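(* Let $R,S$ be symmetries in $(\mathscr{A},\tau)$ with $\tau(R)=\alpha$, $\tau(S)=\beta$, let $(U_t)_{t\ge 0}$ be a free unitary Brownian motion freely independent from $\{R,S\}$, and let $H(t,\cdot)$ be the Herglotz transform of the spectral distribution $\nu_t$ of $RU_tSU_t^*$. Put $a=\frac{|\alpha-\beta|}2$, $b=\frac{|\alpha+\beta|}2$ and $$K(t,z):=\sqrt{H(t,z)^2-\left(a\frac{1-z}{1+z}+b\frac{1+z}{1-z}\right)^2},\qquad |z|<1,$$ with the principal branch of the square root. Let $\phi_t:\Omega_t\to\mathbb{D}$ be the conformal maps solving the radial Löwner equation $\partial_t\phi_t=\phi_tH(t,\phi_t)$, $\phi_0(z)=z$, and let $\eta_t:\mathbb{D}\to\Omega_t$ be the inverse of $\phi_t$. Then $$K(t,z)=K(0,\eta_t(z))\qquad\text{for all } z\in\mathbb{D},\ t\ge0 .$$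
   Context: $(\mathscr{A},\tau)$ is a $W^*$-probability space; a symmetry is a self-adjoint unitary. $(U_t)_{t\ge0}$, $U_0=\mathbf 1$, solves $dU_t=iU_t\,dB_t-\tfrac12U_t\,dt$ with $(B_t)$ a free additive (semicircular) Brownian motion, $\tau(B_t^2)=t$. $\mathbb{D}$ is the open unit disc. $H(t,z)=\int_{\mathbb T}\frac{\zeta+z}{\zeta-z}d\nu_t(\zeta)$ for $z\in\mathbb{D}$. $\Omega_t=\{z\in\mathbb{D}:T_z>t\}$, where $T_z$ is the supremum of all $t$ such that $\phi_s(z)$ exists and stays in $\mathbb{D}$ up to time $t$; $\phi_t$ maps $\Omega_t$ conformally onto $\mathbb{D}$. *)

theory Defs
  imports "HOL-Probability.Probability" "HOL-Complex_Analysis.Complex_Analysis"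
begin

section \<open>$W^*$-probability spaces\<close>

text \<open>Unital, non-zero $C^*$-algebras. The adjoint is \<open>star\<close>; the complex scalar
  multiplication extends the real one of the underlying Banach algebra.\<close>

class cstar_algebra = real_normed_algebra_1 + banach +
  fixes scaleC :: "complex \<Rightarrow> 'a \<Rightarrow> 'a"  (infixr \<open>*\<^sub>C\<close> 75)
    and star :: "'a \<Rightarrow> 'a"
  assumes scaleC_add_right: "c *\<^sub>C (x + y) = c *\<^sub>C x + c *\<^sub>C y"
    and scaleC_add_left: "(c + d) *\<^sub>C x = c *\<^sub>C x + d *\<^sub>C x"
    and scaleC_scaleC: "c *\<^sub>C d *\<^sub>C x = (c * d) *\<^sub>C x"
    and scaleC_of_real: "complex_of_real r *\<^sub>C x = r *\<^sub>R x"
    and mult_scaleC_left: "(c *\<^sub>C x) * y = c *\<^sub>C (x * y)"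
    and mult_scaleC_right: "x * (c *\<^sub>C y) = c *\<^sub>C (x * y)"
    and norm_scaleC: "norm (c *\<^sub>C x) = cmod c * norm x"
    and star_add: "star (x + y) = star x + star y"
    and star_scaleC: "star (c *\<^sub>C x) = cnj c *\<^sub>C star x"
    and star_mult: "star (x * y) = star y * star x"
    and star_star: "star (star x) = x"
    and cstar_identity: "norm (star x * x) = (norm x)\<^sup>2"

text \<open>Following Sakai, a $W^*$-algebra is a $C^*$-algebra that is the dual of a Banach space.
  The predual is represented as a norm-closed complex subspace \<open>P\<close> of the dual of the algebra;
  the last two conjuncts say that evaluation is an isometric isomorphism of the algebra onto
  the Banach dual of \<open>P\<close>. Elements of \<open>P\<close> are the normal functionals.\<close>

definition predual :: "('a::cstar_algebra \<Rightarrow>\<^sub>L complex) set \<Rightarrow> bool" where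
  "predual P \<longleftrightarrow>
     (\<forall>f\<in>P. \<forall>c x. blinfun_apply f (c *\<^sub>C x) = c * blinfun_apply f x) \<and>
     0 \<in> P \<and> (\<forall>f\<in>P. \<forall>g\<in>P. f + g \<in> P) \<and>
     (\<forall>f\<in>P. \<forall>c. blinfun_mult_right c o\<^sub>L f \<in> P) \<and>
     closed P \<and>
     (\<forall>x. norm x = (SUP f\<in>{f\<in>P. norm f \<le> 1}. cmod (blinfun_apply f x))) \<and>
     (\<forall>F :: ('a \<Rightarrow>\<^sub>L complex) \<Rightarrow> complex.
        (\<forall>f\<in>P. \<forall>g\<in>P. F (f + g) = F f + F g) \<and>
        (\<forall>f\<in>P. \<forall>c. F (blinfun_mult_right c o\<^sub>L f) = c * F f) \<and>
        (\<exists>M. \<forall>f\<in>P. cmod (F f) \<le> M * norm f)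
        \<longrightarrow> (\<exists>x. \<forall>f\<in>P. F f = blinfun_apply f x))"

text \<open>A $W^*$-algebra with a faithful normal tracial state.\<close>

locale wstar_probability_space =
  fixes P :: "('a::cstar_algebra \<Rightarrow>\<^sub>L complex) set" and \<tau> :: "'a \<Rightarrow>\<^sub>L complex"
  assumes predual: "predual P"
    and normal: "\<tau> \<in> P"
    and unital: "\<tau> 1 = 1"
    and positive: "\<tau> (star x * x) \<in> \<real>\<^sub>\<ge>\<^sub>0"
    and faithful: "\<tau> (star x * x) = 0 \<Longrightarrow> x = 0"
    and tracial: "\<tau> (x * y) = \<tau> (y * x)"

definition selfadjoint :: "'a::cstar_algebra \<Rightarrow> bool" where
  "selfadjoint x \<longleftrightarrow> star x = x"

definition unitary :: "'a::cstar_algebra \<Rightarrow> bool" where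
  "unitary u \<longleftrightarrow> star u * u = 1 \<and> u * star u = 1"

definition symmetry :: "'a::cstar_algebra \<Rightarrow> bool" where
  "symmetry x \<longleftrightarrow> selfadjoint x \<and> unitary x"

definition l2_norm :: "('a::cstar_algebra \<Rightarrow>\<^sub>L complex) \<Rightarrow> 'a \<Rightarrow> real" where
  "l2_norm \<tau> x = sqrt (Re (\<tau> (star x * x)))"

definition star_subalgebra :: "'a::cstar_algebra set \<Rightarrow> bool" where
  "star_subalgebra A \<longleftrightarrow>
     1 \<in> A \<and> (\<forall>x\<in>A. \<forall>y\<in>A. x + y \<in> A) \<and> (\<forall>x\<in>A. \<forall>y\<in>A. x * y \<in> A) \<and>
     (\<forall>x\<in>A. \<forall>c. c *\<^sub>C x \<in> A) \<and> (\<forall>x\<in>A. star x \<in> A)"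

definition weak_star_closed :: "('a::cstar_algebra \<Rightarrow>\<^sub>L complex) set \<Rightarrow> 'a set \<Rightarrow> bool" where
  "weak_star_closed P A \<longleftrightarrow>
     (\<forall>x. (\<forall>F \<epsilon>. finite F \<and> F \<subseteq> P \<and> \<epsilon> > 0 \<longrightarrow>
             (\<exists>y\<in>A. \<forall>f\<in>F. cmod (blinfun_apply f y - blinfun_apply f x) < \<epsilon>)) \<longrightarrow> x \<in> A)"

definition wstar_subalgebra :: "('a::cstar_algebra \<Rightarrow>\<^sub>L complex) set \<Rightarrow> 'a set \<Rightarrow> bool" where
  "wstar_subalgebra P A \<longleftrightarrow> star_subalgebra A \<and> weak_star_closed P A"


section \<open>Freeness\<close>

text \<open>A word is a list of letters, each tagged with the index of the algebra it is taken from.\<close>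

definition free_algebras ::
  "('a::cstar_algebra \<Rightarrow>\<^sub>L complex) \<Rightarrow> ('i \<Rightarrow> 'a set) \<Rightarrow> bool" where
  "free_algebras \<tau> A \<longleftrightarrow>
     (\<forall>w :: ('i \<times> 'a) list.
        w \<noteq> [] \<and> (\<forall>(i, x)\<in>set w. x \<in> A i \<and> \<tau> x = 0) \<and> distinct_adj (map fst w)
        \<longrightarrow> \<tau> (prod_list (map snd w)) = 0)"

definition free_sets :: "('a::cstar_algebra \<Rightarrow>\<^sub>L complex) \<Rightarrow> 'a set \<Rightarrow> 'a set \<Rightarrow> bool" where
  "free_sets \<tau> X Y \<longleftrightarrow>
     free_algebras \<tau> (\<lambda>b. star_subalgebra hull (if b then X else Y))"


section \<open>Free additive and free unitary Brownian motion\<close>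

text \<open>The distribution of \<open>x\<close> is the centred semicircle law of variance \<open>v > 0\<close>.\<close>

definition semicircular :: "('a::cstar_algebra \<Rightarrow>\<^sub>L complex) \<Rightarrow> real \<Rightarrow> 'a \<Rightarrow> bool" where
  "semicircular \<tau> v x \<longleftrightarrow> selfadjoint x \<and>
     (\<forall>n. \<tau> (x ^ n) = of_real
        (integral {-2 * sqrt v..2 * sqrt v} (\<lambda>s. s ^ n * (sqrt (4 * v - s\<^sup>2) / (2 * pi * v)))))"

definition filtration ::
  "('a::cstar_algebra \<Rightarrow>\<^sub>L complex) set \<Rightarrow> (real \<Rightarrow> 'a set) \<Rightarrow> bool" where
  "filtration P \<A> \<longleftrightarrow>
     (\<forall>t\<ge>0. wstar_subalgebra P (\<A> t)) \<and> (\<forall>s t. 0 \<le> s \<and> s \<le> t \<longrightarrow> \<A> s \<subseteq> \<A> t)"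

definition free_brownian_motion ::
  "('a::cstar_algebra \<Rightarrow>\<^sub>L complex) \<Rightarrow> (real \<Rightarrow> 'a set) \<Rightarrow> (real \<Rightarrow> 'a) \<Rightarrow> bool" where
  "free_brownian_motion \<tau> \<A> B \<longleftrightarrow>
     B 0 = 0 \<and> (\<forall>t\<ge>0. selfadjoint (B t) \<and> B t \<in> \<A> t) \<and>
     (\<forall>s t. 0 \<le> s \<and> s < t \<longrightarrow>
        semicircular \<tau> (t - s) (B t - B s) \<and> free_sets \<tau> {B t - B s} (\<A> s))"

text \<open>\<open>has_free_ito_integral \<tau> X B t Y\<close> means $\int_0^t X_s\,dB_s = Y$. For norm-continuous adapted
  \<open>X\<close> the left-endpoint Riemann sums are the integrals of simple adapted processes converging
  to \<open>X\<close>, so by the Ito isometry their limit in $L^2(\tau)$ is the stochastic integral.\<close>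

definition has_free_ito_integral ::
  "('a::cstar_algebra \<Rightarrow>\<^sub>L complex) \<Rightarrow> (real \<Rightarrow> 'a) \<Rightarrow> (real \<Rightarrow> 'a) \<Rightarrow> real \<Rightarrow> 'a \<Rightarrow> bool" where
  "has_free_ito_integral \<tau> X B t Y \<longleftrightarrow>
     (\<forall>\<epsilon>>0. \<exists>\<delta>>0. \<forall>(n::nat) p.
        p 0 = 0 \<and> p n = t \<and> (\<forall>i<n. p i \<le> p (Suc i) \<and> p (Suc i) - p i < \<delta>) \<longrightarrow>
        l2_norm \<tau> ((\<Sum>i<n. X (p i) * (B (p (Suc i)) - B (p i))) - Y) < \<epsilon>)"

text \<open>Norm-continuous adapted unitary solutions of $dU_t = i U_t\,dB_t - \frac12 U_t\,dt$,
  $U_0 = 1$, in integrated form.\<close>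

definition free_unitary_brownian_motion ::
  "('a::cstar_algebra \<Rightarrow>\<^sub>L complex) set \<Rightarrow> ('a \<Rightarrow>\<^sub>L complex) \<Rightarrow> (real \<Rightarrow> 'a) \<Rightarrow> bool" where
  "free_unitary_brownian_motion P \<tau> U \<longleftrightarrow>
     (\<exists>\<A> B. filtration P \<A> \<and> free_brownian_motion \<tau> \<A> B \<and>
        U 0 = 1 \<and> continuous_on {0..} U \<and> (\<forall>t\<ge>0. unitary (U t) \<and> U t \<in> \<A> t) \<and>
        (\<forall>t\<ge>0. \<exists>Y. has_free_ito_integral \<tau> U B t Y \<and>
                   U t = U 0 + \<i> *\<^sub>C Y - (1/2) *\<^sub>R integral {0..t} U))"


section \<open>Spectral distributions and Herglotz transforms\<close>

text \<open>For unitary \<open>u\<close>; the moments of negative order are the conjugates of those of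
  positive order.\<close>

definition spectral_distribution ::
  "('a::cstar_algebra \<Rightarrow>\<^sub>L complex) \<Rightarrow> 'a \<Rightarrow> complex measure \<Rightarrow> bool" where
  "spectral_distribution \<tau> u \<nu> \<longleftrightarrow>
     prob_space \<nu> \<and> sets \<nu> = sets borel \<and> (AE \<zeta> in \<nu>. \<zeta> \<in> sphere 0 1) \<and>
     (\<forall>n. \<tau> (u ^ n) = (\<integral>\<zeta>. \<zeta> ^ n \<partial>\<nu>))"

definition herglotz :: "complex measure \<Rightarrow> complex \<Rightarrow> complex" where
  "herglotz \<nu> z = (\<integral>\<zeta>. (\<zeta> + z) / (\<zeta> - z) \<partial>\<nu>)"

text \<open>\<open>csqrt\<close> is the principal branch of the square root.\<close>

definition K_transform ::
  "real \<Rightarrow> real \<Rightarrow> (real \<Rightarrow> complex \<Rightarrow> complex) \<Rightarrow> real \<Rightarrow> complex \<Rightarrow> complex" where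
  "K_transform a b H t z =
     csqrt ((H t z)\<^sup>2 - (of_real a * ((1 - z) / (1 + z)) + of_real b * ((1 + z) / (1 - z)))\<^sup>2)"


section \<open>The radial Loewner equation\<close>

definition loewner_solution ::
  "(real \<Rightarrow> complex \<Rightarrow> complex) \<Rightarrow> real \<Rightarrow> complex \<Rightarrow> (real \<Rightarrow> complex) \<Rightarrow> bool" where
  "loewner_solution H t z y \<longleftrightarrow>
     y 0 = z \<and>
     (\<forall>s\<in>{0..t}. y s \<in> ball 0 1 \<and>
        (y has_vector_derivative y s * H s (y s)) (at s within {0..t}))"

definition loewner_lifetime :: "(real \<Rightarrow> complex \<Rightarrow> complex) \<Rightarrow> complex \<Rightarrow> ereal" where
  "loewner_lifetime H z = Sup {ereal t |t. t \<ge> 0 \<and> (\<exists>y. loewner_solution H t z y)}"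

definition loewner_domain :: "(real \<Rightarrow> complex \<Rightarrow> complex) \<Rightarrow> real \<Rightarrow> complex set" where
  "loewner_domain H t = {z \<in> ball 0 1. loewner_lifetime H z > ereal t}"

text \<open>\<open>\<phi> t z\<close> is only meaningful for \<open>z \<in> loewner_domain H t\<close>. A point of the domain at time
  \<open>t\<close> belongs to it at all times in a neighbourhood of \<open>t\<close>, so the derivative
  does not depend on values outside of the domains.\<close>

definition radial_loewner_flow ::
  "(real \<Rightarrow> complex \<Rightarrow> complex) \<Rightarrow> (real \<Rightarrow> complex \<Rightarrow> complex) \<Rightarrow> bool" where
  "radial_loewner_flow H \<phi> \<longleftrightarrow>
     (\<forall>z\<in>ball 0 1. \<phi> 0 z = z) \<and>
     (\<forall>t\<ge>0. \<forall>z\<in>loewner_domain H t. \<phi> t z \<in> ball 0 1 \<and>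
        ((\<lambda>s. \<phi> s z) has_vector_derivative \<phi> t z * H t (\<phi> t z)) (at t within {0..}))"

definition conformal_onto :: "(complex \<Rightarrow> complex) \<Rightarrow> complex set \<Rightarrow> complex set \<Rightarrow> bool" where
  "conformal_onto f X Y \<longleftrightarrow> open X \<and> f holomorphic_on X \<and> bij_betw f X Y"

end

theory Submission
  imports Defs
begin

text \<open>Put \<open>A\<^sub>t = R U\<^sub>t S U\<^sub>t\<^sup>*\<close> and \<open>f\<^sub>n(t) = \<tau>(A\<^sub>t\<^sup>n)\<close>. Over a short time \<open>h\<close> the increment of
  \<open>U\<close> is \<open>D = i U\<^sub>t (B\<^sub>t\<^sub>+\<^sub>h - B\<^sub>t) + o(\<surd>h)\<close> in \<open>L\<^sup>2\<close>, by the Ito isometry, while \<open>\<tau>(c D) = -h/2 \<tau>(c U\<^sub>t) + o(h)\<close>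
  for \<open>c\<close> in the past, because the stochastic integral is a martingale. Freeness of \<open>{R, S}\<close> from \<open>U\<close>
  extends both expansions to coefficients in the algebra generated by \<open>R, S, U\<^sub>t\<close>. Expanding \<open>A\<^sub>t\<^sub>+\<^sub>h\<^sup>n\<close>
  to second order (the cubic remainder is \<open>o(h)\<close> since \<open>U\<close> is norm continuous) gives
  \<open>f\<^sub>n' = n (f\<^sub>n - \<Sum>\<^sub>k f\<^sub>k f\<^sub>n\<^sub>-\<^sub>k) + n\<^sup>2 (b\<^sup>2 + (-1)\<^sup>n a\<^sup>2)\<close>, that is
  \<open>\<partial>\<^sub>t H + z H \<partial>\<^sub>z H = z G G'\<close> with \<open>G(z) = a (1 - z) / (1 + z) + b (1 + z) / (1 - z)\<close>. The Loewner flow is the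
  characteristic flow of this equation, and \<open>H\<^sup>2 - G\<^sup>2\<close> is constant along it; no question about the
  branch of the square root arises.\<close>

section \<open>Adjoints and the trace norm\<close>

text \<open>Freeness is given between the process \<open>U\<close> and \<open>{R, S}\<close>, and
  between an increment of \<open>B\<close> and the past; nothing relates \<open>B\<close> or the
  filtration to \<open>R\<close> and \<open>S\<close>. So the expansion of \<open>D\<close> cannot
  simply be inserted into words containing \<open>R\<close> and \<open>S\<close>. The limits of
  \<open>\<tau> (c * D h) / h\<close> and its quadratic analogues are computed for coefficients that
  are both adapted and generated by \<open>U\<close>; freeness from \<open>{R, S}\<close>, applied
  to \<open>D h\<close> itself, then carries them over to the larger algebra. The Ito isometry
  controls errors in L2 only, and the trace of a product absorbs just two L2 factors. A third small
  factor must be small in operator norm, which is where norm continuity of \<open>U\<close> enters.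
  As increments look forward in time, the moments first get right derivatives only. The source term
  of the moment equation has its origin in a symmetry: conjugation by \<open>R\<close> maps
  \<open>A t\<close> to its adjoint, which freezes the trace of \<open>A t ^ n * R\<close> at
  \<alpha> or \<beta> for all times, so the equations close in the moments of \<open>A t\<close>
  alone.\<close>

lemma scaleC_minus1: "(-1::complex) *\<^sub>C x = - (x::'a::cstar_algebra)"
  using scaleC_of_real[of "-1" x] by simp

lemma scaleC_one: "(1::complex) *\<^sub>C x = (x::'a::cstar_algebra)"
  using scaleC_of_real[of 1 x] by simp

lemma scaleC_zero_left: "(0::complex) *\<^sub>C x = (0::'a::cstar_algebra)"
  using scaleC_of_real[of 0 x] by simp

lemma star_zero [simp]: "star (0::'a::cstar_algebra) = 0"
  using star_add[of "0::'a" 0] by simp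

lemma star_minus: "star (- x) = - star (x::'a::cstar_algebra)"
  using star_scaleC[of "-1" x] by (simp add: scaleC_minus1)

lemma star_diff: "star (x - y) = star x - star (y::'a::cstar_algebra)"
  using star_add[of x "-y"] by (simp add: star_minus)

lemma star_one [simp]: "star (1::'a::cstar_algebra) = 1"
proof -
  have "star (1 * star (1::'a)) = 1 * star 1"
    by (simp only: star_mult star_star)
  then show ?thesis
    by (simp only: mult_1_left star_star)
qed

lemma star_scaleR: "star (r *\<^sub>R x) = r *\<^sub>R star (x::'a::cstar_algebra)"
  using star_scaleC[of "complex_of_real r" x] by (simp add: scaleC_of_real)

lemma star_power: "star (x ^ n) = star (x::'a::cstar_algebra) ^ n"
  by (induction n) (simp_all add: star_mult power_commutes)

text \<open>By the C*-identity, \<open>norm y\<close> squared is at most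
  \<open>norm (star y) * norm y\<close>; this is used for \<open>x\<close> and for
  \<open>star x\<close>.\<close>

lemma norm_star [simp]: "norm (star x) = norm (x::'a::cstar_algebra)"
proof -
  have *: "norm y \<le> norm (star y)" for y :: 'a
  proof (cases "y = 0")
    case False
    have "norm y * norm y \<le> norm (star y) * norm y"
      using norm_mult_ineq[of "star y" y] by (simp add: cstar_identity power2_eq_square)
    then show ?thesis
      using False by simp
  qed simp
  from *[of x] *[of "star x"] show ?thesis
    by (simp add: star_star)
qed

lemma bounded_linear_star: "bounded_linear (star :: 'a::cstar_algebra \<Rightarrow> 'a)"
  by (rule bounded_linear_intro[where K = 1]) (simp_all add: star_add star_scaleR)

lemma bounded_linear_scaleC: "bounded_linear (\<lambda>x::'a::cstar_algebra. c *\<^sub>C x)"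
proof (rule bounded_linear_intro[where K = "cmod c"])
  fix r and x :: 'a
  show "c *\<^sub>C r *\<^sub>R x = r *\<^sub>R c *\<^sub>C x"
    by (simp add: scaleC_of_real[symmetric] scaleC_scaleC mult.commute)
qed (simp_all add: scaleC_add_right norm_scaleC mult.commute)

lemma scaleC_diff_right: "c *\<^sub>C (x - y) = c *\<^sub>C x - c *\<^sub>C (y::'a::cstar_algebra)"
  by (rule linear_diff[OF bounded_linear.linear[OF bounded_linear_scaleC]])

lemma unitary_norm:
  assumes "unitary (u::'a::cstar_algebra)"
  shows "norm u = 1"
proof -
  have "(norm u)\<^sup>2 = 1\<^sup>2"
    using cstar_identity[of u] assms by (simp add: unitary_def)
  then show ?thesis
    by (simp only: power2_eq_iff_nonneg[OF norm_ge_zero zero_le_one])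
qed

lemma unitary_star: "unitary (u::'a::cstar_algebra) \<Longrightarrow> unitary (star u)"
  by (simp add: unitary_def star_star)

lemma unitary_mult: "unitary (u::'a::cstar_algebra) \<Longrightarrow> unitary v \<Longrightarrow> unitary (u * v)"
proof -
  assume *: "unitary u" "unitary v"
  have "star (u * v) * (u * v) = star v * (star u * u) * v"
    and "u * v * star (u * v) = u * (v * star v) * star u"
    by (simp_all add: star_mult mult.assoc)
  with * show ?thesis
    by (simp add: unitary_def)
qed

lemma symmetry_star: "symmetry x \<Longrightarrow> star x = x"
  and symmetry_unitary: "symmetry x \<Longrightarrow> unitary x"
  and symmetry_square: "symmetry x \<Longrightarrow> x * x = 1"
  by (auto simp: symmetry_def selfadjoint_def unitary_def)

section \<open>The L2 inner product of the trace\<close>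

context wstar_probability_space
begin

abbreviation N where "N \<equiv> l2_norm \<tau>"

lemma tau_scaleC: "\<tau> (c *\<^sub>C x) = c * \<tau> x"
  using predual normal unfolding predual_def by blast

lemma tau_add: "\<tau> (x + y) = \<tau> x + \<tau> y"
  and tau_diff: "\<tau> (x - y) = \<tau> x - \<tau> y"
  and tau_minus: "\<tau> (- x) = - \<tau> x"
  by (simp_all add: blinfun.bilinear_simps)

lemma tau_scaleR: "\<tau> (r *\<^sub>R x) = of_real r * \<tau> x"
  using tau_scaleC[of "of_real r" x] by (simp only: scaleC_of_real)

lemma tau_square: "\<tau> (star x * x) = of_real (Re (\<tau> (star x * x)))"
  and tau_square_nonneg: "0 \<le> Re (\<tau> (star x * x))"
  using positive[of x] by (auto simp: nonneg_Reals_def)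

text \<open>Positivity for \<open>x + c *\<^sub>C 1\<close> makes
  \<open>c * \<tau> (star x) + cnj c * \<tau> x\<close> real for every \<open>c\<close>; the values
  1 and \<i> of \<open>c\<close> determine \<open>\<tau> (star x)\<close>.\<close>

lemma tau_star: "\<tau> (star x) = cnj (\<tau> x)"
proof -
  have im: "Im (c * \<tau> (star x) + cnj c * \<tau> x) = 0" for c
  proof -
    have "star (x + c *\<^sub>C 1) * (x + c *\<^sub>C 1)
        = star x * x + c *\<^sub>C star x + cnj c *\<^sub>C x + (c * cnj c) *\<^sub>C 1"
      by (simp add: star_add star_scaleC distrib_left distrib_right mult_scaleC_left
          mult_scaleC_right scaleC_scaleC scaleC_add_right add_ac)
    then have "\<tau> (star (x + c *\<^sub>C 1) * (x + c *\<^sub>C 1))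
        = \<tau> (star x * x) + (c * \<tau> (star x) + cnj c * \<tau> x) + c * cnj c"
      by (simp add: tau_add tau_scaleC unital)
    moreover have "Im (\<tau> (star y * y)) = 0" for y
      by (subst tau_square) simp
    moreover have "Im (c * cnj c) = 0"
      by simp
    ultimately show ?thesis
      by (metis (no_types) add.right_neutral add_0 plus_complex.sel(2))
  qed
  show ?thesis
    using im[of 1] im[of \<i>] by (auto simp: complex_eq_iff)
qed

lemma N_nonneg [simp]: "0 \<le> N x"
  by (simp add: l2_norm_def tau_square_nonneg)

lemma N_square: "(N x)\<^sup>2 = Re (\<tau> (star x * x))"
  by (simp add: l2_norm_def tau_square_nonneg)

lemma tau_N_square: "\<tau> (star x * x) = of_real ((N x)\<^sup>2)"
  using tau_square[of x] by (simp add: N_square)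

lemma N_zero_iff: "N x = 0 \<longleftrightarrow> x = 0"
proof
  assume "N x = 0"
  then show "x = 0"
    using tau_N_square[of x] faithful[of x] by simp
qed (simp add: l2_norm_def)

lemma N_star: "N (star x) = N x"
  using tracial[of x "star x"] by (simp add: l2_norm_def star_star)

lemma N_scaleC: "N (c *\<^sub>C x) = cmod c * N x"
proof -
  have "star (c *\<^sub>C x) * (c *\<^sub>C x) = (cnj c * c) *\<^sub>C (star x * x)"
    by (simp add: star_scaleC mult_scaleC_left mult_scaleC_right scaleC_scaleC mult.commute)
  moreover have "cnj c * c = of_real ((cmod c)\<^sup>2)"
    using complex_norm_square[of c] by (simp add: mult.commute)
  ultimately have "(N (c *\<^sub>C x))\<^sup>2 = (cmod c * N x)\<^sup>2"
    by (simp add: N_square tau_scaleC power_mult_distrib del: of_real_power)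
  then show ?thesis
    by (simp add: power2_eq_iff_nonneg)
qed

lemma N_minus: "N (- x) = N x"
  using N_scaleC[of "-1" x] by (simp add: scaleC_minus1)

lemma N_add_square: "(N (x + y))\<^sup>2 = (N x)\<^sup>2 + 2 * Re (\<tau> (star x * y)) + (N y)\<^sup>2"
proof -
  have "\<tau> (star y * x) = cnj (\<tau> (star x * y))"
    using tau_star[of "star x * y"] by (simp add: star_mult star_star)
  then show ?thesis
    by (simp add: N_square star_add distrib_left distrib_right tau_add)
qed

lemma Cauchy_Schwarz: "cmod (\<tau> (star x * y)) \<le> N x * N y"
proof (cases "y = 0")
  case False
  then have pos: "N y > 0"
    using N_zero_iff[of y] by (simp add: less_le)
  let ?k = "\<tau> (star x * y)"
  \<comment> \<open>The minimiser of \<open>N (x + c *\<^sub>C y)\<close> over all scalars.\<close>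
  define c where "c = - cnj ?k / of_real ((N y)\<^sup>2)"
  have "0 \<le> (N (x + c *\<^sub>C y))\<^sup>2"
    by simp
  also have "\<dots> = (N x)\<^sup>2 + 2 * Re (c * ?k) + (cmod c)\<^sup>2 * (N y)\<^sup>2"
    by (simp add: N_add_square mult_scaleC_right tau_scaleC N_scaleC power_mult_distrib)
  also have "c * ?k = - of_real ((cmod ?k)\<^sup>2 / (N y)\<^sup>2)"
    by (simp add: c_def complex_norm_square[of ?k] mult.commute del: of_real_power)
  also have "cmod c = cmod ?k / (N y)\<^sup>2"
    using pos by (simp add: c_def norm_divide norm_power)
  also have "(N x)\<^sup>2 + 2 * Re (- of_real ((cmod ?k)\<^sup>2 / (N y)\<^sup>2)) + (cmod ?k / (N y)\<^sup>2)\<^sup>2 * (N y)\<^sup>2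
      = (N x)\<^sup>2 - (cmod ?k)\<^sup>2 / (N y)\<^sup>2"
    using pos by (simp add: field_simps power2_eq_square)
  finally have "(cmod ?k)\<^sup>2 \<le> (N x * N y)\<^sup>2"
    using pos by (simp add: field_simps power_mult_distrib)
  then show ?thesis
    by (rule power2_le_imp_le) simp
qed simp

lemma Cauchy_Schwarz': "cmod (\<tau> (x * y)) \<le> N x * N y"
  using Cauchy_Schwarz[of "star x" y] by (simp add: star_star N_star)

lemma N_triangle: "N (x + y) \<le> N x + N y"
proof (rule power2_le_imp_le)
  have "Re (\<tau> (star x * y)) \<le> N x * N y"
    using Cauchy_Schwarz[of x y] complex_Re_le_cmod[of "\<tau> (star x * y)"] by linarith
  then show "(N (x + y))\<^sup>2 \<le> (N x + N y)\<^sup>2"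
    by (simp add: N_add_square power2_sum)
qed simp

lemma N_triangle_diff: "N (x - y) \<le> N x + N y"
  using N_triangle[of x "- y"] by (simp add: N_minus)

text \<open>Without functional calculus: iterating Cauchy-Schwarz bounds the \<open>2 ^ k\<close>-th power of the
  quotient of both sides by a constant.\<close>

lemma N_mult_left: "N (x * y) \<le> norm x * N y"
proof (cases "x = 0 \<or> y = 0")
  case True
  then show ?thesis
    using N_zero_iff[of 0] by auto
next
  case False
  define s where "s = star x * x"
  have star_s: "star s = s"
    by (simp add: s_def star_mult star_star)
  define f where "f k = Re (\<tau> (star y * s ^ k * y))" for k
  have f0: "f 0 = (N y)\<^sup>2"
    by (simp add: f_def N_square)
  have f1: "f 1 = (N (x * y))\<^sup>2"
    by (simp add: f_def N_square star_mult s_def mult.assoc)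
  have pos: "f 0 > 0"
    using False N_zero_iff[of y] by (simp add: f0)
  \<comment> \<open>Cauchy-Schwarz for \<open>y\<close> and \<open>s ^ k * y\<close>;
    self-adjointness of \<open>s\<close> turns the squared norm of the latter into
    \<open>f (2 * k)\<close>.\<close>
  have sq: "(f k)\<^sup>2 \<le> f 0 * f (2 * k)" for k
  proof -
    have "\<bar>f k\<bar> \<le> cmod (\<tau> (star y * (s ^ k * y)))"
      unfolding f_def mult.assoc by (rule abs_Re_le_cmod)
    also have "\<dots> \<le> N y * N (s ^ k * y)"
      by (rule Cauchy_Schwarz)
    finally have "\<bar>f k\<bar>\<^sup>2 \<le> (N y * N (s ^ k * y))\<^sup>2"
      by (rule power_mono) simp
    moreover have "(N (s ^ k * y))\<^sup>2 = f (2 * k)"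
      by (simp add: N_square f_def star_mult star_power star_s mult.assoc mult_2 power_add)
    ultimately show ?thesis
      by (simp add: f0 power_mult_distrib)
  qed
  define K where "K = norm \<tau> * (norm y)\<^sup>2"
  have bound: "f k \<le> K * ((norm x)\<^sup>2) ^ k" for k
  proof -
    have "f k \<le> cmod (\<tau> (star y * s ^ k * y))"
      unfolding f_def by (rule complex_Re_le_cmod)
    also have "\<dots> \<le> norm \<tau> * norm (star y * s ^ k * y)"
      by (rule norm_blinfun)
    also have "\<dots> \<le> norm \<tau> * (norm y * norm s ^ k * norm y)"
      by (intro mult_left_mono order_trans[OF norm_mult_ineq] mult_mono norm_power_ineq) auto
    finally show ?thesis
      by (simp add: K_def s_def cstar_identity power2_eq_square mult_ac)
  qed
  define \<rho> where "\<rho> = f 1 / f 0"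
  have iter: "\<rho> ^ (2 ^ k) \<le> f (2 ^ k) / f 0" for k
  proof (induction k)
    case (Suc k)
    have "0 \<le> \<rho>"
      unfolding \<rho>_def f1 using pos by simp
    then have "(\<rho> ^ 2 ^ k)\<^sup>2 \<le> (f (2 ^ k) / f 0)\<^sup>2"
      by (intro power_mono Suc) simp
    also have "\<dots> \<le> f (2 * 2 ^ k) / f 0"
      using sq[of "2 ^ k"] pos by (simp add: field_simps power2_eq_square)
    finally show ?case
      by (simp add: power_mult[symmetric] mult.commute)
  qed (simp add: \<rho>_def)
  have "\<rho> \<le> (norm x)\<^sup>2"
  proof (rule ccontr)
    assume "\<not> ?thesis"
    then have gt: "\<rho> / (norm x)\<^sup>2 > 1"
      using False by (simp add: field_simps)
    obtain n where n: "K / f 0 < (\<rho> / (norm x)\<^sup>2) ^ n"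
      using real_arch_pow[OF gt] by blast
    have "(\<rho> / (norm x)\<^sup>2) ^ n \<le> (\<rho> / (norm x)\<^sup>2) ^ (2 ^ n)"
      using gt by (intro power_increasing) (auto intro: less_imp_le[OF less_exp])
    also have "\<dots> \<le> (f (2 ^ n) / f 0) / ((norm x)\<^sup>2) ^ (2 ^ n)"
      unfolding power_divide using iter[of n] by (intro divide_right_mono) auto
    also have "\<dots> \<le> (K * ((norm x)\<^sup>2) ^ (2 ^ n) / f 0) / ((norm x)\<^sup>2) ^ (2 ^ n)"
      using bound[of "2 ^ n"] pos by (intro divide_right_mono) auto
    also have "\<dots> = K / f 0"
      using False by simp
    finally show False
      using n by simp
  qed
  then have "(N (x * y))\<^sup>2 \<le> (norm x * N y)\<^sup>2"
    using pos unfolding \<rho>_def f0 f1 by (simp add: field_simps power_mult_distrib)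
  then show ?thesis
    by (rule power2_le_imp_le) simp
qed

text \<open>By traciality \<open>N\<close> is invariant under \<open>star\<close>, and adjoints
  exchange the two sides of a product.\<close>

lemma N_mult_right: "N (x * y) \<le> N x * norm y"
  using N_mult_left[of "star y" "star x"] N_star[of "x * y"]
  by (simp add: star_mult N_star mult.commute)

lemma N_le_norm: "N x \<le> norm x"
  using N_mult_left[of x 1] by (simp add: l2_norm_def unital)

end

section \<open>Free increments and the Ito isometry\<close>

lemma star_subalgebra_one: "star_subalgebra A \<Longrightarrow> 1 \<in> A"
  and star_subalgebra_add: "star_subalgebra A \<Longrightarrow> x \<in> A \<Longrightarrow> y \<in> A \<Longrightarrow> x + y \<in> A"
  and star_subalgebra_mult: "star_subalgebra A \<Longrightarrow> x \<in> A \<Longrightarrow> y \<in> A \<Longrightarrow> x * y \<in> A"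
  and star_subalgebra_scaleC: "star_subalgebra A \<Longrightarrow> x \<in> A \<Longrightarrow> c *\<^sub>C x \<in> A"
  and star_subalgebra_star: "star_subalgebra A \<Longrightarrow> x \<in> A \<Longrightarrow> star x \<in> A"
  by (auto simp: star_subalgebra_def)

lemma star_subalgebra_zero: "star_subalgebra A \<Longrightarrow> 0 \<in> A"
  using star_subalgebra_scaleC[of A 1 0] star_subalgebra_one[of A] by (simp add: scaleC_zero_left)

lemma star_subalgebra_diff:
  assumes "star_subalgebra A" "x \<in> A" "y \<in> A"
  shows "x - y \<in> A"
  using star_subalgebra_add[OF assms(1,2) star_subalgebra_scaleC[OF assms(1,3), of "-1"]]
  by (simp add: scaleC_minus1)

lemma star_subalgebra_power: "star_subalgebra A \<Longrightarrow> x \<in> A \<Longrightarrow> x ^ n \<in> A"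
  by (induction n) (auto intro: star_subalgebra_one star_subalgebra_mult)

lemma star_subalgebra_Int:
  "star_subalgebra A \<Longrightarrow> star_subalgebra A' \<Longrightarrow> star_subalgebra (A \<inter> A')"
  by (auto simp: star_subalgebra_def)

lemma star_subalgebra_hull: "star_subalgebra (star_subalgebra hull X)"
  by (rule hull_in) (auto simp: star_subalgebra_def)

lemmas star_subalgebra_intros = star_subalgebra_one star_subalgebra_add star_subalgebra_mult
  star_subalgebra_scaleC star_subalgebra_star star_subalgebra_diff star_subalgebra_power

text \<open>The function \<open>(4 * v - s\<^sup>2) * w s\<close> and its product with
  \<open>s\<close> vanish at both ends of the interval and have derivatives
  \<open>- 3 * s * w s\<close> and \<open>4 * (v - s\<^sup>2) * w s\<close>. The square root is not
  differentiable at the ends, hence the version of the fundamental theorem for the interior. The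
  total mass stays symbolic: for a semicircular element it is the zeroth moment, which is
  \<open>\<tau> 1\<close>.\<close>

lemma semicircle_moments:
  assumes "v > 0"
  defines "w \<equiv> \<lambda>s. sqrt (4 * v - s\<^sup>2) / (2 * pi * v)"
  shows "integral {-2 * sqrt v..2 * sqrt v} (\<lambda>s. s * w s) = 0"
    and "integral {-2 * sqrt v..2 * sqrt v} (\<lambda>s. s\<^sup>2 * w s)
      = v * integral {-2 * sqrt v..2 * sqrt v} w"
proof -
  let ?I = "{-2 * sqrt v..2 * sqrt v}"
  have w_cont: "continuous_on ?I w"
    unfolding w_def using assms(1) by (intro continuous_intros) auto
  have pos: "4 * v - s\<^sup>2 > 0" if "s \<in> {-2 * sqrt v<..<2 * sqrt v}" for s
  proof -
    have "\<bar>s\<bar> < 2 * sqrt v"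
      using that by auto
    then have "\<bar>s\<bar>\<^sup>2 < (2 * sqrt v)\<^sup>2"
      by (intro power_strict_mono) auto
    then show ?thesis
      using assms(1) by (simp add: power_mult_distrib)
  qed
  have end0: "4 * v - (2 * sqrt v)\<^sup>2 = 0" "4 * v - (-2 * sqrt v)\<^sup>2 = 0"
    using assms(1) by (simp_all add: power_mult_distrib)
  define g where "g s = (4 * v - s\<^sup>2) * w s" for s
  have le: "-2 * sqrt v \<le> 2 * sqrt v"
    using assms(1) by simp
  have g_deriv: "(g has_vector_derivative - 3 * s * w s) (at s)"
    if "s \<in> {-2 * sqrt v<..<2 * sqrt v}" for s
  proof -
    have "sqrt (4 * v - s\<^sup>2) * sqrt (4 * v - s\<^sup>2) = 4 * v - s\<^sup>2"
      using pos[OF that] by simp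
    then have "(4 * v - s\<^sup>2) / sqrt (4 * v - s\<^sup>2) = sqrt (4 * v - s\<^sup>2)"
      using pos[OF that] by (simp add: field_simps)
    then have *: "- s * (4 * v - s\<^sup>2) / sqrt (4 * v - s\<^sup>2) / (2 * pi * v) = - s * w s"
      by (simp add: w_def divide_divide_eq_left[symmetric] times_divide_eq_right[symmetric]
          del: divide_divide_eq_left times_divide_eq_right)
    have "(g has_real_derivative - 2 * s * w s
        - s * (4 * v - s\<^sup>2) / sqrt (4 * v - s\<^sup>2) / (2 * pi * v)) (at s)"
      unfolding g_def w_def using pos[OF that] assms(1)
      by (auto intro!: derivative_eq_intros simp: divide_simps)
    also have "- 2 * s * w s - s * (4 * v - s\<^sup>2) / sqrt (4 * v - s\<^sup>2) / (2 * pi * v) = - 3 * s * w s"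
      using * by simp
    finally show ?thesis
      by (simp add: has_real_derivative_iff_has_vector_derivative)
  qed
  have g_cont: "continuous_on ?I g"
    unfolding g_def by (intro continuous_intros w_cont)
  have g0: "g (2 * sqrt v) = 0" "g (-2 * sqrt v) = 0"
    unfolding g_def end0 by simp_all
  have "((\<lambda>s. - 3 * s * w s) has_integral g (2 * sqrt v) - g (-2 * sqrt v)) ?I"
    by (rule fundamental_theorem_of_calculus_interior[OF le g_cont]) (rule g_deriv)
  then have "((\<lambda>s. (- 1 / 3) * (- 3 * s * w s)) has_integral (- 1 / 3) * 0) ?I"
    unfolding g0 diff_self by (rule has_integral_mult_right)
  then show "integral ?I (\<lambda>s. s * w s) = 0"
    by (simp add: integral_unique)
  have "((\<lambda>s. 4 * (v - s\<^sup>2) * w s) has_integral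
      2 * sqrt v * g (2 * sqrt v) - (-2 * sqrt v) * g (-2 * sqrt v)) ?I"
  proof (rule fundamental_theorem_of_calculus_interior[OF le])
    show "continuous_on ?I (\<lambda>s. s * g s)"
      by (intro continuous_intros g_cont)
    fix s assume "s \<in> {-2 * sqrt v<..<2 * sqrt v}"
    from g_deriv[OF this]
    have "((\<lambda>s. s * g s) has_real_derivative 1 * g s + s * (- 3 * s * w s)) (at s)"
      unfolding has_real_derivative_iff_has_vector_derivative[symmetric]
      by (auto intro!: derivative_eq_intros)
    also have "1 * g s + s * (- 3 * s * w s) = 4 * (v - s\<^sup>2) * w s"
      by (simp add: g_def algebra_simps power2_eq_square)
    finally show "((\<lambda>s. s * g s) has_vector_derivative 4 * (v - s\<^sup>2) * w s) (at s)"
      by (simp add: has_real_derivative_iff_has_vector_derivative)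
  qed
  then have "integral ?I (\<lambda>s. 4 * (v - s\<^sup>2) * w s) = 0"
    unfolding g0 by (simp add: integral_unique)
  moreover have "integral ?I (\<lambda>s. 4 * (v - s\<^sup>2) * w s)
      = integral ?I (\<lambda>s. 4 * (v * w s - s\<^sup>2 * w s))"
    by (simp add: algebra_simps)
  moreover have "\<dots> = 4 * (v * integral ?I w - integral ?I (\<lambda>s. s\<^sup>2 * w s))"
    using w_cont by (subst integral_mult_right, subst integral_diff)
      (auto intro!: integrable_continuous_real continuous_on_mult w_cont continuous_intros)
  ultimately show "integral ?I (\<lambda>s. s\<^sup>2 * w s) = v * integral ?I w"
    by simp
qed

context wstar_probability_space
begin

lemma centre:
  assumes "star_subalgebra A" "x \<in> A"
  obtains y where "y \<in> A" "\<tau> y = 0" "x = y + \<tau> x *\<^sub>C 1"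
proof
  show "x - \<tau> x *\<^sub>C 1 \<in> A"
    using assms by (intro star_subalgebra_intros)
  show "\<tau> (x - \<tau> x *\<^sub>C 1) = 0"
    by (simp add: tau_diff tau_scaleC unital)
qed simp

lemma semicircular_moments:
  assumes "semicircular \<tau> v x" "v > 0"
  shows "\<tau> x = 0" and "\<tau> (x * x) = of_real v"
proof -
  let ?I = "{-2 * sqrt v..2 * sqrt v}"
  let ?w = "\<lambda>s. sqrt (4 * v - s\<^sup>2) / (2 * pi * v)"
  have m: "\<tau> (x ^ n) = of_real (integral ?I (\<lambda>s. s ^ n * ?w s))" for n
    using assms(1) unfolding semicircular_def by blast
  have "complex_of_real (integral ?I ?w) = 1"
    using m[of 0] by (simp only: power_0 mult_1_left unital)
  then have "integral ?I ?w = 1"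
    by (simp only: of_real_eq_1_iff)
  then show "\<tau> x = 0" "\<tau> (x * x) = of_real v"
    using m[of 1] m[of 2]
    by (simp_all only: semicircle_moments[OF assms(2)] power_one_right power2_eq_square[of x]
        mult_1_right of_real_0)
qed

lemma free_pair:
  assumes free: "free_sets \<tau> X Y"
    and b: "b \<in> star_subalgebra hull X" and y: "y \<in> star_subalgebra hull Y"
  shows "\<tau> (y * b) = \<tau> y * \<tau> b"
proof -
  obtain b' where b': "b' \<in> star_subalgebra hull X" "\<tau> b' = 0" "b = b' + \<tau> b *\<^sub>C 1"
    using centre[OF star_subalgebra_hull b] by blast
  obtain y' where y': "y' \<in> star_subalgebra hull Y" "\<tau> y' = 0" "y = y' + \<tau> y *\<^sub>C 1"
    using centre[OF star_subalgebra_hull y] by blast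
  have "\<tau> (prod_list (map snd [(False, y'), (True, b')])) = 0"
    using free b' y' unfolding free_sets_def free_algebras_def
    by (elim allE[of _ "[(False, y'), (True, b')]"]) simp
  then have 0: "\<tau> (y' * b') = 0"
    by simp
  have "\<tau> (y * b) = \<tau> ((y' + \<tau> y *\<^sub>C 1) * (b' + \<tau> b *\<^sub>C 1))"
    using b'(3) y'(3) by simp
  also have "\<dots> = \<tau> (y' * b') + \<tau> b * \<tau> y' + \<tau> y * \<tau> b' + \<tau> y * \<tau> b"
    by (simp add: distrib_left distrib_right mult_scaleC_left mult_scaleC_right tau_add tau_scaleC unital
        del: blinfun.add_right)
  finally show ?thesis
    using 0 b' y' by simp
qed

text \<open>With \<open>x\<close> and \<open>y\<close> split into centred parts and scalars, the
  word of centred parts has trace 0 by freeness. A term with exactly one scalar becomes, after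
  rotation, a trace of a centred element of \<open>Y\<close> against \<open>b * c\<close> or
  \<open>c * b\<close>, which vanishes by \<open>free_pair\<close>. Only the term with two scalars
  survives.\<close>

lemma free_four:
  assumes free: "free_sets \<tau> X Y"
    and b: "b \<in> star_subalgebra hull X" "\<tau> b = 0" and c: "c \<in> star_subalgebra hull X" "\<tau> c = 0"
    and x: "x \<in> star_subalgebra hull Y" and y: "y \<in> star_subalgebra hull Y"
  shows "\<tau> (x * b * y * c) = \<tau> x * \<tau> y * \<tau> (b * c)"
proof -
  obtain x' where x': "x' \<in> star_subalgebra hull Y" "\<tau> x' = 0" "x = x' + \<tau> x *\<^sub>C 1"
    using centre[OF star_subalgebra_hull x] by blast
  obtain y' where y': "y' \<in> star_subalgebra hull Y" "\<tau> y' = 0" "y = y' + \<tau> y *\<^sub>C 1"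
    using centre[OF star_subalgebra_hull y] by blast
  have "\<tau> (prod_list (map snd [(False, x'), (True, b), (False, y'), (True, c)])) = 0"
    using free b c x' y' unfolding free_sets_def free_algebras_def
    by (elim allE[of _ "[(False, x'), (True, b), (False, y'), (True, c)]"]) simp
  then have 0: "\<tau> (x' * b * y' * c) = 0"
    by (simp add: mult.assoc)
  have bc: "b * c \<in> star_subalgebra hull X" "c * b \<in> star_subalgebra hull X"
    using b c by (auto intro: star_subalgebra_hull star_subalgebra_mult)
  have 1: "\<tau> (x' * (b * c)) = 0"
    using free_pair[OF free bc(1) x'(1)] x'(2) by simp
  have "\<tau> (b * y' * c) = \<tau> (y' * (c * b))"
    using tracial[of b "y' * c"] by (simp add: mult.assoc)
  then have 2: "\<tau> (b * y' * c) = 0"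
    using free_pair[OF free bc(2) y'(1)] y'(2) by simp
  have "\<tau> (x * b * y * c) = \<tau> ((x' + \<tau> x *\<^sub>C 1) * b * (y' + \<tau> y *\<^sub>C 1) * c)"
    using x'(3) y'(3) by simp
  also have "\<dots> = \<tau> (x' * b * y' * c) + \<tau> y * \<tau> (x' * (b * c)) + \<tau> x * \<tau> (b * y' * c)
      + \<tau> x * \<tau> y * \<tau> (b * c)"
    by (simp add: distrib_left distrib_right mult_scaleC_left mult_scaleC_right tau_add tau_scaleC
        scaleC_scaleC mult.assoc del: blinfun.add_right)
  finally show ?thesis
    using 0 1 2 by simp
qed

end

section \<open>Increments of the driving free Brownian motion against adapted coefficients\<close>

locale free_unitary_bm = wstar_probability_space P \<tau>
  for P :: "('a::cstar_algebra \<Rightarrow>\<^sub>L complex) set" and \<tau> :: "'a \<Rightarrow>\<^sub>L complex" +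
  fixes \<A> :: "real \<Rightarrow> 'a set" and B U :: "real \<Rightarrow> 'a"
  assumes filtration: "filtration P \<A>"
    and brownian: "free_brownian_motion \<tau> \<A> B"
    and U_0: "U 0 = 1"
    and U_continuous: "continuous_on {0..} U"
    and U_unitary: "t \<ge> 0 \<Longrightarrow> unitary (U t)"
    and U_adapted: "t \<ge> 0 \<Longrightarrow> U t \<in> \<A> t"
    and U_ito: "t \<ge> 0 \<Longrightarrow> \<exists>Y. has_free_ito_integral \<tau> U B t Y \<and>
        U t = U 0 + \<i> *\<^sub>C Y - (1/2) *\<^sub>R integral {0..t} U"
begin

lemma subalgebra: "t \<ge> 0 \<Longrightarrow> star_subalgebra (\<A> t)"
  using filtration by (auto simp: filtration_def wstar_subalgebra_def)

lemma filtration_mono: "0 \<le> s \<Longrightarrow> s \<le> t \<Longrightarrow> x \<in> \<A> s \<Longrightarrow> x \<in> \<A> t"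
  using filtration by (auto simp: filtration_def)

lemma B_adapted: "t \<ge> 0 \<Longrightarrow> B t \<in> \<A> t"
  and B_star: "t \<ge> 0 \<Longrightarrow> star (B t) = B t"
  using brownian by (auto simp: free_brownian_motion_def selfadjoint_def)

context
  fixes s t :: real
  assumes st: "0 \<le> s" "s < t"
begin

lemma increment_star: "star (B t - B s) = B t - B s"
  using st by (simp add: star_diff B_star)

lemma increment_moments:
  shows "\<tau> (B t - B s) = 0" and "\<tau> ((B t - B s) * (B t - B s)) = of_real (t - s)"
  using brownian semicircular_moments[of "t - s" "B t - B s"] st
  by (auto simp: free_brownian_motion_def)

lemma increment_free: "free_sets \<tau> {B t - B s} (\<A> s)"
  using brownian st by (auto simp: free_brownian_motion_def)

lemma increment_centred: "x \<in> \<A> s \<Longrightarrow> \<tau> (x * (B t - B s)) = 0"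
  using free_pair[OF increment_free hull_inc hull_inc] increment_moments by simp

lemma increment_covariance:
  assumes "x \<in> \<A> s" "y \<in> \<A> s"
  shows "\<tau> (x * (B t - B s) * y * (B t - B s)) = of_real (t - s) * \<tau> x * \<tau> y"
  using free_four[OF increment_free hull_inc _ hull_inc _ hull_inc hull_inc, of _ _ x y]
    increment_moments assms by simp

lemma N_increment: "x \<in> \<A> s \<Longrightarrow> (N (x * (B t - B s)))\<^sup>2 = (t - s) * (N x)\<^sup>2"
proof -
  assume x: "x \<in> \<A> s"
  let ?b = "B t - B s"
  have "\<tau> (star (x * ?b) * (x * ?b)) = \<tau> (1 * ?b * (star x * x) * ?b)"
    by (simp add: star_mult increment_star mult.assoc)
  also have "\<dots> = of_real (t - s) * \<tau> 1 * \<tau> (star x * x)"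
    using x st by (intro increment_covariance star_subalgebra_intros subalgebra)
  finally show ?thesis
    by (simp add: N_square unital)
qed

end

text \<open>Each new summand is orthogonal to the partial sum, because
  \<open>star (?X n) * x n\<close> is adapted at \<open>p n\<close> and the next increment is
  centred against the past; thus squared norms add. Adaptedness of the partial sums is carried
  through the induction for this purpose. The points increase strictly because the law of an
  increment is specified for \<open>s < t\<close> only.\<close>

lemma ito_isometry:
  fixes x :: "nat \<Rightarrow> 'a"
  assumes p: "0 \<le> p 0" "\<And>i. i < n \<Longrightarrow> p i < p (Suc i)"
    and x: "\<And>i. i < n \<Longrightarrow> x i \<in> \<A> (p i)"
  defines "X \<equiv> \<Sum>i<n. x i * (B (p (Suc i)) - B (p i))"
  shows "p 0 \<le> p n" and "X \<in> \<A> (p n)"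
    and "\<And>z. z \<in> \<A> (p 0) \<Longrightarrow> \<tau> (z * X) = 0"
    and "(N X)\<^sup>2 = (\<Sum>i<n. (p (Suc i) - p i) * (N (x i))\<^sup>2)"
proof -
  let ?X = "\<lambda>n. \<Sum>i<n. x i * (B (p (Suc i)) - B (p i))"
  have "p 0 \<le> p n \<and> ?X n \<in> \<A> (p n) \<and> (\<forall>z\<in>\<A> (p 0). \<tau> (z * ?X n) = 0) \<and>
      (N (?X n))\<^sup>2 = (\<Sum>i<n. (p (Suc i) - p i) * (N (x i))\<^sup>2)"
    using p(2) x
  proof (induction n)
    case 0
    then show ?case
      using p(1) by (auto simp: subalgebra star_subalgebra_zero N_zero_iff)
  next
    case (Suc n)
    then have IH: "p 0 \<le> p n" "?X n \<in> \<A> (p n)" "\<And>z. z \<in> \<A> (p 0) \<Longrightarrow> \<tau> (z * ?X n) = 0"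
        "(N (?X n))\<^sup>2 = (\<Sum>i<n. (p (Suc i) - p i) * (N (x i))\<^sup>2)"
      by auto
    have step: "0 \<le> p n" "p n < p (Suc n)" "x n \<in> \<A> (p n)"
      using Suc.prems IH(1) p(1) by auto
    have "?X (Suc n) \<in> \<A> (p (Suc n))"
      using step IH(2) B_adapted[of "p n"] B_adapted[of "p (Suc n)"]
      by (auto intro!: star_subalgebra_intros subalgebra intro: filtration_mono[of "p n"])
    moreover have "\<tau> (z * ?X (Suc n)) = 0" if "z \<in> \<A> (p 0)" for z
    proof -
      have "z * x n \<in> \<A> (p n)"
        using that step IH(1) p(1)
        by (auto intro!: star_subalgebra_intros subalgebra intro: filtration_mono)
      then show ?thesis
        using increment_centred[OF step(1,2)] IH(3)[OF that]
        by (simp add: distrib_left tau_add mult.assoc[symmetric])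
    qed
    moreover have "(N (?X (Suc n)))\<^sup>2 = (\<Sum>i<Suc n. (p (Suc i) - p i) * (N (x i))\<^sup>2)"
    proof -
      have "star (?X n) * x n \<in> \<A> (p n)"
        using step IH by (intro star_subalgebra_intros subalgebra)
      then show ?thesis
        using increment_centred[OF step(1,2)] N_increment[OF step] IH(4)
        by (simp add: N_add_square mult.assoc[symmetric])
    qed
    ultimately show ?case
      using IH(1) step(2) by auto
  qed
  then show "p 0 \<le> p n" "X \<in> \<A> (p n)" "\<And>z. z \<in> \<A> (p 0) \<Longrightarrow> \<tau> (z * X) = 0"
    "(N X)\<^sup>2 = (\<Sum>i<n. (p (Suc i) - p i) * (N (x i))\<^sup>2)"
    by (auto simp: X_def)
qed

text \<open>By the integrated equation this is \<i> times the Ito integral of \<open>U\<close> over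
  the interval from \<open>t\<close> to \<open>t + h\<close>, written without choosing values of the
  integrals.\<close>

definition martingale_increment :: "real \<Rightarrow> real \<Rightarrow> 'a" where
  "martingale_increment t h = U (t + h) - U t + (1/2) *\<^sub>R integral {t..t + h} U"

lemma U_integrable: "0 \<le> s \<Longrightarrow> U integrable_on {s..t}"
  by (intro integrable_continuous_real continuous_on_subset[OF U_continuous]) auto

text \<open>Ito integrals are available on intervals starting at 0 only. The integral from
  \<open>t\<close> to \<open>t + h\<close> is the difference of two of them, and its Riemann sums
  arise by extending a partition of the first interval to one of the second and subtracting.\<close>

lemma martingale_increment_approx:
  assumes t: "0 \<le> t" and h: "0 < h" and \<epsilon>: "0 < \<epsilon>"
  obtains n :: nat and p where "p 0 = t" "p n = t + h" "\<And>i. i < n \<Longrightarrow> p i < p (Suc i)"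
    "\<And>i. i \<le> n \<Longrightarrow> p i \<in> {t..t + h}"
    "N (\<i> *\<^sub>C (\<Sum>i<n. U (p i) * (B (p (Suc i)) - B (p i))) - martingale_increment t h) < \<epsilon>"
proof -
  obtain Y where Y: "has_free_ito_integral \<tau> U B t Y"
      "U t = U 0 + \<i> *\<^sub>C Y - (1/2) *\<^sub>R integral {0..t} U"
    using U_ito[OF t] by auto
  obtain Z where Z: "has_free_ito_integral \<tau> U B (t + h) Z"
      "U (t + h) = U 0 + \<i> *\<^sub>C Z - (1/2) *\<^sub>R integral {0..t + h} U"
    using U_ito[of "t + h"] t h by auto
  let ?S = "\<lambda>n p. \<Sum>i<n. U (p i) * (B (p (Suc i)) - B (p i))"
  obtain \<delta> where \<delta>: "\<delta> > 0" "\<And>(n::nat) p. p 0 = 0 \<Longrightarrow> p n = t \<Longrightarrow>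
      (\<And>i. i < n \<Longrightarrow> p i \<le> p (Suc i) \<and> p (Suc i) - p i < \<delta>) \<Longrightarrow> N (?S n p - Y) < \<epsilon> / 2"
    using Y(1)[unfolded has_free_ito_integral_def, rule_format, of "\<epsilon> / 2"] \<epsilon> by force
  obtain \<delta>' where \<delta>': "\<delta>' > 0" "\<And>(n::nat) p. p 0 = 0 \<Longrightarrow> p n = t + h \<Longrightarrow>
      (\<And>i. i < n \<Longrightarrow> p i \<le> p (Suc i) \<and> p (Suc i) - p i < \<delta>') \<Longrightarrow> N (?S n p - Z) < \<epsilon> / 2"
    using Z(1)[unfolded has_free_ito_integral_def, rule_format, of "\<epsilon> / 2"] \<epsilon> by force
  \<comment> \<open>Both intervals are cut into \<open>n\<close> equal pieces. Their steps
    \<open>t / n\<close> and \<open>h / n\<close> are at most \<open>(t + h) / n\<close>, so one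
    choice of \<open>n\<close> serves both thresholds.\<close>
  obtain n :: nat where n: "(t + h) / min \<delta> \<delta>' < real n"
    using reals_Archimedean2 by blast
  have "0 \<le> (t + h) / min \<delta> \<delta>'"
    using t h \<delta>(1) \<delta>'(1) by simp
  with n have n0: "n > 0"
    by (cases n) auto
  have "min \<delta> \<delta>' > 0"
    using \<delta>(1) \<delta>'(1) by simp
  with n n0 have small: "(t + h) / real n < min \<delta> \<delta>'"
    by (simp only: pos_divide_less_eq of_nat_0_less_iff mult.commute)
  have steps: "t / real n < min \<delta> \<delta>'" "h / real n < min \<delta> \<delta>'"
    using t h n0 small divide_right_mono[of t "t + h" "real n"] divide_right_mono[of h "t + h" "real n"]
    by linarith+
  define q where "q i = t * real i / real n" for i :: nat
  define p where "p i = t + h * real i / real n" for i :: nat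
  \<comment> \<open>The concatenated partition; the junction is consistent because
    \<open>q n\<close> and \<open>p 0\<close> are both \<open>t\<close>. For \<open>t = 0\<close>
    the part \<open>q\<close> is constant, which the definition of the integral permits, while
    \<open>p\<close> is strictly increasing in any case.\<close>
  define r where "r i = (if i \<le> n then q i else p (i - n))" for i :: nat
  have q_step: "q (Suc i) - q i = t / real n" for i
    by (simp add: q_def field_simps add_divide_distrib)
  have p_step: "p (Suc i) - p i = h / real n" for i
    by (simp add: p_def field_simps add_divide_distrib)
  have qp: "q n = t" "p 0 = t"
    using n0 by (auto simp: q_def p_def)
  have r_right: "r (n + i) = p i" for i
    using qp by (cases i) (auto simp: r_def)
  have r_step: "r (Suc i) - r i \<in> {t / real n, h / real n}" for i
  proof (cases "i < n")
    case True
    then show ?thesis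
      using q_step[of i] by (simp add: r_def)
  next
    case False
    then obtain j where "i = n + j"
      using le_Suc_ex not_less by blast
    then show ?thesis
      using r_right[of j] r_right[of "Suc j"] p_step[of j] by simp
  qed
  have "N (?S n q - Y) < \<epsilon> / 2"
  proof (rule \<delta>(2))
    show "q i \<le> q (Suc i) \<and> q (Suc i) - q i < \<delta>" for i
      using q_step[of i] steps(1) divide_nonneg_nonneg[OF t, of "real n"] by auto
  qed (simp_all add: qp q_def[of 0])
  moreover have "N (?S (n + n) r - Z) < \<epsilon> / 2"
  proof (rule \<delta>'(2))
    show "r 0 = 0"
      by (simp add: r_def q_def)
    show "r (n + n) = t + h"
      using n0 r_right[of n] by (simp add: p_def)
    fix i
    have "0 \<le> t / real n" "0 \<le> h / real n" "t / real n < \<delta>'" "h / real n < \<delta>'"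
      using t h steps by auto
    moreover have "r (Suc i) - r i = t / real n \<or> r (Suc i) - r i = h / real n"
      using r_step[of i] by simp
    ultimately show "r i \<le> r (Suc i) \<and> r (Suc i) - r i < \<delta>'"
      by (elim disjE) linarith+
  qed
  moreover have "?S (n + n) r = ?S n q + ?S n p"
  proof -
    have "?S (n + m) r = ?S n q + (\<Sum>i<m. U (p i) * (B (p (Suc i)) - B (p i)))" for m
    proof (induction m)
      case 0
      show ?case
        by (auto simp: r_def intro!: sum.cong)
    next
      case (Suc m)
      then show ?case
        using r_right[of m] r_right[of "Suc m"] by (simp add: add.assoc)
    qed
    then show ?thesis .
  qed
  moreover have "N (?S n p - (Z - Y)) = N ((?S n q + ?S n p - Z) - (?S n q - Y))"
    by (simp add: algebra_simps)
  ultimately have "N (?S n p - (Z - Y)) < \<epsilon>"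
    using N_triangle_diff[of "?S n q + ?S n p - Z" "?S n q - Y"] by simp
  moreover have "integral {0..t + h} U = integral {0..t} U + integral {t..t + h} U"
    using t h by (intro Henstock_Kurzweil_Integration.integral_combine[symmetric] U_integrable) auto
  then have "martingale_increment t h = \<i> *\<^sub>C (Z - Y)"
    by (simp add: martingale_increment_def Y(2) Z(2) scaleC_diff_right scaleR_add_right)
  then have "N (\<i> *\<^sub>C ?S n p - martingale_increment t h) = N (?S n p - (Z - Y))"
    using N_scaleC[of \<i> "?S n p - (Z - Y)"] by (simp add: scaleC_diff_right)
  ultimately have "N (\<i> *\<^sub>C ?S n p - martingale_increment t h) < \<epsilon>"
    by simp
  moreover have "p n = t + h"
    using n0 by (simp add: p_def)
  moreover have "p i < p (Suc i)" for i
    using p_step[of i] divide_pos_pos[OF h, of "real n"] n0 by simp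
  moreover have "p i \<in> {t..t + h}" if "i \<le> n" for i
    using that h n0 by (auto simp: p_def field_simps)
  ultimately show ?thesis
    using that qp(2) by blast
qed

text \<open>The Riemann sums have trace 0 against the past and converge in L2, and by Cauchy-Schwarz
  the functional \<open>\<tau> (z * _)\<close> is continuous for \<open>N\<close>.\<close>

lemma martingale_increment_centred:
  assumes t: "0 \<le> t" and h: "0 < h" and z: "z \<in> \<A> t"
  shows "\<tau> (z * martingale_increment t h) = 0"
proof (rule ccontr)
  let ?M = "martingale_increment t h"
  assume "\<not> ?thesis"
  then have pos: "cmod (\<tau> (z * ?M)) > 0"
    by simp
  \<comment> \<open>The summand 1 covers \<open>z = 0\<close> and makes the final comparison
    strict.\<close>
  define \<epsilon> where "\<epsilon> = cmod (\<tau> (z * ?M)) / (N z + 1)"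
  have Nz: "N z + 1 > 0"
    using N_nonneg[of z] by linarith
  have \<epsilon>: "\<epsilon> > 0"
    using pos Nz by (simp add: \<epsilon>_def)
  obtain n :: nat and p where p: "p 0 = t" "p n = t + h" "\<And>i. i < n \<Longrightarrow> p i < p (Suc i)"
    "\<And>i. i \<le> n \<Longrightarrow> p i \<in> {t..t + h}"
    "N (\<i> *\<^sub>C (\<Sum>i<n. U (p i) * (B (p (Suc i)) - B (p i))) - ?M) < \<epsilon>"
    using martingale_increment_approx[OF t h \<epsilon>] by blast
  let ?S = "\<Sum>i<n. U (p i) * (B (p (Suc i)) - B (p i))"
  have "U (p i) \<in> \<A> (p i)" if "i < n" for i
    using U_adapted[of "p i"] p(4)[of i] t that by simp
  then have "\<tau> (z * ?S) = 0"
    using ito_isometry(3)[of p n "\<lambda>i. U (p i)" z] p(1,3) t z by simp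
  then have "\<tau> (z * (\<i> *\<^sub>C ?S - ?M)) = - \<tau> (z * ?M)"
    by (simp add: right_diff_distrib tau_diff mult_scaleC_right tau_scaleC)
  then have "cmod (\<tau> (z * ?M)) \<le> N z * N (\<i> *\<^sub>C ?S - ?M)"
    using Cauchy_Schwarz'[of z "\<i> *\<^sub>C ?S - ?M"] by simp
  also have "\<dots> \<le> N z * \<epsilon>"
    using p(5) by (intro mult_left_mono) auto
  also have "\<dots> < (N z + 1) * \<epsilon>"
    using \<epsilon> by simp
  also have "\<dots> = cmod (\<tau> (z * ?M))"
    using Nz by (simp add: \<epsilon>_def)
  finally show False
    by simp
qed

text \<open>The integrand is frozen at the left end of the interval. The difference is the integral
  of \<open>U s - U t\<close>, and the isometry bounds the squared norm of its Riemann sums by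
  \<open>K\<^sup>2\<close> times the telescoping total length \<open>h\<close>.\<close>

lemma martingale_increment_linear:
  assumes t: "0 \<le> t" and h: "0 < h" and K: "\<And>s. s \<in> {t..t + h} \<Longrightarrow> norm (U s - U t) \<le> K"
  shows "N (martingale_increment t h - \<i> *\<^sub>C (U t * (B (t + h) - B t))) \<le> K * sqrt h"
proof (rule field_le_epsilon)
  let ?M = "martingale_increment t h"
  fix \<epsilon> :: real
  assume \<epsilon>: "\<epsilon> > 0"
  have K0: "0 \<le> K"
    using K[of t] h by simp
  obtain n :: nat and p where p: "p 0 = t" "p n = t + h" "\<And>i. i < n \<Longrightarrow> p i < p (Suc i)"
    "\<And>i. i \<le> n \<Longrightarrow> p i \<in> {t..t + h}"
    "N (\<i> *\<^sub>C (\<Sum>i<n. U (p i) * (B (p (Suc i)) - B (p i))) - ?M) < \<epsilon>"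
    using martingale_increment_approx[OF t h \<epsilon>] by blast
  let ?S = "\<Sum>i<n. U (p i) * (B (p (Suc i)) - B (p i))"
  let ?T = "\<Sum>i<n. (U (p i) - U t) * (B (p (Suc i)) - B (p i))"
  have "(\<Sum>i<n. U t * (B (p (Suc i)) - B (p i))) = U t * (B (t + h) - B t)"
    using p(1,2) by (simp add: sum_distrib_left[symmetric] sum_lessThan_telescope[of "\<lambda>i. B (p i)"])
  then have T: "?T = ?S - U t * (B (t + h) - B t)"
    by (simp add: left_diff_distrib sum_subtractf)
  have "U (p i) - U t \<in> \<A> (p i)" if "i < n" for i
    using U_adapted[of "p i"] U_adapted[of t] p(4)[of i] t that
    by (auto intro!: star_subalgebra_diff subalgebra intro: filtration_mono[of t])
  then have "(N ?T)\<^sup>2 = (\<Sum>i<n. (p (Suc i) - p i) * (N (U (p i) - U t))\<^sup>2)"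
    using ito_isometry(4)[of p n "\<lambda>i. U (p i) - U t"] p(1,3) t by simp
  also have "\<dots> \<le> (\<Sum>i<n. (p (Suc i) - p i) * K\<^sup>2)"
  proof (intro sum_mono mult_left_mono power_mono)
    fix i assume "i \<in> {..<n}"
    then show "N (U (p i) - U t) \<le> K" "0 \<le> p (Suc i) - p i"
      using K[OF p(4)[of i]] N_le_norm[of "U (p i) - U t"] p(3)[of i] by auto
  qed simp
  also have "\<dots> = (K * sqrt h)\<^sup>2"
    using p(1,2) h by (simp add: sum_distrib_right[symmetric] sum_lessThan_telescope[of p]
        power_mult_distrib)
  finally have "N ?T \<le> K * sqrt h"
    using K0 h by (auto intro: power2_le_imp_le)
  then have "N (\<i> *\<^sub>C ?T) \<le> K * sqrt h"
    by (simp add: N_scaleC)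
  moreover have *: "?M - \<i> *\<^sub>C (U t * (B (t + h) - B t)) = \<i> *\<^sub>C ?T - (\<i> *\<^sub>C ?S - ?M)"
    by (simp add: T scaleC_diff_right)
  ultimately show "N (?M - \<i> *\<^sub>C (U t * (B (t + h) - B t))) \<le> K * sqrt h + \<epsilon>"
    unfolding *
    using N_triangle_diff[of "\<i> *\<^sub>C ?T" "\<i> *\<^sub>C ?S - ?M"] p(5) by linarith
qed

end

section \<open>Short-time asymptotics of the increments of \<open>U\<close>\<close>

context free_unitary_bm
begin

lemma N_scaleR: "N (r *\<^sub>R x) = \<bar>r\<bar> * N x"
  using N_scaleC[of "of_real r" x] by (simp only: scaleC_of_real norm_of_real)

lemma N_unitary_mult: "unitary u \<Longrightarrow> N (u * x) = N x"
proof -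
  assume u: "unitary u"
  have "star (u * x) * (u * x) = star x * (star u * u) * x"
    by (simp add: star_mult mult.assoc)
  with u show ?thesis
    by (simp add: l2_norm_def unitary_def)
qed

context
  fixes t :: real
  assumes t: "0 \<le> t"
begin

lemma U_right_continuous:
  assumes "\<epsilon> > 0"
  shows "\<forall>\<^sub>F h in at_right 0. \<forall>s\<in>{t..t + h}. norm (U s - U t) \<le> \<epsilon>"
proof -
  obtain \<delta> where \<delta>: "\<delta> > 0" "\<And>s. s \<in> {0..} \<Longrightarrow> dist s t < \<delta> \<Longrightarrow> dist (U s) (U t) < \<epsilon>"
    using U_continuous t assms unfolding continuous_on_iff by (metis atLeast_iff)
  show ?thesis
    unfolding eventually_at_right_field
  proof (intro exI[of _ \<delta>] conjI allI impI ballI)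
    fix h s assume "0 < h" "h < \<delta>" "s \<in> {t..t + h}"
    then show "norm (U s - U t) \<le> \<epsilon>"
      using \<delta>(2)[of s] t by (auto simp: dist_norm)
  qed (use \<delta> in simp)
qed

lemma U_increment_tendsto_0: "((\<lambda>h. U (t + h) - U t) \<longlongrightarrow> 0) (at_right 0)"
proof (rule tendstoI)
  fix \<epsilon> :: real assume "\<epsilon> > 0"
  then have "\<forall>\<^sub>F h in at_right 0. \<forall>s\<in>{t..t + h}. norm (U s - U t) \<le> \<epsilon> / 2"
    by (intro U_right_continuous) simp
  then show "\<forall>\<^sub>F h in at_right 0. dist (U (t + h) - U t) 0 < \<epsilon>"
    using eventually_at_right_less[of 0]
  proof eventually_elim
    case (elim h)
    then have "norm (U (t + h) - U t) \<le> \<epsilon> / 2"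
      by auto
    then show ?case
      using \<open>\<epsilon> > 0\<close> by (simp add: dist_norm)
  qed
qed

lemma U_average_tendsto: "((\<lambda>h. (1 / h) *\<^sub>R integral {t..t + h} U) \<longlongrightarrow> U t) (at_right 0)"
proof (rule tendstoI)
  fix \<epsilon> :: real assume \<epsilon>: "\<epsilon> > 0"
  then have "\<forall>\<^sub>F h in at_right 0. \<forall>s\<in>{t..t + h}. norm (U s - U t) \<le> \<epsilon> / 2"
    by (intro U_right_continuous) simp
  then show "\<forall>\<^sub>F h in at_right 0. dist ((1 / h) *\<^sub>R integral {t..t + h} U) (U t) < \<epsilon>"
    using eventually_at_right_less[of 0]
  proof eventually_elim
    case (elim h)
    have "((\<lambda>s. U s - U t) has_integral integral {t..t + h} U - h *\<^sub>R U t) (cbox t (t + h))"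
      using has_integral_diff[OF integrable_integral[OF U_integrable[OF t]] has_integral_const_real[of "U t" t "t + h"]]
        elim by simp
    then have "norm (integral {t..t + h} U - h *\<^sub>R U t) \<le> \<epsilon> / 2 * measure lborel (cbox t (t + h))"
      using \<epsilon> elim by (intro has_integral_bound) auto
    then have "norm ((1 / h) *\<^sub>R (integral {t..t + h} U - h *\<^sub>R U t)) \<le> \<epsilon> / 2"
      unfolding norm_scaleR using elim by (simp add: field_simps)
    also have "(1 / h) *\<^sub>R (integral {t..t + h} U - h *\<^sub>R U t) = (1 / h) *\<^sub>R integral {t..t + h} U - U t"
      using elim by (simp add: scaleR_diff_right)
    finally show ?case
      using \<epsilon> by (simp add: dist_norm)
  qed
qed

text \<open>The martingale part has trace 0 against \<open>z\<close>, which leaves the time average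
  of \<open>U\<close>.\<close>

lemma drift_limit:
  assumes z: "z \<in> \<A> t"
  shows "((\<lambda>h. \<tau> (z * (U (t + h) - U t)) / of_real h) \<longlongrightarrow> (- 1 / 2) * \<tau> (z * U t)) (at_right 0)"
proof -
  have "((\<lambda>h. (- 1 / 2) * \<tau> (z * ((1 / h) *\<^sub>R integral {t..t + h} U)))
      \<longlongrightarrow> (- 1 / 2) * \<tau> (z * U t)) (at_right 0)"
    by (intro tendsto_intros U_average_tendsto)
  moreover have "\<forall>\<^sub>F h in at_right 0. (- 1 / 2) * \<tau> (z * ((1 / h) *\<^sub>R integral {t..t + h} U))
      = \<tau> (z * (U (t + h) - U t)) / of_real h"
    using eventually_at_right_less[of 0]
  proof eventually_elim
    case (elim h)
    have "U (t + h) - U t = martingale_increment t h - (1/2) *\<^sub>R integral {t..t + h} U"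
      by (simp add: martingale_increment_def)
    then have "\<tau> (z * (U (t + h) - U t)) = - (1/2) * \<tau> (z * integral {t..t + h} U)"
      using martingale_increment_centred[OF t elim z]
      by (simp add: right_diff_distrib tau_diff tau_scaleR)
    then show ?case
      using elim by (simp add: tau_scaleR)
  qed
  ultimately show ?thesis
    by (rule Lim_transform_eventually)
qed

text \<open>The error has two sources: freezing the integrand costs a small multiple of
  \<open>sqrt h\<close> by norm continuity, and the drift is of order \<open>h\<close>.\<close>

lemma diffusion_limit:
  "((\<lambda>h. N (U (t + h) - U t - \<i> *\<^sub>C (U t * (B (t + h) - B t))) / sqrt h) \<longlongrightarrow> 0) (at_right 0)"
proof (rule tendstoI)
  fix \<epsilon> :: real assume \<epsilon>: "\<epsilon> > 0"
  then have "\<forall>\<^sub>F h in at_right 0. \<forall>s\<in>{t..t + h}. norm (U s - U t) \<le> \<epsilon> / 4"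
    by (intro U_right_continuous) simp
  moreover have "\<forall>\<^sub>F h in at_right 0. h < \<epsilon>\<^sup>2"
    using \<epsilon> by (intro eventually_at_rightI[of _ "\<epsilon>\<^sup>2"]) auto
  ultimately show "\<forall>\<^sub>F h in at_right 0.
      dist (N (U (t + h) - U t - \<i> *\<^sub>C (U t * (B (t + h) - B t))) / sqrt h) 0 < \<epsilon>"
    using eventually_at_right_less[of 0]
  proof eventually_elim
    case (elim h)
    let ?g = "\<i> *\<^sub>C (U t * (B (t + h) - B t))"
    let ?I = "integral {t..t + h} U"
    have "norm ?I \<le> 1 * measure lborel (cbox t (t + h))"
      using U_unitary t elim
      by (intro has_integral_bound integrable_integral) (auto intro!: U_integrable simp: unitary_norm)
    then have "N ?I \<le> h"
      using N_le_norm[of ?I] elim by simp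
    then have "N ((1/2) *\<^sub>R ?I) \<le> h / 2"
      by (simp add: N_scaleR)
    moreover have "h \<le> \<epsilon> * sqrt h"
    proof -
      have "sqrt h \<le> \<epsilon>"
        using elim \<epsilon> by (simp add: real_le_lsqrt)
      then have "sqrt h * sqrt h \<le> \<epsilon> * sqrt h"
        using elim by (intro mult_right_mono) auto
      then show ?thesis
        using elim by simp
    qed
    moreover have "N (martingale_increment t h - ?g) \<le> \<epsilon> / 4 * sqrt h"
      using elim by (intro martingale_increment_linear t) auto
    moreover have *: "U (t + h) - U t - ?g = (martingale_increment t h - ?g) - (1/2) *\<^sub>R ?I"
      by (simp add: martingale_increment_def)
    ultimately have "N (U (t + h) - U t - ?g) \<le> \<epsilon> / 4 * sqrt h + \<epsilon> * sqrt h / 2"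
      unfolding *
      using N_triangle_diff[of "martingale_increment t h - ?g" "(1/2) *\<^sub>R ?I"] by linarith
    also have "\<dots> < \<epsilon> * sqrt h"
      using \<epsilon> elim by simp
    finally show ?case
      using elim by (simp add: field_simps)
  qed
qed

lemma N_diffusion: "h > 0 \<Longrightarrow> N (\<i> *\<^sub>C (U t * (B (t + h) - B t))) = sqrt h"
proof -
  assume h: "h > 0"
  have "(N (1 * (B (t + h) - B t)))\<^sup>2 = h"
    using N_increment[of t "t + h" 1] t h subalgebra[OF t]
    by (simp add: star_subalgebra_one N_square unital)
  then have "N (B (t + h) - B t) = sqrt h"
    by (simp add: real_sqrt_unique)
  then show ?thesis
    using U_unitary[OF t] by (simp add: N_scaleC N_unitary_mult)
qed

text \<open>The leading term has norm exactly \<open>sqrt h\<close>, and the error is eventually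
  below \<open>sqrt h\<close>.\<close>

lemma N_U_increment_bound: "\<forall>\<^sub>F h in at_right 0. N (U (t + h) - U t) \<le> 2 * sqrt h"
proof -
  have "\<forall>\<^sub>F h in at_right 0. N (U (t + h) - U t - \<i> *\<^sub>C (U t * (B (t + h) - B t))) / sqrt h < 1"
    using diffusion_limit by (rule order_tendstoD) simp
  then show ?thesis
    using eventually_at_right_less[of 0]
  proof eventually_elim
    case (elim h)
    then show ?case
      using N_triangle[of "U (t + h) - U t - \<i> *\<^sub>C (U t * (B (t + h) - B t))"
          "\<i> *\<^sub>C (U t * (B (t + h) - B t))"] N_diffusion[of h]
      by (simp add: field_simps)
  qed
qed

end

text \<open>A trace \<open>\<tau> (x * a * y * b)\<close> is bounded by
  \<open>norm x * norm y * N a * N b\<close>. Replacing factors of size \<open>sqrt h\<close> by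
  approximations with error \<open>o(sqrt h)\<close> therefore changes it by \<open>o(h)\<close>
  only. Keeping \<open>d\<close> and \<open>d'\<close> separate covers both the increment of
  \<open>U\<close> and its adjoint.\<close>

lemma covariance_limit:
  assumes E: "((\<lambda>h. N (d h - g h) / sqrt h) \<longlongrightarrow> 0) (at_right 0)"
    and E': "((\<lambda>h. N (d' h - g' h) / sqrt h) \<longlongrightarrow> 0) (at_right 0)"
    and g: "\<And>h. h > 0 \<Longrightarrow> N (g h) = sqrt h" and g': "\<And>h. h > 0 \<Longrightarrow> N (g' h) = sqrt h"
    and L: "\<And>h. h > 0 \<Longrightarrow> \<tau> (x * g h * y * g' h) = of_real h * L"
  shows "((\<lambda>h. \<tau> (x * d h * y * d' h) / of_real h) \<longlongrightarrow> L) (at_right 0)"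
proof -
  define e where "e h = N (d h - g h) / sqrt h" for h
  define e' where "e' h = N (d' h - g' h) / sqrt h" for h
  have "((\<lambda>h. norm x * norm y * (e h * (1 + e' h) + e' h))
      \<longlongrightarrow> norm x * norm y * (0 * (1 + 0) + 0)) (at_right 0)"
    unfolding e_def e'_def by (intro tendsto_intros E E')
  then have lim: "((\<lambda>h. norm x * norm y * (e h * (1 + e' h) + e' h)) \<longlongrightarrow> 0) (at_right 0)"
    by simp
  have "((\<lambda>h. \<tau> (x * d h * y * d' h) / of_real h - L) \<longlongrightarrow> 0) (at_right 0)"
  proof (rule Lim_null_comparison[OF _ lim])
    show "\<forall>\<^sub>F h in at_right 0. norm (\<tau> (x * d h * y * d' h) / of_real h - L)
        \<le> norm x * norm y * (e h * (1 + e' h) + e' h)"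
      using eventually_at_right_less[of 0]
    proof eventually_elim
      case (elim h)
      have N_e: "N (d h - g h) = e h * sqrt h" "N (d' h - g' h) = e' h * sqrt h"
        using elim by (simp_all add: e_def e'_def)
      have pos: "0 \<le> e h" "0 \<le> e' h"
        using elim by (simp_all add: e_def e'_def)
      have "N (d' h) \<le> e' h * sqrt h + sqrt h"
        using N_triangle[of "d' h - g' h" "g' h"] N_e g'[OF elim] by simp
      then have d': "N (d' h) \<le> (1 + e' h) * sqrt h"
        by (simp add: algebra_simps)
      have sandwich: "cmod (\<tau> (x * a * y * b)) \<le> norm x * norm y * (N a * N b)" for a b
      proof -
        have "cmod (\<tau> (x * a * y * b)) \<le> N (x * a) * N (y * b)"
          using Cauchy_Schwarz'[of "x * a" "y * b"] by (simp add: mult.assoc)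
        also have "\<dots> \<le> (norm x * N a) * (norm y * N b)"
          by (intro mult_mono N_mult_left) auto
        finally show ?thesis
          by (simp add: mult_ac)
      qed
      have "\<tau> (x * d h * y * d' h) - of_real h * L
          = \<tau> (x * (d h - g h) * y * d' h) + \<tau> (x * g h * y * (d' h - g' h))"
        by (simp add: L[OF elim, symmetric] left_diff_distrib right_diff_distrib tau_diff)
      then have "cmod (\<tau> (x * d h * y * d' h) - of_real h * L)
          \<le> norm x * norm y * (N (d h - g h) * N (d' h)) + norm x * norm y * (N (g h) * N (d' h - g' h))"
        using norm_triangle_ineq[of "\<tau> (x * (d h - g h) * y * d' h)" "\<tau> (x * g h * y * (d' h - g' h))"]
          sandwich[of "d h - g h" "d' h"] sandwich[of "g h" "d' h - g' h"] by simp
      also have "\<dots> \<le> norm x * norm y * ((e h * sqrt h) * ((1 + e' h) * sqrt h))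
          + norm x * norm y * (sqrt h * (e' h * sqrt h))"
        using d' pos elim unfolding N_e g[OF elim]
        by (intro add_mono mult_left_mono) auto
      also have "\<dots> = norm x * norm y * (e h * (1 + e' h) + e' h) * (sqrt h * sqrt h)"
        by algebra
      finally have "cmod (\<tau> (x * d h * y * d' h) - of_real h * L)
          \<le> norm x * norm y * (e h * (1 + e' h) + e' h) * h"
        using elim by simp
      moreover have "\<tau> (x * d h * y * d' h) / of_real h - L = (\<tau> (x * d h * y * d' h) - of_real h * L) / of_real h"
        using elim by (simp add: field_simps)
      ultimately show ?case
        using elim by (simp add: norm_divide divide_le_eq)
    qed
  qed
  then show ?thesis
    by (rule LIM_zero_cancel)
qed

context
  fixes t :: real and x y
  assumes t: "0 \<le> t" and x: "x \<in> \<A> t" and y: "y \<in> \<A> t"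
begin

text \<open>Cyclic rotation conjugates \<open>x\<close> by \<open>U t\<close>, which does not change
  its trace, so no trace of \<open>U t\<close> remains in the limit.\<close>

lemma covariance_limit_star:
  "((\<lambda>h. \<tau> (x * (U (t + h) - U t) * y * star (U (t + h) - U t)) / of_real h)
    \<longlongrightarrow> \<tau> x * \<tau> y) (at_right 0)"
proof (rule covariance_limit[OF diffusion_limit[OF t]])
  let ?g = "\<lambda>h. \<i> *\<^sub>C (U t * (B (t + h) - B t))"
  have "N (star (U (t + h) - U t) - star (?g h)) = N (U (t + h) - U t - ?g h)" for h
    by (simp only: star_diff[symmetric] N_star)
  then show "((\<lambda>h. N (star (U (t + h) - U t) - star (?g h)) / sqrt h) \<longlongrightarrow> 0) (at_right 0)"
    using diffusion_limit[OF t] by simp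
  fix h :: real assume h: "h > 0"
  show "N (?g h) = sqrt h" "N (star (?g h)) = sqrt h"
    using N_diffusion[OF t h] by (simp_all only: N_star)
  let ?b = "B (t + h) - B t"
  have b: "star ?b = ?b"
    using t h by (intro increment_star) auto
  have "\<tau> (x * ?g h * y * star (?g h)) = \<tau> ((x * U t * ?b * y * ?b) * star (U t))"
    by (simp add: star_scaleC star_mult b mult_scaleC_left mult_scaleC_right scaleC_scaleC
        scaleC_one mult.assoc)
  also have "\<dots> = \<tau> (star (U t) * x * U t * ?b * y * ?b)"
    by (subst tracial) (simp add: mult.assoc)
  also have "\<dots> = of_real h * \<tau> (star (U t) * x * U t) * \<tau> y"
    using increment_covariance[of t "t + h" "star (U t) * x * U t" y] t h x y U_adapted[OF t]
    by (simp add: star_subalgebra_intros subalgebra)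
  also have "\<tau> (star (U t) * x * U t) = \<tau> (x * (U t * star (U t)))"
    using tracial[of "star (U t)" "x * U t"] by (simp add: mult.assoc)
  also have "\<dots> = \<tau> x"
    using U_unitary[OF t] by (simp add: unitary_def)
  finally show "\<tau> (x * ?g h * y * star (?g h)) = of_real h * (\<tau> x * \<tau> y)"
    by simp
qed

text \<open>Here the factors \<open>U t\<close> stay with \<open>x\<close> and \<open>y\<close>, and
  the sign is the square of \<i>.\<close>

lemma covariance_limit_same:
  "((\<lambda>h. \<tau> (x * (U (t + h) - U t) * y * (U (t + h) - U t)) / of_real h)
    \<longlongrightarrow> - (\<tau> (x * U t) * \<tau> (y * U t))) (at_right 0)"
proof (rule covariance_limit[OF diffusion_limit[OF t] diffusion_limit[OF t]])
  let ?g = "\<lambda>h. \<i> *\<^sub>C (U t * (B (t + h) - B t))"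
  fix h :: real assume h: "h > 0"
  show "N (?g h) = sqrt h" "N (?g h) = sqrt h"
    using N_diffusion[OF t h] by (simp_all only: N_star)
  let ?b = "B (t + h) - B t"
  have "\<tau> (x * ?g h * y * ?g h) = - \<tau> ((x * U t) * ?b * (y * U t) * ?b)"
    by (simp add: mult_scaleC_left mult_scaleC_right scaleC_scaleC scaleC_minus1 tau_minus mult.assoc)
  also have "\<dots> = - (of_real h * \<tau> (x * U t) * \<tau> (y * U t))"
    using increment_covariance[of t "t + h" "x * U t" "y * U t"] t h x y U_adapted[OF t]
    by (simp add: star_subalgebra_intros subalgebra)
  finally show "\<tau> (x * ?g h * y * ?g h) = of_real h * - (\<tau> (x * U t) * \<tau> (y * U t))"
    by simp
qed

end

end

section \<open>Words in two free algebras\<close>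

context wstar_probability_space
begin

text \<open>\<open>mixed C Q\<close> is the algebra generated by \<open>C\<close> and \<open>Q\<close>, written as \<open>C + span (C V C)\<close> where \<open>V\<close> are the
  alternating centred words that begin and end with a letter of \<open>Q\<close>. If \<open>Q\<close> is free from an algebra
  \<open>X\<close> containing \<open>C\<close>, then \<open>C V C\<close> is invisible to \<open>x \<mapsto> \<tau> (x * d)\<close> for \<open>d\<close> in \<open>X\<close>.\<close>

inductive_set alternating :: "'a set \<Rightarrow> 'a set \<Rightarrow> 'a set" for C Q where
  single: "q \<in> Q \<Longrightarrow> \<tau> q = 0 \<Longrightarrow> q \<in> alternating C Q"
| step: "v \<in> alternating C Q \<Longrightarrow> c \<in> C \<Longrightarrow> \<tau> c = 0 \<Longrightarrow> q \<in> Q \<Longrightarrow> \<tau> q = 0 \<Longrightarrow>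
    v * c * q \<in> alternating C Q"

inductive_set mixed :: "'a set \<Rightarrow> 'a set \<Rightarrow> 'a set" for C Q where
  pure: "c \<in> C \<Longrightarrow> c \<in> mixed C Q"
| sandwich: "c \<in> C \<Longrightarrow> v \<in> alternating C Q \<Longrightarrow> c' \<in> C \<Longrightarrow> c * v * c' \<in> mixed C Q"
| add: "x \<in> mixed C Q \<Longrightarrow> y \<in> mixed C Q \<Longrightarrow> x + y \<in> mixed C Q"

context
  fixes C Q :: "'a set"
  assumes C: "star_subalgebra C" and Q: "star_subalgebra Q"
begin

text \<open>Words in \<open>U t\<close>, its adjoint, \<open>R\<close> and \<open>S\<close> are
  built from left to right, so closure under right multiplication is what puts them into
  \<open>mixed\<close>.\<close>

lemma mixed_mult_first: "x \<in> mixed C Q \<Longrightarrow> c \<in> C \<Longrightarrow> x * c \<in> mixed C Q"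
proof (induction rule: mixed.induct)
  case (pure c')
  then show ?case
    using C by (intro mixed.pure star_subalgebra_mult)
next
  case (sandwich c1 v c2)
  then show ?case
    using mixed.sandwich[of c1 C v Q "c2 * c"] C by (simp add: mult.assoc star_subalgebra_mult)
next
  case (add x y)
  then show ?case
    by (simp add: distrib_right mixed.add)
qed

lemma mixed_scaleC: "x \<in> mixed C Q \<Longrightarrow> k *\<^sub>C x \<in> mixed C Q"
  using mixed_mult_first[of x "k *\<^sub>C 1"] C
  by (simp add: mult_scaleC_right star_subalgebra_intros)

lemma mixed_mult_alternating: "c \<in> C \<Longrightarrow> v \<in> alternating C Q \<Longrightarrow> c * v \<in> mixed C Q"
  using mixed.sandwich[of c C v Q 1] C by (simp add: star_subalgebra_one)

text \<open>The factor \<open>q\<close> merges with the last letter of \<open>v\<close>. The centred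
  part of that product is a legitimate last letter again; its mean removes the letter and leaves a
  shorter word, or no word at all if \<open>v\<close> was a single letter.\<close>

lemma mixed_alternating_mult:
  assumes c: "c \<in> C" and v: "v \<in> alternating C Q" and q: "q \<in> Q"
  shows "c * v * q \<in> mixed C Q"
  using v
proof (cases rule: alternating.cases)
  case single
  obtain r where r: "r \<in> Q" "\<tau> r = 0" "v * q = r + \<tau> (v * q) *\<^sub>C 1"
    using centre[OF Q star_subalgebra_mult[OF Q single(1) q]] by blast
  have "c * v * q = c * (r + \<tau> (v * q) *\<^sub>C 1)"
    by (simp only: mult.assoc r(3)[symmetric])
  also have "\<dots> = c * r + \<tau> (v * q) *\<^sub>C c"
    by (simp add: distrib_left mult_scaleC_right)
  also have "\<dots> \<in> mixed C Q"
    using c r by (intro mixed.add mixed_mult_alternating mixed_scaleC) (auto intro: mixed.pure alternating.single)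
  finally show ?thesis .
next
  case (step w d p)
  obtain r where r: "r \<in> Q" "\<tau> r = 0" "p * q = r + \<tau> (p * q) *\<^sub>C 1"
    using centre[OF Q star_subalgebra_mult[OF Q step(5) q]] by blast
  have "c * v * q = c * w * d * (p * q)"
    by (simp only: mult.assoc step(1))
  also have "\<dots> = c * (w * d * r) + \<tau> (p * q) *\<^sub>C (c * w * d)"
    by (subst r(3)) (simp add: distrib_left mult_scaleC_right mult.assoc)
  also have "\<dots> \<in> mixed C Q"
    using c r step
    by (intro mixed.add mixed_mult_alternating mixed_scaleC mixed.sandwich)
      (auto intro: alternating.step)
  finally show ?thesis .
qed

text \<open>Between \<open>v\<close> and \<open>q\<close> stands an element of \<open>C\<close>. Its
  centred part separates two alternating words as required, while its mean lets \<open>q\<close>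
  meet the last letter of \<open>v\<close>, the case of
  \<open>mixed_alternating_mult\<close>.\<close>

lemma mixed_mult_second: "x \<in> mixed C Q \<Longrightarrow> q \<in> Q \<Longrightarrow> x * q \<in> mixed C Q"
proof (induction rule: mixed.induct)
  case (pure c)
  obtain r where r: "r \<in> Q" "\<tau> r = 0" "q = r + \<tau> q *\<^sub>C 1"
    using centre[OF Q \<open>q \<in> Q\<close>] by blast
  have "c * q = c * (r + \<tau> q *\<^sub>C 1)"
    by (simp only: r(3)[symmetric])
  also have "\<dots> = c * r + \<tau> q *\<^sub>C c"
    by (simp add: distrib_left mult_scaleC_right)
  also have "\<dots> \<in> mixed C Q"
    using pure r by (intro mixed.add mixed_mult_alternating mixed_scaleC) (auto intro: mixed.pure alternating.single)
  finally show ?case .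
next
  case (sandwich c v d)
  obtain r where r: "r \<in> Q" "\<tau> r = 0" "q = r + \<tau> q *\<^sub>C 1"
    using centre[OF Q \<open>q \<in> Q\<close>] by blast
  obtain e where e: "e \<in> C" "\<tau> e = 0" "d = e + \<tau> d *\<^sub>C 1"
    using centre[OF C sandwich(3)] by blast
  have "c * v * d * q = c * v * (d * r) + \<tau> q *\<^sub>C (c * v * d)"
    by (subst r(3)) (simp add: distrib_left mult_scaleC_right mult.assoc)
  also have "d * r = e * r + \<tau> d *\<^sub>C r"
    by (subst e(3)) (simp add: distrib_right mult_scaleC_left)
  also have "c * v * (e * r + \<tau> d *\<^sub>C r) = c * (v * e * r) + \<tau> d *\<^sub>C (c * v * r)"
    by (simp add: distrib_left mult_scaleC_right mult.assoc)
  also have "c * (v * e * r) + \<tau> d *\<^sub>C (c * v * r) + \<tau> q *\<^sub>C (c * v * d) \<in> mixed C Q"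
    using r e sandwich
    by (intro mixed.add mixed_scaleC mixed_mult_alternating mixed_alternating_mult mixed.sandwich)
      (auto intro: alternating.step)
  finally show ?case .
next
  case (add x y)
  then show ?case
    by (simp add: distrib_right mixed.add)
qed

end

context
  fixes X Y C :: "'a set"
  assumes free: "free_sets \<tau> X Y" and CX: "C \<subseteq> star_subalgebra hull X"
begin

text \<open>Translation into tagged lists, the form in which freeness is stated. Since both end
  letters carry the tag \<open>False\<close>, a letter tagged \<open>True\<close> may be attached on
  either side.\<close>

lemma alternating_word:
  assumes "v \<in> alternating C (star_subalgebra hull Y)"
  shows "\<exists>w. w \<noteq> [] \<and> \<not> fst (hd w) \<and> \<not> fst (last w) \<and> distinct_adj (map fst w) \<and>
    (\<forall>(i, x)\<in>set w. x \<in> star_subalgebra hull (if i then X else Y) \<and> \<tau> x = 0) \<and>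
    v = prod_list (map snd w)"
  using assms
proof (induction rule: alternating.induct)
  case (single q)
  then show ?case
    by (intro exI[of _ "[(False, q)]"]) simp
next
  case (step v c q)
  then obtain w where w: "w \<noteq> []" "\<not> fst (hd w)" "\<not> fst (last w)" "distinct_adj (map fst w)"
    "\<forall>(i, x)\<in>set w. x \<in> star_subalgebra hull (if i then X else Y) \<and> \<tau> x = 0"
    "v = prod_list (map snd w)"
    by auto
  then show ?case
    using step CX
    by (intro exI[of _ "w @ [(True, c), (False, q)]"])
      (auto simp: distinct_adj_append_iff last_map mult.assoc)
qed

text \<open>The centred part of \<open>u\<close> extends the word by an admissible letter, and the
  mean of \<open>u\<close> multiplies the trace of \<open>v\<close>, which is 0 as well.\<close>

lemma alternating_trace:
  assumes v: "v \<in> alternating C (star_subalgebra hull Y)" and u: "u \<in> star_subalgebra hull X"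
  shows "\<tau> (v * u) = 0"
proof -
  obtain w where w: "w \<noteq> []" "\<not> fst (hd w)" "\<not> fst (last w)" "distinct_adj (map fst w)"
    "\<forall>(i, x)\<in>set w. x \<in> star_subalgebra hull (if i then X else Y) \<and> \<tau> x = 0"
    "v = prod_list (map snd w)"
    using alternating_word[OF v] by auto
  obtain u' where u': "u' \<in> star_subalgebra hull X" "\<tau> u' = 0" "u = u' + \<tau> u *\<^sub>C 1"
    using centre[OF star_subalgebra_hull u] by blast
  have "\<tau> v = 0"
    using free w unfolding free_sets_def free_algebras_def
    by (elim allE[of _ w]) simp
  moreover have "\<tau> (v * u') = 0"
    using free w u' unfolding free_sets_def free_algebras_def
    by (elim allE[of _ "w @ [(True, u')]"]) (auto simp: distinct_adj_append_iff last_map)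
  ultimately show ?thesis
    by (subst u'(3)) (simp add: distrib_left tau_add mult_scaleC_right tau_scaleC)
qed

text \<open>This is the vanishing of the trace of the word with \<open>x\<close> and
  \<open>y\<close> replaced by their centred parts, multiplied out. The trace of
  \<open>v * v'\<close> remains because two letters of the same algebra meet there.\<close>

lemma alternating_trace_pair:
  assumes v: "v \<in> alternating C (star_subalgebra hull Y)"
    and v': "v' \<in> alternating C (star_subalgebra hull Y)"
    and x: "x \<in> star_subalgebra hull X" and y: "y \<in> star_subalgebra hull X"
  shows "\<tau> (v * x * v' * y) = \<tau> x * \<tau> (v * v' * y) + \<tau> y * \<tau> (v * x * v') - \<tau> x * \<tau> y * \<tau> (v * v')"
proof -
  obtain w where w: "w \<noteq> []" "\<not> fst (hd w)" "\<not> fst (last w)" "distinct_adj (map fst w)"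
    "\<forall>(i, x)\<in>set w. x \<in> star_subalgebra hull (if i then X else Y) \<and> \<tau> x = 0"
    "v = prod_list (map snd w)"
    using alternating_word[OF v] by auto
  obtain w' where w': "w' \<noteq> []" "\<not> fst (hd w')" "\<not> fst (last w')" "distinct_adj (map fst w')"
    "\<forall>(i, x)\<in>set w'. x \<in> star_subalgebra hull (if i then X else Y) \<and> \<tau> x = 0"
    "v' = prod_list (map snd w')"
    using alternating_word[OF v'] by auto
  define x' where "x' = x - \<tau> x *\<^sub>C 1"
  define y' where "y' = y - \<tau> y *\<^sub>C 1"
  have x': "x' \<in> star_subalgebra hull X" "\<tau> x' = 0" and y': "y' \<in> star_subalgebra hull X" "\<tau> y' = 0"
    using x y by (auto simp: x'_def y'_def tau_diff tau_scaleC unital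
        intro!: star_subalgebra_intros star_subalgebra_hull)
  have "\<tau> (v * x' * v' * y') = 0"
    using free w w' x' y' unfolding free_sets_def free_algebras_def
    by (elim allE[of _ "w @ [(True, x')] @ w' @ [(True, y')]"])
      (auto simp: distinct_adj_append_iff distinct_adj_Cons last_map hd_map mult.assoc)
  then show ?thesis
    by (simp add: x'_def y'_def left_diff_distrib right_diff_distrib tau_diff tau_add mult_scaleC_left
        mult_scaleC_right tau_scaleC algebra_simps)
qed

end

end

section \<open>The liberation process\<close>

context wstar_probability_space
begin

context
  fixes X Y C :: "'a set"
  assumes free: "free_sets \<tau> X Y" and CX: "C \<subseteq> star_subalgebra hull X"
begin

text \<open>After rotating \<open>c\<close> to the end, a sandwich \<open>c * v * c'\<close> has
  trace 0 against every element generated by \<open>X\<close>, hence against \<open>d h\<close> and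
  against \<open>k\<close>. Writing the limit as a trace against such a \<open>k\<close> makes it
  vanish on sandwiches too, so only the pure part matters on both sides.\<close>

lemma mixed_first_order:
  assumes d: "\<And>h. h > 0 \<Longrightarrow> d h \<in> star_subalgebra hull X"
    and k: "k \<in> star_subalgebra hull X"
    and lim: "\<And>c. c \<in> C \<Longrightarrow>
      ((\<lambda>h. \<tau> (c * d h) / of_real h) \<longlongrightarrow> \<kappa> * \<tau> (c * k)) (at_right 0)"
    and x: "x \<in> mixed C (star_subalgebra hull Y)"
  shows "((\<lambda>h. \<tau> (x * d h) / of_real h) \<longlongrightarrow> \<kappa> * \<tau> (x * k)) (at_right 0)"
  using x
proof (induction rule: mixed.induct)
  case (pure c)
  then show ?case
    by (rule lim)
next
  case (sandwich c v c')
  have vanish: "\<tau> (c * v * c' * u) = 0" if "u \<in> star_subalgebra hull X" for u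
  proof -
    have "\<tau> (c * v * c' * u) = \<tau> (v * (c' * u * c))"
      using tracial[of c "v * c' * u"] by (simp add: mult.assoc)
    also have "\<dots> = 0"
      using sandwich that CX
      by (intro alternating_trace[OF free CX] star_subalgebra_intros star_subalgebra_hull) auto
    finally show ?thesis .
  qed
  have "\<forall>\<^sub>F h in at_right 0. 0 = \<tau> (c * v * c' * d h) / of_real h"
    using eventually_at_right_less[of 0] by eventually_elim (simp add: vanish d)
  then show ?case
    unfolding vanish[OF k] by (intro Lim_transform_eventually[OF tendsto_const]) auto
next
  case (add x y)
  then show ?case
    using tendsto_add[OF add.IH] by (simp add: distrib_right tau_add add_divide_distrib distrib_left)
qed

text \<open>For two words \<open>v\<close>, \<open>w\<close> freeness leaves only products of one factor \<open>\<tau> (c * d h) = O(h)\<close> with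
  one factor that tends to 0.\<close>

lemma mixed_second_order:
  assumes d: "\<And>h. h > 0 \<Longrightarrow> d h \<in> star_subalgebra hull X"
    and d': "\<And>h. h > 0 \<Longrightarrow> d' h \<in> star_subalgebra hull X"
    and C: "star_subalgebra C" and k: "k \<in> C" "k' \<in> C"
    and d0: "(d \<longlongrightarrow> 0) (at_right 0)" and d'0: "(d' \<longlongrightarrow> 0) (at_right 0)"
    and lim: "\<And>c. c \<in> C \<Longrightarrow> ((\<lambda>h. \<tau> (c * d h) / of_real h) \<longlongrightarrow> l c) (at_right 0)"
    and lim': "\<And>c. c \<in> C \<Longrightarrow> ((\<lambda>h. \<tau> (c * d' h) / of_real h) \<longlongrightarrow> l' c) (at_right 0)"
    and lim2: "\<And>c c'. c \<in> C \<Longrightarrow> c' \<in> C \<Longrightarrow>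
      ((\<lambda>h. \<tau> (c * d h * c' * d' h) / of_real h) \<longlongrightarrow> \<kappa> * (\<tau> (c * k) * \<tau> (c' * k'))) (at_right 0)"
    and x: "x \<in> mixed C (star_subalgebra hull Y)" and y: "y \<in> mixed C (star_subalgebra hull Y)"
  shows "((\<lambda>h. \<tau> (x * d h * y * d' h) / of_real h) \<longlongrightarrow> \<kappa> * (\<tau> (x * k) * \<tau> (y * k'))) (at_right 0)"
proof -
  have vanish: "\<tau> (c * v * c' * u) = 0"
    if "c \<in> C" "c' \<in> C" "v \<in> alternating C (star_subalgebra hull Y)" "u \<in> star_subalgebra hull X"
    for c c' v u
  proof -
    have "\<tau> (c * v * c' * u) = \<tau> (v * (c' * u * c))"
      using tracial[of c "v * c' * u"] by (simp add: mult.assoc)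
    also have "\<dots> = 0"
      using that CX
      by (intro alternating_trace[OF free CX] star_subalgebra_intros star_subalgebra_hull) auto
    finally show ?thesis .
  qed
  have CX': "c \<in> star_subalgebra hull X" if "c \<in> C" for c
    using that CX by auto
  show ?thesis
    using x
  proof (induction rule: mixed.induct)
    case (pure c)
    show ?case
      using y
    proof (induction rule: mixed.induct)
      case (pure c')
      then show ?case
        using \<open>c \<in> C\<close> by (rule lim2[rotated])
    next
      case (sandwich e v e')
      have tr: "\<tau> (c * d h * (e * v * e') * d' h) = \<tau> (e * v * e' * (d' h * c * d h))" for h
        using tracial[of "c * d h" "e * v * e' * d' h"] by (simp add: mult.assoc)
      have "\<forall>\<^sub>F h in at_right 0. 0 = \<tau> (c * d h * (e * v * e') * d' h) / of_real h"
        using eventually_at_right_less[of 0]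
      proof eventually_elim
        case (elim h)
        then show ?case
          using sandwich pure
          by (simp add: tr vanish CX' d d' star_subalgebra_mult star_subalgebra_hull)
      qed
      moreover have "\<tau> (e * v * e' * k') = 0"
        using sandwich k by (simp add: vanish CX')
      ultimately show ?case
        by (simp add: Lim_transform_eventually[OF tendsto_const])
    next
      case (add x y)
      then show ?case
        using tendsto_add[OF add.IH]
        by (simp add: distrib_right tau_add add_divide_distrib distrib_left)
    qed
  next
    case (sandwich c v c')
    have zero: "\<tau> (c * v * c' * k) = 0"
      using sandwich k by (simp add: vanish CX')
    show ?case
      using y
    proof (induction rule: mixed.induct)
      case (pure e)
      have "\<forall>\<^sub>F h in at_right 0. 0 = \<tau> (c * v * c' * d h * e * d' h) / of_real h"
        using eventually_at_right_less[of 0]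
      proof eventually_elim
        case (elim h)
        then show ?case
          using sandwich pure vanish[of c c' v "d h * e * d' h"]
          by (simp add: CX' d d' star_subalgebra_mult star_subalgebra_hull mult.assoc)
      qed
      then show ?case
        by (simp add: zero Lim_transform_eventually[OF tendsto_const])
    next
      case (sandwich e w e')
      note v = \<open>c \<in> C\<close> \<open>c' \<in> C\<close> \<open>v \<in> alternating C (star_subalgebra hull Y)\<close>
      \<comment> \<open>Rotating \<open>c\<close> to the end gathers the coefficients around
        \<open>d h\<close> and \<open>d' h\<close> into single elements generated by
        \<open>X\<close>, which separate the words \<open>v\<close> and \<open>w\<close>.\<close>
      define p where "p h = c' * d h * e" for h
      define q where "q h = e' * d' h * c" for h
      have p: "p h \<in> star_subalgebra hull X" and q: "q h \<in> star_subalgebra hull X" if "h > 0" for h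
        using that v sandwich
        by (auto simp: p_def q_def CX' d d' star_subalgebra_mult star_subalgebra_hull)
      have "((\<lambda>h. \<tau> (v * w * q h)) \<longlongrightarrow> \<tau> (v * w * (e' * 0 * c))) (at_right 0)"
        unfolding q_def by (intro tendsto_intros d'0)
      then have q0: "((\<lambda>h. \<tau> (v * w * q h)) \<longlongrightarrow> 0) (at_right 0)"
        by simp
      have "((\<lambda>h. \<tau> (v * p h * w)) \<longlongrightarrow> \<tau> (v * (c' * 0 * e) * w)) (at_right 0)"
        unfolding p_def by (intro tendsto_intros d0)
      then have p0: "((\<lambda>h. \<tau> (v * p h * w)) \<longlongrightarrow> 0) (at_right 0)"
        by simp
      have "((\<lambda>h. \<tau> (q h)) \<longlongrightarrow> \<tau> (e' * 0 * c)) (at_right 0)"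
        unfolding q_def by (intro tendsto_intros d'0)
      then have q1: "((\<lambda>h. \<tau> (q h)) \<longlongrightarrow> 0) (at_right 0)"
        by simp
      have "\<tau> (p h) = \<tau> ((e * c') * d h)" "\<tau> (q h) = \<tau> ((c * e') * d' h)" for h
        using tracial[of "c' * d h" e] tracial[of "e' * d' h" c] by (simp_all add: p_def q_def mult.assoc)
      then have lp: "((\<lambda>h. \<tau> (p h) / of_real h) \<longlongrightarrow> l (e * c')) (at_right 0)"
        and lq: "((\<lambda>h. \<tau> (q h) / of_real h) \<longlongrightarrow> l' (c * e')) (at_right 0)"
        using lim[of "e * c'"] lim'[of "c * e'"] v sandwich C by (simp_all add: star_subalgebra_mult)
      have "((\<lambda>h. \<tau> (p h) / of_real h * \<tau> (v * w * q h) + \<tau> (q h) / of_real h * \<tau> (v * p h * w)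
            - \<tau> (p h) / of_real h * \<tau> (q h) * \<tau> (v * w))
          \<longlongrightarrow> l (e * c') * 0 + l' (c * e') * 0 - l (e * c') * 0 * \<tau> (v * w)) (at_right 0)"
        by (intro tendsto_intros lp lq q0 p0 q1)
      moreover have "\<forall>\<^sub>F h in at_right 0.
          \<tau> (p h) / of_real h * \<tau> (v * w * q h) + \<tau> (q h) / of_real h * \<tau> (v * p h * w)
            - \<tau> (p h) / of_real h * \<tau> (q h) * \<tau> (v * w)
          = \<tau> (c * v * c' * d h * (e * w * e') * d' h) / of_real h"
        using eventually_at_right_less[of 0]
      proof eventually_elim
        case (elim h)
        have "\<tau> (c * v * c' * d h * (e * w * e') * d' h) = \<tau> (v * p h * w * q h)"
          using tracial[of c "v * c' * d h * (e * w * e') * d' h"]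
          by (simp add: p_def q_def mult.assoc)
        also have "\<dots> = \<tau> (p h) * \<tau> (v * w * q h) + \<tau> (q h) * \<tau> (v * p h * w)
            - \<tau> (p h) * \<tau> (q h) * \<tau> (v * w)"
          using v sandwich p[OF elim] q[OF elim] by (intro alternating_trace_pair[OF free CX])
        finally show ?case
          by (simp add: add_divide_distrib diff_divide_distrib)
      qed
      ultimately show ?case
        using Lim_transform_eventually by (fastforce simp: zero)
    next
      case (add x y)
      then show ?case
        using tendsto_add[OF add.IH]
        by (simp add: distrib_right tau_add add_divide_distrib distrib_left)
    qed
  next
    case (add x y)
    then show ?case
      using tendsto_add[OF add.IH]
      by (simp add: distrib_right tau_add add_divide_distrib distrib_left)
  qed
qed

end

text \<open>Cauchy-Schwarz: one factor is \<open>o(sqrt h)\<close> and the other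
  \<open>O(sqrt h)\<close> in L2.\<close>

lemma negligible_product:
  assumes u: "\<forall>\<^sub>F h in at_right 0. N (u h) \<le> e h * sqrt h" and e: "(e \<longlongrightarrow> 0) (at_right 0)"
    and v: "\<forall>\<^sub>F h in at_right 0. N (v h) \<le> K * sqrt h"
  shows "((\<lambda>h. \<tau> (u h * v h) / of_real h) \<longlongrightarrow> 0) (at_right 0)"
proof (rule Lim_null_comparison)
  show "((\<lambda>h. e h * K) \<longlongrightarrow> 0) (at_right 0)"
    using tendsto_mult_right[OF e, of K] by simp
  show "\<forall>\<^sub>F h in at_right 0. norm (\<tau> (u h * v h) / of_real h) \<le> e h * K"
    using u v eventually_at_right_less[of 0]
  proof eventually_elim
    case (elim h)
    have "cmod (\<tau> (u h * v h)) \<le> N (u h) * N (v h)"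
      by (rule Cauchy_Schwarz')
    also have "\<dots> \<le> (e h * sqrt h) * (K * sqrt h)"
      using elim N_nonneg order_trans by (intro mult_mono) blast+
    also have "\<dots> = e h * K * (sqrt h * sqrt h)"
      by (simp only: mult_ac)
    finally show ?case
      using elim by (simp add: norm_divide divide_le_eq)
  qed
qed

end

section \<open>Limits with coefficients generated by \<open>R\<close>, \<open>S\<close> and the past
  of \<open>U\<close>\<close>

locale liberation = free_unitary_bm P \<tau> \<A> B U
  for P :: "('a::cstar_algebra \<Rightarrow>\<^sub>L complex) set" and \<tau> :: "'a \<Rightarrow>\<^sub>L complex"
    and \<A> :: "real \<Rightarrow> 'a set" and B U :: "real \<Rightarrow> 'a" +
  fixes R S :: 'a and \<alpha> \<beta> :: real
  assumes R: "symmetry R" and S: "symmetry S"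
    and tau_R: "\<tau> R = of_real \<alpha>" and tau_S: "\<tau> S = of_real \<beta>"
    and free: "free_sets \<tau> (U ` {0..}) {R, S}"
begin

context
  fixes t :: real
  assumes t: "0 \<le> t"
begin

abbreviation "D \<equiv> \<lambda>h. U (t + h) - U t"

text \<open>Membership in \<open>\<A> t\<close> gives access to the limits computed from
  \<open>B\<close>, and membership in the hull gives freeness from \<open>{R, S}\<close>;
  coefficients need both.\<close>

definition "alg_U = \<A> t \<inter> star_subalgebra hull (U ` {0..})"

abbreviation "alg_URS \<equiv> mixed alg_U (star_subalgebra hull {R, S})"

lemma alg_U: "star_subalgebra alg_U"
  unfolding alg_U_def by (intro star_subalgebra_Int subalgebra[OF t] star_subalgebra_hull)

lemma alg_U_subset: "alg_U \<subseteq> star_subalgebra hull (U ` {0..})"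
  and alg_U_adapted: "c \<in> alg_U \<Longrightarrow> c \<in> \<A> t"
  by (auto simp: alg_U_def)

lemma U_in_alg_U: "U t \<in> alg_U" "star (U t) \<in> alg_U"
proof -
  show "U t \<in> alg_U"
    using U_adapted[OF t] t by (auto simp: alg_U_def intro: hull_inc)
  then show "star (U t) \<in> alg_U"
    using alg_U by (rule star_subalgebra_star[rotated])
qed

lemma D_in_hull: "h > 0 \<Longrightarrow> D h \<in> star_subalgebra hull (U ` {0..})"
  and star_D_in_hull: "h > 0 \<Longrightarrow> star (D h) \<in> star_subalgebra hull (U ` {0..})"
proof -
  show *: "D h \<in> star_subalgebra hull (U ` {0..})" if "h > 0" for h
    using t that by (intro star_subalgebra_diff[OF star_subalgebra_hull] hull_inc) auto
  show "star (D h) \<in> star_subalgebra hull (U ` {0..})" if "h > 0" for h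
    by (rule star_subalgebra_star[OF star_subalgebra_hull *[OF that]])
qed

lemma D_limit: "(D \<longlongrightarrow> 0) (at_right 0)"
  by (rule U_increment_tendsto_0[OF t])

lemma star_D_limit: "((\<lambda>h. star (D h)) \<longlongrightarrow> 0) (at_right 0)"
  using bounded_linear.tendsto[OF bounded_linear_star D_limit] by simp

lemma alg_U_D: "c \<in> alg_U \<Longrightarrow>
    ((\<lambda>h. \<tau> (c * D h) / of_real h) \<longlongrightarrow> (- 1 / 2) * \<tau> (c * U t)) (at_right 0)"
  by (intro drift_limit[OF t] alg_U_adapted)

lemma alg_U_star_D:
  assumes "c \<in> alg_U"
  shows "((\<lambda>h. \<tau> (c * star (D h)) / of_real h) \<longlongrightarrow> (- 1 / 2) * \<tau> (c * star (U t))) (at_right 0)"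
proof -
  have cnj_eq: "\<tau> (c * star x) = cnj (\<tau> (star c * x))" for x
    using tau_star[of "star c * x"] tracial[of "star x" c] by (simp add: star_mult star_star)
  have "star c \<in> alg_U"
    using assms alg_U by (rule star_subalgebra_star[rotated])
  from tendsto_cnj[OF alg_U_D[OF this]] show ?thesis
    by (simp add: cnj_eq)
qed

text \<open>The complex conjugate of \<open>covariance_limit_same\<close> for the adjoint
  coefficients, brought back into order by traciality.\<close>

lemma alg_U_star_D_star_D:
  assumes "c \<in> alg_U" "c' \<in> alg_U"
  shows "((\<lambda>h. \<tau> (c * star (D h) * c' * star (D h)) / of_real h)
    \<longlongrightarrow> (- 1) * (\<tau> (c * star (U t)) * \<tau> (c' * star (U t)))) (at_right 0)"
proof -
  have cnj_eq: "\<tau> (x * star y) = cnj (\<tau> (star x * y))" for x y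
    using tau_star[of "star x * y"] tracial[of "star y" x] by (simp add: star_mult star_star)
  have cnj_eq': "\<tau> (c * star x * c' * star x) = cnj (\<tau> (star c * x * star c' * x))" for x
    using tau_star[of "star c * x * star c' * x"] tracial[of "star x * c' * star x" c]
    by (simp add: star_mult star_star mult.assoc)
  have "star c \<in> alg_U" "star c' \<in> alg_U"
    using assms alg_U by (auto intro: star_subalgebra_star)
  then have "((\<lambda>h. \<tau> (star c * D h * star c' * D h) / of_real h)
      \<longlongrightarrow> - (\<tau> (star c * U t) * \<tau> (star c' * U t))) (at_right 0)"
    by (intro covariance_limit_same[OF t] alg_U_adapted)
  from tendsto_cnj[OF this] show ?thesis
    by (simp add: cnj_eq[of _ "U t"] cnj_eq')
qed

lemma limit_D:
  "x \<in> alg_URS \<Longrightarrow> ((\<lambda>h. \<tau> (x * D h) / of_real h) \<longlongrightarrow> (- 1 / 2) * \<tau> (x * U t)) (at_right 0)"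
  using U_in_alg_U alg_U_subset
  by (intro mixed_first_order[OF free alg_U_subset D_in_hull _ alg_U_D]) auto

lemma limit_star_D:
  "x \<in> alg_URS \<Longrightarrow>
    ((\<lambda>h. \<tau> (x * star (D h)) / of_real h) \<longlongrightarrow> (- 1 / 2) * \<tau> (x * star (U t))) (at_right 0)"
  using U_in_alg_U alg_U_subset
  by (intro mixed_first_order[OF free alg_U_subset star_D_in_hull _ alg_U_star_D]) auto

context
  fixes x y
  assumes xy: "x \<in> alg_URS" "y \<in> alg_URS"
begin

lemma limit_D_star_D:
  "((\<lambda>h. \<tau> (x * D h * y * star (D h)) / of_real h) \<longlongrightarrow> \<tau> x * \<tau> y) (at_right 0)"
proof -
  have "((\<lambda>h. \<tau> (x * D h * y * star (D h)) / of_real h) \<longlongrightarrow> 1 * (\<tau> (x * 1) * \<tau> (y * 1))) (at_right 0)"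
  proof (rule mixed_second_order[OF free alg_U_subset D_in_hull star_D_in_hull alg_U
        star_subalgebra_one[OF alg_U] star_subalgebra_one[OF alg_U] D_limit star_D_limit
        alg_U_D alg_U_star_D])
    fix c c' assume "c \<in> alg_U" "c' \<in> alg_U"
    then show "((\<lambda>h. \<tau> (c * D h * c' * star (D h)) / of_real h)
        \<longlongrightarrow> 1 * (\<tau> (c * 1) * \<tau> (c' * 1))) (at_right 0)"
      using covariance_limit_star[OF t alg_U_adapted alg_U_adapted, of c c'] by simp
  qed (use xy in simp_all)
  then show ?thesis
    by simp
qed

text \<open>Traciality reduces this to the opposite order of the increments with \<open>x\<close>
  and \<open>y\<close> exchanged.\<close>

lemma limit_star_D_D:
  "((\<lambda>h. \<tau> (x * star (D h) * y * D h) / of_real h) \<longlongrightarrow> \<tau> x * \<tau> y) (at_right 0)"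
proof -
  have "((\<lambda>h. \<tau> (y * D h * x * star (D h)) / of_real h) \<longlongrightarrow> 1 * (\<tau> (y * 1) * \<tau> (x * 1))) (at_right 0)"
  proof (rule mixed_second_order[OF free alg_U_subset D_in_hull star_D_in_hull alg_U
        star_subalgebra_one[OF alg_U] star_subalgebra_one[OF alg_U] D_limit star_D_limit
        alg_U_D alg_U_star_D])
    fix c c' assume "c \<in> alg_U" "c' \<in> alg_U"
    then show "((\<lambda>h. \<tau> (c * D h * c' * star (D h)) / of_real h)
        \<longlongrightarrow> 1 * (\<tau> (c * 1) * \<tau> (c' * 1))) (at_right 0)"
      using covariance_limit_star[OF t alg_U_adapted alg_U_adapted, of c c'] by simp
  qed (use xy in simp_all)
  moreover have "\<tau> (x * star (D h) * y * D h) = \<tau> (y * D h * x * star (D h))" for h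
    using tracial[of "x * star (D h)" "y * D h"] by (simp only: mult.assoc)
  ultimately show ?thesis
    by (simp add: mult.commute[of "\<tau> x"])
qed

lemma limit_D_D:
  "((\<lambda>h. \<tau> (x * D h * y * D h) / of_real h) \<longlongrightarrow> - (\<tau> (x * U t) * \<tau> (y * U t))) (at_right 0)"
proof -
  have "((\<lambda>h. \<tau> (x * D h * y * D h) / of_real h)
      \<longlongrightarrow> (- 1) * (\<tau> (x * U t) * \<tau> (y * U t))) (at_right 0)"
  proof (rule mixed_second_order[OF free alg_U_subset D_in_hull D_in_hull alg_U
        U_in_alg_U(1) U_in_alg_U(1) D_limit D_limit alg_U_D alg_U_D])
    fix c c' assume "c \<in> alg_U" "c' \<in> alg_U"
    then show "((\<lambda>h. \<tau> (c * D h * c' * D h) / of_real h)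
        \<longlongrightarrow> (- 1) * (\<tau> (c * U t) * \<tau> (c' * U t))) (at_right 0)"
      using covariance_limit_same[OF t alg_U_adapted alg_U_adapted, of c c'] by simp
  qed (use xy in simp_all)
  then show ?thesis
    by simp
qed

lemma limit_star_D_star_D:
  "((\<lambda>h. \<tau> (x * star (D h) * y * star (D h)) / of_real h)
    \<longlongrightarrow> - (\<tau> (x * star (U t)) * \<tau> (y * star (U t)))) (at_right 0)"
proof -
  have "((\<lambda>h. \<tau> (x * star (D h) * y * star (D h)) / of_real h)
      \<longlongrightarrow> (- 1) * (\<tau> (x * star (U t)) * \<tau> (y * star (U t)))) (at_right 0)"
    by (rule mixed_second_order[OF free alg_U_subset star_D_in_hull star_D_in_hull alg_U
          U_in_alg_U(2) U_in_alg_U(2) star_D_limit star_D_limit alg_U_star_D alg_U_star_D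
          alg_U_star_D_star_D xy])
  then show ?thesis
    by simp
qed

end

end

end

section \<open>Expansion and resummation of powers\<close>

lemma power_diff_telescope:
  fixes x y :: "'a::ring_1"
  shows "x ^ n - y ^ n = (\<Sum>i<n. x ^ i * (x - y) * y ^ (n - 1 - i))"
proof (induction n)
  case (Suc n)
  have "x ^ Suc n - y ^ Suc n = (x ^ n - y ^ n) * y + x ^ n * (x - y)"
    by (simp add: power_Suc2 algebra_simps del: power_Suc)
  also have "(x ^ n - y ^ n) * y = (\<Sum>i<n. x ^ i * (x - y) * y ^ (n - i))"
    unfolding Suc.IH sum_distrib_right
  proof (rule sum.cong)
    fix i assume "i \<in> {..<n}"
    then have "n - i = Suc (n - 1 - i)"
      by simp
    then show "x ^ i * (x - y) * y ^ (n - 1 - i) * y = x ^ i * (x - y) * y ^ (n - i)"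
      by (simp add: power_Suc2 mult.assoc del: power_Suc)
  qed simp
  finally show ?case
    by simp
qed simp

text \<open>The gap \<open>k = i - 1 - j\<close> occurs \<open>n - 1 - k\<close> times among the
  pairs \<open>j < i < n\<close>. Reflecting \<open>k\<close> to \<open>n - 2 - k\<close> turns this
  multiplicity into \<open>k + 1\<close>, and the two average to \<open>n / 2\<close>.\<close>

lemma sum_triangle_symmetric:
  fixes g :: "nat \<Rightarrow> complex"
  assumes sym: "\<And>k. k < n - 1 \<Longrightarrow> g (n - 2 - k) = g k"
  shows "(\<Sum>i<n. \<Sum>j<i. g (i - 1 - j)) = of_nat n / 2 * (\<Sum>k<n - 1. g k)"
proof -
  have inner: "(\<Sum>j<i. g (i - 1 - j)) = (\<Sum>k<i. g k)" for i
    using sum.nat_diff_reindex[of g i] by simp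
  have tri: "(\<Sum>i<m. \<Sum>k<i. g k) = (\<Sum>k<m - 1. of_nat (m - 1 - k) * g k)" for m
  proof (induction m)
    case (Suc m)
    show ?case
    proof (cases m)
      case (Suc l)
      have "(\<Sum>k<l. of_nat (m - 1 - k) * g k) + (\<Sum>k<l. g k)
          = (\<Sum>k<l. of_nat (m - k) * g k)"
        unfolding sum.distrib[symmetric]
      proof (rule sum.cong)
        fix k assume "k \<in> {..<l}"
        then have "m - k = Suc (m - 1 - k)"
          using Suc by simp
        then show "of_nat (m - 1 - k) * g k + g k = of_nat (m - k) * g k"
          by (simp add: algebra_simps)
      qed simp
      then show ?thesis
        using Suc Suc.IH by (simp add: algebra_simps)
    qed simp
  qed simp
  have reflect: "(\<Sum>k<n - 1. of_nat (n - 1 - k) * g k) = (\<Sum>k<n - 1. of_nat (k + 1) * g k)"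
  proof -
    have "(\<Sum>k<n - 1. of_nat (k + 1) * g k)
        = (\<Sum>k<n - 1. of_nat (n - 1 - Suc k + 1) * g (n - 1 - Suc k))"
      by (rule sum.nat_diff_reindex[symmetric])
    also have "\<dots> = (\<Sum>k<n - 1. of_nat (n - 1 - k) * g k)"
    proof (rule sum.cong)
      fix k assume k: "k \<in> {..<n - 1}"
      then have "n - 1 - Suc k + 1 = n - 1 - k" "n - 1 - Suc k = n - 2 - k"
        by auto
      then show "of_nat (n - 1 - Suc k + 1) * g (n - 1 - Suc k) = of_nat (n - 1 - k) * g k"
        using sym[of k] k by simp
    qed simp
    finally show ?thesis
      by simp
  qed
  have "2 * (\<Sum>k<n - 1. of_nat (n - 1 - k) * g k)
      = (\<Sum>k<n - 1. of_nat (n - 1 - k) * g k + of_nat (k + 1) * g k)"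
    unfolding sum.distrib mult_2 by (rule arg_cong[OF reflect])
  also have "\<dots> = (\<Sum>k<n - 1. of_nat n * g k)"
  proof (rule sum.cong)
    fix k assume "k \<in> {..<n - 1}"
    then have "n - 1 - k + (k + 1) = n"
      by simp
    then show "of_nat (n - 1 - k) * g k + of_nat (k + 1) * g k = of_nat n * g k"
      by (metis distrib_right of_nat_add)
  qed simp
  finally have twice: "2 * (\<Sum>k<n - 1. of_nat (n - 1 - k) * g k) = of_nat n * (\<Sum>k<n - 1. g k)"
    unfolding sum_distrib_left[symmetric] .
  have half: "x = c / 2 * y" if "2 * x = c * y" for x c y :: complex
    using that by (simp add: field_simps)
  show ?thesis
    unfolding inner tri by (rule half[OF twice])
qed

context wstar_probability_space
begin

lemma N_sandwich:
  assumes "norm x \<le> 1" "norm y \<le> 1"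
  shows "N (x * z * y) \<le> N z"
proof -
  have "N (x * z * y) \<le> norm x * N z * norm y"
    using N_mult_right[of "x * z" y] N_mult_left[of x z]
    by (meson mult_right_mono norm_ge_zero order_trans)
  also have "\<dots> \<le> 1 * N z * 1"
    using assms by (intro mult_mono) auto
  finally show ?thesis
    by simp
qed

end

section \<open>Right derivatives of the moments\<close>

context liberation
begin

definition A :: "real \<Rightarrow> 'a" where
  "A t = R * U t * S * star (U t)"

definition f :: "nat \<Rightarrow> real \<Rightarrow> complex" where
  "f n t = \<tau> (A t ^ n)"

text \<open>The trace of \<open>A t ^ n * R\<close>, independent of \<open>t\<close> by
  \<open>tau_A_power_R\<close>.\<close>

definition r :: "nat \<Rightarrow> complex" where
  "r n = (if even n then of_real \<alpha> else of_real \<beta>)"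

lemmas R_simps = symmetry_star[OF R] symmetry_square[OF R] symmetry_unitary[OF R]
lemmas S_simps = symmetry_star[OF S] symmetry_square[OF S] symmetry_unitary[OF S]

lemma unitary_power: "unitary u \<Longrightarrow> unitary (u ^ n)" for u :: 'a
proof (induction n)
  case (Suc n)
  then show ?case
    using unitary_mult[of u "u ^ n"] by simp
qed (simp add: unitary_def)

lemma A_unitary: "t \<ge> 0 \<Longrightarrow> unitary (A t)"
  unfolding A_def by (intro unitary_mult unitary_star U_unitary R_simps S_simps)

lemma A_power_unitary: "t \<ge> 0 \<Longrightarrow> unitary (A t ^ n)"
  by (rule unitary_power[OF A_unitary])

lemma f_0: "f 0 t = 1"
  by (simp add: f_def unital)

context
  fixes t :: real
  assumes t: "0 \<le> t"
begin

lemma U_cancel: "U t * star (U t) = 1" "star (U t) * U t = 1"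
  using U_unitary[OF t] by (auto simp: unitary_def)

lemma R_cancel': "R * (R * x) = x" and S_cancel': "S * (S * x) = x"
  by (simp_all add: mult.assoc[symmetric] R_simps S_simps)

text \<open>Since \<open>R\<close> squares to 1, conjugation of \<open>A t\<close> by
  \<open>R\<close> yields \<open>U t * S * star (U t) * R\<close>, the adjoint of
  \<open>A t\<close>.\<close>

lemma A_reflect: "A t * R = R * star (A t)"
  by (simp add: A_def star_mult star_star R_simps S_simps mult.assoc R_cancel')

text \<open>Conjugation by \<open>R\<close> maps \<open>A t ^ n\<close> to its adjoint and preserves
  the trace. Real moments remove the conjugates from the expansion of the Herglotz
  transform.\<close>

lemma f_real: "cnj (f n t) = f n t"
proof -
  have "star (A t ^ n) = R * A t ^ n * R"
  proof (induction n)
    case (Suc n)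
    have "star (A t ^ Suc n) = star (A t) * star (A t ^ n)"
      by (simp only: power_Suc2 star_mult)
    also have "\<dots> = star (A t) * R * A t ^ n * R"
      by (simp only: Suc.IH mult.assoc)
    also have "star (A t) = R * (A t * R)"
      by (simp add: A_reflect R_cancel')
    also have "R * (A t * R) * R = R * A t"
      by (simp add: mult.assoc R_simps)
    finally show ?case
      by (simp add: mult.assoc)
  qed (simp add: R_simps)
  then have "cnj (f n t) = \<tau> (R * A t ^ n * R)"
    by (simp add: f_def tau_star[symmetric])
  also have "\<dots> = \<tau> (R * (R * A t ^ n))"
    using tracial[of R "A t ^ n * R"] tracial[of "A t ^ n" "R * R"] by (simp add: mult.assoc R_simps R_cancel')
  finally show ?thesis
    by (simp add: R_cancel' f_def)
qed

text \<open>Moving one factor \<open>A t\<close> across \<open>R\<close> makes it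
  \<open>star (A t)\<close>, which cancels cyclically against the first factor. The exponent drops
  by 2, down to the trace of \<open>R\<close> or that of \<open>S\<close>.\<close>

lemma tau_A_power_R: "\<tau> (A t ^ n * R) = r n"
proof (induction n rule: nat_less_induct)
  case (1 n)
  consider "n = 0" | "n = 1" | m where "n = Suc (Suc m)"
    by (metis One_nat_def not0_implies_Suc)
  then show ?case
  proof cases
    case 1
    then show ?thesis
      by (simp add: tau_R r_def)
  next
    case 2
    have "\<tau> (A t * R) = \<tau> (R * (A t))"
      by (rule tracial)
    also have "\<dots> = \<tau> (U t * (S * star (U t)))"
      by (simp add: A_def mult.assoc R_cancel')
    also have "\<dots> = \<tau> S"
      using tracial[of "U t" "S * star (U t)"] by (simp add: mult.assoc U_cancel)
    finally show ?thesis
      using 2 by (simp add: tau_S r_def)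
  next
    case 3
    have "A t ^ n * R = A t * (A t ^ m * (A t * R))"
      by (simp only: 3 power_Suc[of _ "Suc m"] power_Suc2[of _ m] mult.assoc)
    also have "\<dots> = A t * (A t ^ m * R * star (A t))"
      by (simp add: A_reflect mult.assoc)
    finally have "\<tau> (A t ^ n * R) = \<tau> (A t * (A t ^ m * R * star (A t)))"
      by simp
    also have "\<dots> = \<tau> (A t ^ m * R * (star (A t) * A t))"
      using tracial[of "A t" "A t ^ m * R * star (A t)"] by (simp add: mult.assoc)
    also have "\<dots> = \<tau> (A t ^ m * R)"
      using A_unitary[OF t] by (simp add: unitary_def)
    finally show ?thesis
      using 1 3 by (simp add: r_def)
  qed
qed

abbreviation "\<delta> \<equiv> \<lambda>h. A (t + h) - A t"

abbreviation "M \<equiv> alg_URS t"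

lemma M_one: "1 \<in> M"
  using star_subalgebra_one[OF alg_U[OF t]] by (rule mixed.pure)

lemma M_mult_U: "x \<in> M \<Longrightarrow> x * U t \<in> M" "x \<in> M \<Longrightarrow> x * star (U t) \<in> M"
  using mixed_mult_first[OF alg_U[OF t] star_subalgebra_hull] U_in_alg_U[OF t] by auto

lemma M_mult_RS: "x \<in> M \<Longrightarrow> x * R \<in> M" "x \<in> M \<Longrightarrow> x * S \<in> M"
  using mixed_mult_second[OF alg_U[OF t] star_subalgebra_hull[of "{R, S}"]]
    hull_inc[of R "{R, S}"] hull_inc[of S "{R, S}"] by auto

lemma M_mult_A_power: "x \<in> M \<Longrightarrow> x * A t ^ n \<in> M"
proof (induction n)
  case (Suc n)
  have "x * A t ^ n * R * U t * S * star (U t) \<in> M"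
    using Suc by (intro M_mult_U M_mult_RS) simp
  then show ?case
    by (simp only: power_Suc2 A_def mult.assoc)
qed simp

lemma A_power_in_M: "A t ^ n \<in> M" and S_in_M: "S \<in> M"
  using M_mult_A_power[OF M_one, of n] M_mult_RS(2)[OF M_one] by simp_all

lemmas M_intros = M_mult_U M_mult_RS M_mult_A_power A_power_in_M S_in_M

text \<open>The last term, though quadratic in \<open>D\<close>, contributes to the first-order
  limit, because the covariance of \<open>D\<close> with its adjoint is of order
  \<open>h\<close>.\<close>

lemma \<delta>_expand: "\<delta> h = R * D t h * S * star (U t) + R * U t * S * star (D t h) + R * D t h * S * star (D t h)"
  by (simp add: A_def star_diff left_diff_distrib right_diff_distrib)

lemma unit_norms: "norm R = 1" "norm S = 1" "norm (U t) = 1" "norm (star (U t)) = 1"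
  by (simp_all add: unitary_norm R_simps S_simps U_unitary t)

lemma norm_products: "norm (R * U t * S) \<le> 1" "norm (S * star (U t)) \<le> 1"
  "norm (A t ^ n) \<le> 1"
proof -
  have "unitary (R * U t * S)" "unitary (S * star (U t))" "unitary (A t ^ n)"
    by (intro unitary_mult unitary_star U_unitary t R_simps S_simps A_power_unitary)+
  then show "norm (R * U t * S) \<le> 1" "norm (S * star (U t)) \<le> 1" "norm (A t ^ n) \<le> 1"
    by (simp_all only: unitary_norm order_refl)
qed

lemma \<delta>_parts_bound:
  "N (R * D t h * S * star (U t)) \<le> N (D t h)"
  "N (R * U t * S * star (D t h)) \<le> N (D t h)"
  "N (R * D t h * S * star (D t h)) \<le> norm (D t h) * N (D t h)"
proof -
  show "N (R * D t h * S * star (U t)) \<le> N (D t h)"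
    using N_sandwich[of R "S * star (U t)" "D t h"] unit_norms norm_products by (simp add: mult.assoc)
  show "N (R * U t * S * star (D t h)) \<le> N (D t h)"
    using N_sandwich[of "R * U t * S" 1 "star (D t h)"] norm_products by (simp add: N_star)
  have "N (R * D t h * S * star (D t h)) \<le> norm (R * D t h * S) * N (star (D t h))"
    by (rule N_mult_left)
  also have "\<dots> \<le> norm (D t h) * N (D t h)"
  proof -
    have "norm (R * D t h * S) \<le> norm R * norm (D t h) * norm S"
      by (intro order_trans[OF norm_mult_ineq] mult_mono) auto
    then show ?thesis
      unfolding N_star by (intro mult_right_mono) (auto simp: unit_norms)
  qed
  finally show "N (R * D t h * S * star (D t h)) \<le> norm (D t h) * N (D t h)" .
qed

text \<open>Once \<open>norm (D t h) < 1\<close>, each of the three parts has norm at most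
  \<open>2 * sqrt h\<close>.\<close>

lemma \<delta>_bound: "\<forall>\<^sub>F h in at_right 0. N (\<delta> h) \<le> 6 * sqrt h"
proof -
  have "\<forall>\<^sub>F h in at_right 0. norm (D t h) < 1"
    using order_tendstoD(2)[OF tendsto_norm[OF U_increment_tendsto_0[OF t]], of 1] by simp
  then show ?thesis
    using N_U_increment_bound[OF t]
  proof eventually_elim
    case (elim h)
    have "norm (D t h) * N (D t h) \<le> 1 * N (D t h)"
      using elim by (intro mult_right_mono) auto
    then have "N (R * D t h * S * star (U t)) + N (R * U t * S * star (D t h))
        + N (R * D t h * S * star (D t h)) \<le> 6 * sqrt h"
      using \<delta>_parts_bound[of h] elim by linarith
    then show ?case
      unfolding \<delta>_expand
      using N_triangle[of "R * D t h * S * star (U t) + R * U t * S * star (D t h)"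
          "R * D t h * S * star (D t h)"]
        N_triangle[of "R * D t h * S * star (U t)" "R * U t * S * star (D t h)"]
      by linarith
  qed
qed

text \<open>Each of the two parts linear in \<open>D\<close> contributes the drift
  \<open>- f (Suc n) t / 2\<close>; the quadratic part contributes the product of the traces of
  \<open>A t ^ n * R\<close> and \<open>S\<close>.\<close>

lemma first_order: "((\<lambda>h. \<tau> (A t ^ n * \<delta> h) / of_real h) \<longlongrightarrow> - f (Suc n) t + r n * of_real \<beta>) (at_right 0)"
proof -
  have "((\<lambda>h. \<tau> ((S * star (U t) * A t ^ n * R) * D t h) / of_real h
        + \<tau> ((A t ^ n * R * U t * S) * star (D t h)) / of_real h
        + \<tau> ((A t ^ n * R) * D t h * S * star (D t h)) / of_real h)
      \<longlongrightarrow> (- 1 / 2) * \<tau> ((S * star (U t) * A t ^ n * R) * U t)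
        + (- 1 / 2) * \<tau> ((A t ^ n * R * U t * S) * star (U t))
        + \<tau> (A t ^ n * R) * \<tau> S) (at_right 0)"
    by (intro tendsto_add limit_D limit_star_D limit_D_star_D t M_intros)
  moreover have "\<tau> ((S * star (U t) * A t ^ n * R) * U t) = f (Suc n) t"
    using tracial[of "S * star (U t)" "A t ^ n * R * U t"]
    by (simp add: f_def A_def power_Suc2 mult.assoc del: power_Suc)
  moreover have "\<tau> ((A t ^ n * R * U t * S) * star (U t)) = f (Suc n) t"
    by (simp add: f_def A_def power_Suc2 mult.assoc del: power_Suc)
  moreover have "\<tau> (A t ^ n * \<delta> h) / of_real h = \<tau> ((S * star (U t) * A t ^ n * R) * D t h) / of_real h
        + \<tau> ((A t ^ n * R * U t * S) * star (D t h)) / of_real h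
        + \<tau> ((A t ^ n * R) * D t h * S * star (D t h)) / of_real h" for h
  proof -
    have "\<tau> ((S * star (U t) * A t ^ n * R) * D t h) = \<tau> (A t ^ n * (R * D t h * S * star (U t)))"
      using tracial[of "S * star (U t)" "A t ^ n * R * D t h"] by (simp add: mult.assoc)
    then show ?thesis
      unfolding \<delta>_expand
      by (simp add: distrib_left tau_add add_divide_distrib mult.assoc)
  qed
  ultimately show ?thesis
    by (simp add: tau_A_power_R tau_S)
qed

text \<open>Only the parts \<open>p\<close> and \<open>q\<close> linear in \<open>D\<close> count.
  The products \<open>p p\<close> and \<open>q q\<close> each give minus a product of moments of
  \<open>A t\<close>, the products \<open>p q\<close> and \<open>q p\<close> each give a product of
  values of \<open>r\<close>, hence the factor 2.\<close>

lemma second_order: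
  "((\<lambda>h. \<tau> (A t ^ k * \<delta> h * A t ^ l * \<delta> h) / of_real h)
    \<longlongrightarrow> 2 * (r k * r l - f (Suc k) t * f (Suc l) t)) (at_right 0)"
proof -
  define p where "p h = R * D t h * S * star (U t)" for h
  define q where "q h = R * U t * S * star (D t h)" for h
  define s where "s h = R * D t h * S * star (D t h)" for h
  \<comment> \<open>Coefficients between consecutive increments in the cyclic word: \<open>x\<close>
    from a \<open>p\<close> to a \<open>p\<close>, \<open>y\<close> from a \<open>q\<close> to a
    \<open>q\<close>, \<open>w\<close> from a \<open>p\<close> to a \<open>q\<close>,
    \<open>z\<close> from a \<open>q\<close> to a \<open>p\<close>.\<close>
  define x where "x j = S * star (U t) * A t ^ j * R" for j
  define y where "y j = A t ^ j * R * U t * S" for j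
  define z where "z j = A t ^ j * R" for j
  define w where "w j = S * star (U t) * A t ^ j * R * U t * S" for j
  have in_M: "x j \<in> M" "y j \<in> M" "z j \<in> M" "w j \<in> M" for j
    unfolding x_def y_def z_def w_def by (intro M_intros)+
  have tx: "\<tau> (x j * U t) = f (Suc j) t" and ty: "\<tau> (y j * star (U t)) = f (Suc j) t" for j
    using tracial[of "S * star (U t)" "A t ^ j * R * U t"]
    by (simp_all add: f_def A_def power_Suc2 x_def y_def mult.assoc del: power_Suc)
  have tz: "\<tau> (z j) = r j" and tw: "\<tau> (w j) = r j" for j
  proof -
    show "\<tau> (z j) = r j"
      by (simp add: z_def tau_A_power_R)
    have "\<tau> (w j) = \<tau> (A t ^ j * R)"
      using tracial[of "S * star (U t)" "A t ^ j * R * U t * S"]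
      by (simp add: w_def mult.assoc S_cancel' U_cancel)
    then show "\<tau> (w j) = r j"
      by (simp add: tau_A_power_R)
  qed
  have main: "((\<lambda>h. \<tau> (x k * D t h * x l * D t h) / of_real h
        + \<tau> (y k * star (D t h) * y l * star (D t h)) / of_real h
        + \<tau> (z k * D t h * w l * star (D t h)) / of_real h
        + \<tau> (w k * star (D t h) * z l * D t h) / of_real h)
      \<longlongrightarrow> - (\<tau> (x k * U t) * \<tau> (x l * U t)) + - (\<tau> (y k * star (U t)) * \<tau> (y l * star (U t)))
        + \<tau> (z k) * \<tau> (w l) + \<tau> (w k) * \<tau> (z l)) (at_right 0)"
    by (intro tendsto_add limit_D_D limit_star_D_star_D limit_D_star_D limit_star_D_D t in_M)
  have D0: "((\<lambda>h. 2 * norm (D t h)) \<longlongrightarrow> 0) (at_right 0)"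
    using tendsto_mult[OF tendsto_const[of 2] tendsto_norm_zero[OF U_increment_tendsto_0[OF t]]]
    by simp
  have s_bound: "\<forall>\<^sub>F h in at_right 0. N (A t ^ j * s h) \<le> 2 * norm (D t h) * sqrt h" for j
    using N_U_increment_bound[OF t]
  proof eventually_elim
    case (elim h)
    have "N (A t ^ j * s h) \<le> N (s h)"
      using N_sandwich[of "A t ^ j" 1 "s h"] norm_products by simp
    also have "\<dots> \<le> norm (D t h) * N (D t h)"
      unfolding s_def by (rule \<delta>_parts_bound)
    also have "\<dots> \<le> norm (D t h) * (2 * sqrt h)"
      using elim by (intro mult_left_mono) auto
    finally show ?case
      by (simp add: mult_ac)
  qed
  have \<delta>_bound': "\<forall>\<^sub>F h in at_right 0. N (A t ^ j * \<delta> h) \<le> 6 * sqrt h" for j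
    using \<delta>_bound
  proof eventually_elim
    case (elim h)
    then show ?case
      using N_sandwich[of "A t ^ j" 1 "\<delta> h"] norm_products(3)[of j] by simp
  qed
  have pq_bound: "\<forall>\<^sub>F h in at_right 0. N (A t ^ j * (p h + q h)) \<le> 4 * sqrt h" for j
    using N_U_increment_bound[OF t]
  proof eventually_elim
    case (elim h)
    have "N (A t ^ j * (p h + q h)) \<le> N (p h + q h)"
      using N_sandwich[of "A t ^ j" 1 "p h + q h"] norm_products by simp
    also have "\<dots> \<le> N (p h) + N (q h)"
      by (rule N_triangle)
    also have "\<dots> \<le> 4 * sqrt h"
      using elim \<delta>_parts_bound[of h] unfolding p_def q_def by linarith
    finally show ?case .
  qed
  \<comment> \<open>All terms containing \<open>s\<close> are covered by \<open>e1\<close>, with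
    \<open>s\<close> in the first place, and \<open>e2\<close>, with \<open>s\<close> only in the
    second place.\<close>
  have e1: "((\<lambda>h. \<tau> ((A t ^ k * s h) * (A t ^ l * \<delta> h)) / of_real h) \<longlongrightarrow> 0) (at_right 0)"
    by (rule negligible_product[OF s_bound D0 \<delta>_bound'])
  have e2: "((\<lambda>h. \<tau> ((A t ^ l * s h) * (A t ^ k * (p h + q h))) / of_real h) \<longlongrightarrow> 0) (at_right 0)"
    by (rule negligible_product[OF s_bound D0 pq_bound])
  have split: "\<tau> (A t ^ k * \<delta> h * A t ^ l * \<delta> h)
      = (\<tau> (x k * D t h * x l * D t h) + \<tau> (y k * star (D t h) * y l * star (D t h))
        + \<tau> (z k * D t h * w l * star (D t h)) + \<tau> (w k * star (D t h) * z l * D t h))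
        + \<tau> ((A t ^ k * s h) * (A t ^ l * \<delta> h)) + \<tau> ((A t ^ l * s h) * (A t ^ k * (p h + q h)))" for h
  proof -
    have "\<delta> h = p h + q h + s h"
      unfolding p_def q_def s_def by (rule \<delta>_expand)
    then have "\<tau> (A t ^ k * \<delta> h * A t ^ l * \<delta> h) = \<tau> (A t ^ k * p h * A t ^ l * p h)
        + \<tau> (A t ^ k * q h * A t ^ l * q h) + \<tau> (A t ^ k * p h * A t ^ l * q h)
        + \<tau> (A t ^ k * q h * A t ^ l * p h) + \<tau> ((A t ^ k * s h) * (A t ^ l * \<delta> h))
        + \<tau> ((A t ^ k * (p h + q h)) * (A t ^ l * s h))"
      by (simp add: distrib_left distrib_right tau_add mult.assoc)
    moreover have "\<tau> (A t ^ k * p h * A t ^ l * p h) = \<tau> (x k * D t h * x l * D t h)"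
      using tracial[of "A t ^ k * p h * A t ^ l * R * D t h" "S * star (U t)"]
      by (simp add: x_def p_def mult.assoc)
    moreover have "\<tau> (A t ^ k * q h * A t ^ l * q h) = \<tau> (y k * star (D t h) * y l * star (D t h))"
      by (simp add: y_def q_def mult.assoc)
    moreover have "\<tau> (A t ^ k * p h * A t ^ l * q h) = \<tau> (z k * D t h * w l * star (D t h))"
      by (simp add: z_def w_def p_def q_def mult.assoc)
    moreover have "\<tau> (A t ^ k * q h * A t ^ l * p h) = \<tau> (w k * star (D t h) * z l * D t h)"
      using tracial[of "A t ^ k * q h * A t ^ l * R * D t h" "S * star (U t)"]
      by (simp add: z_def w_def p_def q_def mult.assoc)
    moreover have "\<tau> ((A t ^ k * (p h + q h)) * (A t ^ l * s h)) = \<tau> ((A t ^ l * s h) * (A t ^ k * (p h + q h)))"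
      by (rule tracial)
    ultimately show ?thesis
      by simp
  qed
  have lim: "- (\<tau> (x k * U t) * \<tau> (x l * U t)) + - (\<tau> (y k * star (U t)) * \<tau> (y l * star (U t)))
        + \<tau> (z k) * \<tau> (w l) + \<tau> (w k) * \<tau> (z l) + 0 + 0
      = 2 * (r k * r l - f (Suc k) t * f (Suc l) t)"
    unfolding tx ty tz tw by simp
  show ?thesis
    using tendsto_add[OF tendsto_add[OF main e1] e2]
    unfolding lim split add_divide_distrib .
qed

lemma A_power_increment_tendsto: "((\<lambda>h. A (t + h) ^ n - A t ^ n) \<longlongrightarrow> 0) (at_right 0)"
proof -
  have U: "((\<lambda>h. U (t + h)) \<longlongrightarrow> U t) (at_right 0)"
    using tendsto_add[OF U_increment_tendsto_0[OF t] tendsto_const, of "U t"] by simp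
  have "((\<lambda>h. A (t + h) ^ n - A t ^ n) \<longlongrightarrow> A t ^ n - A t ^ n) (at_right 0)"
    unfolding A_def by (intro tendsto_intros U bounded_linear.tendsto[OF bounded_linear_star])
  then show ?thesis
    by simp
qed

text \<open>Replacing the left power at time \<open>t + h\<close> by that at time \<open>t\<close>
  costs a cubic term: a factor small in operator norm times two increments bounded by
  \<open>6 * sqrt h\<close> in L2. Then traciality joins the outer powers into
  \<open>l + j\<close>.\<close>

lemma second_order_perturbed:
  "((\<lambda>h. \<tau> (A (t + h) ^ j * \<delta> h * A t ^ k * \<delta> h * A t ^ l) / of_real h)
    \<longlongrightarrow> 2 * (r k * r (l + j) - f (Suc k) t * f (Suc (l + j)) t)) (at_right 0)"
proof -
  have e: "((\<lambda>h. 6 * norm (A (t + h) ^ j - A t ^ j)) \<longlongrightarrow> 0) (at_right 0)"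
    using tendsto_mult[OF tendsto_const[of 6] tendsto_norm_zero[OF A_power_increment_tendsto[of j]]]
    by simp
  have "((\<lambda>h. \<tau> (((A (t + h) ^ j - A t ^ j) * \<delta> h) * (A t ^ k * \<delta> h * A t ^ l)) / of_real h)
      \<longlongrightarrow> 0) (at_right 0)"
  proof (rule negligible_product[OF _ e, of _ _ 6])
    show "\<forall>\<^sub>F h in at_right 0. N ((A (t + h) ^ j - A t ^ j) * \<delta> h)
        \<le> 6 * norm (A (t + h) ^ j - A t ^ j) * sqrt h"
      using \<delta>_bound
    proof eventually_elim
      case (elim h)
      have "N ((A (t + h) ^ j - A t ^ j) * \<delta> h) \<le> norm (A (t + h) ^ j - A t ^ j) * N (\<delta> h)"
        by (rule N_mult_left)
      also have "\<dots> \<le> norm (A (t + h) ^ j - A t ^ j) * (6 * sqrt h)"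
        using elim by (intro mult_left_mono) auto
      finally show ?case
        by (simp add: mult_ac)
    qed
    show "\<forall>\<^sub>F h in at_right 0. N (A t ^ k * \<delta> h * A t ^ l) \<le> 6 * sqrt h"
      using \<delta>_bound
    proof eventually_elim
      case (elim h)
      then show ?case
        using N_sandwich[OF norm_products(3) norm_products(3), of k "\<delta> h" l] by simp
    qed
  qed
  from tendsto_add[OF second_order[of "l + j" k] this]
  have "((\<lambda>h. \<tau> (A t ^ (l + j) * \<delta> h * A t ^ k * \<delta> h) / of_real h
        + \<tau> (((A (t + h) ^ j - A t ^ j) * \<delta> h) * (A t ^ k * \<delta> h * A t ^ l)) / of_real h)
      \<longlongrightarrow> 2 * (r k * r (l + j) - f (Suc k) t * f (Suc (l + j)) t)) (at_right 0)"
    by (simp add: mult.commute)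
  moreover have "\<tau> (A t ^ (l + j) * \<delta> h * A t ^ k * \<delta> h) / of_real h
        + \<tau> (((A (t + h) ^ j - A t ^ j) * \<delta> h) * (A t ^ k * \<delta> h * A t ^ l)) / of_real h
        = \<tau> (A (t + h) ^ j * \<delta> h * A t ^ k * \<delta> h * A t ^ l) / of_real h" for h
  proof -
    have "\<tau> (A t ^ (l + j) * \<delta> h * A t ^ k * \<delta> h) = \<tau> (A t ^ j * \<delta> h * A t ^ k * \<delta> h * A t ^ l)"
      using tracial[of "A t ^ l" "A t ^ j * \<delta> h * A t ^ k * \<delta> h"] by (simp only: power_add mult.assoc)
    moreover have "\<tau> (((A (t + h) ^ j - A t ^ j) * \<delta> h) * (A t ^ k * \<delta> h * A t ^ l))
        = \<tau> (A (t + h) ^ j * \<delta> h * A t ^ k * \<delta> h * A t ^ l) - \<tau> (A t ^ j * \<delta> h * A t ^ k * \<delta> h * A t ^ l)"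
      by (subst mult.assoc, subst left_diff_distrib) (simp only: tau_diff mult.assoc)
    ultimately show ?thesis
      by (simp only: add_divide_distrib[symmetric] add_diff_cancel_left' add_diff_eq add.commute diff_add_cancel)
  qed
  ultimately show ?thesis
    by (simp only:)
qed

text \<open>Telescoping the power difference once yields the terms with one increment; telescoping
  the left powers in them again yields an exact second-order expansion whose terms have known
  limits.\<close>

lemma f_right_derivative:
  "((\<lambda>h. (f n (t + h) - f n t) / of_real h)
    \<longlongrightarrow> of_nat n * (r (n - 1) * of_real \<beta> - f n t)
      + of_nat n * (\<Sum>k<n - 1. r k * r (n - 2 - k) - f (Suc k) t * f (Suc (n - 2 - k)) t)) (at_right 0)"
proof -
  let ?g = "\<lambda>k. 2 * (r k * r (n - 2 - k) - f (Suc k) t * f (Suc (n - 2 - k)) t)"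
  have expand: "f n (t + h) - f n t = (\<Sum>i<n. \<tau> (A t ^ (n - 1) * \<delta> h)
      + (\<Sum>j<i. \<tau> (A (t + h) ^ j * \<delta> h * A t ^ (i - 1 - j) * \<delta> h * A t ^ (n - 1 - i))))" for h
  proof -
    have "f n (t + h) - f n t = (\<Sum>i<n. \<tau> (A (t + h) ^ i * \<delta> h * A t ^ (n - 1 - i)))"
      unfolding f_def
      by (simp only: tau_diff[symmetric] power_diff_telescope blinfun.sum_right)
    also have "\<dots> = (\<Sum>i<n. \<tau> (A t ^ (n - 1) * \<delta> h)
      + (\<Sum>j<i. \<tau> (A (t + h) ^ j * \<delta> h * A t ^ (i - 1 - j) * \<delta> h * A t ^ (n - 1 - i))))"
    proof (rule sum.cong)
      fix i assume "i \<in> {..<n}"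
      then have "n - 1 = n - 1 - i + i"
        by simp
      then have *: "A t ^ (n - 1) = A t ^ (n - 1 - i) * A t ^ i"
        by (metis power_add)
      have "A (t + h) ^ i * \<delta> h * A t ^ (n - 1 - i) = A t ^ i * \<delta> h * A t ^ (n - 1 - i)
          + (A (t + h) ^ i - A t ^ i) * \<delta> h * A t ^ (n - 1 - i)"
        by (simp add: left_diff_distrib)
      moreover have "\<tau> (A t ^ i * \<delta> h * A t ^ (n - 1 - i)) = \<tau> (A t ^ (n - 1) * \<delta> h)"
        using tracial[of "A t ^ (n - 1 - i)" "A t ^ i * \<delta> h"] by (simp only: * mult.assoc)
      moreover have "\<tau> ((A (t + h) ^ i - A t ^ i) * \<delta> h * A t ^ (n - 1 - i))
          = (\<Sum>j<i. \<tau> (A (t + h) ^ j * \<delta> h * A t ^ (i - 1 - j) * \<delta> h * A t ^ (n - 1 - i)))"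
        by (simp only: power_diff_telescope sum_distrib_right blinfun.sum_right)
      ultimately show "\<tau> (A (t + h) ^ i * \<delta> h * A t ^ (n - 1 - i)) = \<tau> (A t ^ (n - 1) * \<delta> h)
          + (\<Sum>j<i. \<tau> (A (t + h) ^ j * \<delta> h * A t ^ (i - 1 - j) * \<delta> h * A t ^ (n - 1 - i)))"
        by (simp only: tau_add)
    qed simp
    finally show ?thesis .
  qed
  have "((\<lambda>h. \<Sum>i<n. \<tau> (A t ^ (n - 1) * \<delta> h) / of_real h
      + (\<Sum>j<i. \<tau> (A (t + h) ^ j * \<delta> h * A t ^ (i - 1 - j) * \<delta> h * A t ^ (n - 1 - i)) / of_real h))
      \<longlongrightarrow> (\<Sum>i<n. (- f (Suc (n - 1)) t + r (n - 1) * of_real \<beta>)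
        + (\<Sum>j<i. 2 * (r (i - 1 - j) * r (n - 1 - i + j)
            - f (Suc (i - 1 - j)) t * f (Suc (n - 1 - i + j)) t)))) (at_right 0)"
    by (intro tendsto_sum tendsto_add first_order second_order_perturbed)
  then have "((\<lambda>h. (f n (t + h) - f n t) / of_real h)
      \<longlongrightarrow> (\<Sum>i<n. (- f (Suc (n - 1)) t + r (n - 1) * of_real \<beta>)
        + (\<Sum>j<i. 2 * (r (i - 1 - j) * r (n - 1 - i + j)
            - f (Suc (i - 1 - j)) t * f (Suc (n - 1 - i + j)) t)))) (at_right 0)"
    by (simp only: expand sum_divide_distrib add_divide_distrib)
  also have "(\<Sum>i<n. (- f (Suc (n - 1)) t + r (n - 1) * of_real \<beta>)
        + (\<Sum>j<i. 2 * (r (i - 1 - j) * r (n - 1 - i + j)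
            - f (Suc (i - 1 - j)) t * f (Suc (n - 1 - i + j)) t)))
      = (\<Sum>i<n. (r (n - 1) * of_real \<beta> - f n t) + (\<Sum>j<i. ?g (i - 1 - j)))"
  proof (intro sum.cong arg_cong2[where f = "(+)"])
    fix i j assume "i \<in> {..<n}" "j \<in> {..<i}"
    \<comment> \<open>The limit of a second-order term thus depends on the gap
      \<open>i - 1 - j\<close> alone.\<close>
    then have "n - 1 - i + j = n - 2 - (i - 1 - j)"
      by auto
    then show "2 * (r (i - 1 - j) * r (n - 1 - i + j)
        - f (Suc (i - 1 - j)) t * f (Suc (n - 1 - i + j)) t) = ?g (i - 1 - j)"
      by simp
  qed (auto simp: Suc_diff_1)
  \<comment> \<open>The limits are symmetric under exchanging the gap \<open>k\<close> with
    \<open>n - 2 - k\<close>; the factor 2 in \<open>?g\<close> cancels the 2 in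
    \<open>n / 2\<close>.\<close>
  also have "\<dots> = of_nat n * (r (n - 1) * of_real \<beta> - f n t) + of_nat n / 2 * (\<Sum>k<n - 1. ?g k)"
  proof -
    have "?g (n - 2 - k) = ?g k" if "k < n - 1" for k
    proof -
      have "n - 2 - (n - 2 - k) = k"
        using that by simp
      then show ?thesis
        by (simp only: mult.commute)
    qed
    from sum_triangle_symmetric[of n ?g, OF this] show ?thesis
      by (simp only: sum.distrib sum_constant card_lessThan)
  qed
  also have "of_nat n / 2 * (\<Sum>k<n - 1. ?g k)
      = of_nat n * (\<Sum>k<n - 1. r k * r (n - 2 - k) - f (Suc k) t * f (Suc (n - 2 - k)) t)"
    unfolding sum_distrib_left[symmetric] by simp
  finally show ?thesis .
qed

end

lemma f_continuous: "continuous_on {0..} (f n)"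
  unfolding f_def A_def
  by (intro continuous_intros U_continuous
      linear_continuous_on_compose[OF _ bounded_linear.linear[OF bounded_linear_star]]
      bounded_linear.continuous_on[OF bounded_linear_star])

lemma f_bound: "t \<ge> 0 \<Longrightarrow> cmod (f n t) \<le> 1"
  using Cauchy_Schwarz'[of 1 "A t ^ n"] N_le_norm[of 1] N_le_norm[of "A t ^ n"]
    unitary_norm[OF A_power_unitary, of t n] mult_mono[of "N 1" 1 "N (A t ^ n)" 1]
  by (simp add: f_def)

end

section \<open>Differentiation along characteristics\<close>

lemma right_quotient_tendsto:
  fixes F :: "real \<Rightarrow> 'b::real_normed_vector"
  assumes "(F has_vector_derivative d) (at_right t)"
  shows "((\<lambda>h. (1 / h) *\<^sub>R (F (t + h) - F t)) \<longlongrightarrow> d) (at_right 0)"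
proof -
  have "((\<lambda>y. (1 / norm (y - t)) *\<^sub>R (F y - (F t + (y - t) *\<^sub>R d))) \<longlongrightarrow> 0) (at_right t)"
    using assms unfolding has_vector_derivative_def has_derivative_within by blast
  then have "((\<lambda>h. (1 / norm (h + t - t)) *\<^sub>R (F (h + t) - (F t + (h + t - t) *\<^sub>R d))) \<longlongrightarrow> 0) (at_right 0)"
    unfolding at_right_to_0[of t] filterlim_filtermap .
  moreover have "\<forall>\<^sub>F h in at_right 0. (1 / norm (h + t - t)) *\<^sub>R (F (h + t) - (F t + (h + t - t) *\<^sub>R d))
      = (1 / h) *\<^sub>R (F (t + h) - F t) - d"
    using eventually_at_right_less[of 0]
    by eventually_elim (simp add: scaleR_diff_right scaleR_add_right add.commute)
  ultimately have "((\<lambda>h. (1 / h) *\<^sub>R (F (t + h) - F t) - d) \<longlongrightarrow> 0) (at_right 0)"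
    by (rule Lim_transform_eventually)
  then show ?thesis
    by (rule LIM_zero_cancel)
qed

text \<open>Continuous induction: the times with
  \<open>norm (F t - F a) \<le> \<epsilon> * (t - a)\<close> form a compact set, and a largest
  element below \<open>b\<close> could be increased by the limit of the right quotient
  there.\<close>

lemma zero_right_derivative_constant:
  fixes F :: "real \<Rightarrow> 'b::real_normed_vector"
  assumes ab: "a \<le> b" and cont: "continuous_on {a..b} F"
    and quot: "\<And>t. a \<le> t \<Longrightarrow> t < b \<Longrightarrow> ((\<lambda>h. (1 / h) *\<^sub>R (F (t + h) - F t)) \<longlongrightarrow> 0) (at_right 0)"
  shows "F b = F a"
proof -
  have le: "norm (F b - F a) \<le> \<epsilon> * (b - a)" if \<epsilon>: "\<epsilon> > 0" for \<epsilon>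
  proof -
    define T where "T = {t \<in> {a..b}. norm (F t - F a) \<le> \<epsilon> * (t - a)}"
    have "compact T"
    proof -
      have "closed T"
        unfolding T_def by (intro continuous_on_closed_Collect_le continuous_intros cont)
      then have "compact ({a..b} \<inter> T)"
        by (intro compact_Int_closed) auto
      moreover have "{a..b} \<inter> T = T"
        by (auto simp: T_def)
      ultimately show ?thesis
        by simp
    qed
    moreover have "a \<in> T"
      using ab by (simp add: T_def)
    ultimately obtain c where c: "c \<in> T" "\<And>t. t \<in> T \<Longrightarrow> t \<le> c"
      using compact_attains_sup[of T] by blast
    have "c = b"
    proof (rule ccontr)
      assume "c \<noteq> b"
      with c have cb: "a \<le> c" "c < b"
        by (auto simp: T_def)
      have "\<forall>\<^sub>F h in at_right 0. dist ((1 / h) *\<^sub>R (F (c + h) - F c)) 0 < \<epsilon>"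
        using quot[OF cb] \<epsilon> by (rule tendstoD)
      moreover have "\<forall>\<^sub>F h in at_right 0. h < b - c"
        using cb by (intro eventually_at_rightI[of _ "b - c"]) auto
      ultimately have "\<forall>\<^sub>F h in at_right (0::real). False"
        using eventually_at_right_less[of 0]
      proof eventually_elim
        case (elim h)
        then have "norm (F (c + h) - F c) / h < \<epsilon>"
          unfolding dist_norm diff_zero norm_scaleR by simp
        then have "norm (F (c + h) - F c) \<le> \<epsilon> * h"
          using elim by (simp add: divide_less_eq less_imp_le)
        then have "norm (F (c + h) - F a) \<le> \<epsilon> * h + \<epsilon> * (c - a)"
          using c(1) norm_triangle_ineq[of "F (c + h) - F c" "F c - F a"] by (simp add: T_def)
        then have "c + h \<in> T"
          using elim cb by (simp add: T_def algebra_simps)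
        from c(2)[OF this] elim show False
          by simp
      qed
      then show False
        by simp
    qed
    with c(1) show ?thesis
      by (simp add: T_def)
  qed
  have "norm (F b - F a) \<le> 0"
  proof (rule field_le_epsilon)
    fix e :: real assume e: "e > 0"
    have "norm (F b - F a) \<le> e / (b - a + 1) * (b - a)"
      using ab e by (intro le) simp
    also have "\<dots> \<le> e"
      using ab e by (simp add: field_simps)
    finally show "norm (F b - F a) \<le> 0 + e"
      by simp
  qed
  then show ?thesis
    by simp
qed

text \<open>Subtracting the integral of \<open>G\<close> leaves a function with right derivative 0,
  hence a constant; differentiability within the whole interval is inherited from the
  integral.\<close>

lemma continuous_right_derivative:
  fixes F :: "real \<Rightarrow> 'b::banach"
  assumes F: "continuous_on {0..} F" and G: "continuous_on {0..} G"
    and quot: "\<And>t. 0 \<le> t \<Longrightarrow> ((\<lambda>h. (1 / h) *\<^sub>R (F (t + h) - F t)) \<longlongrightarrow> G t) (at_right 0)"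
    and s: "s \<in> {0..T}"
  shows "(F has_vector_derivative G s) (at s within {0..T})"
proof -
  define J where "J t = integral {0..t} G" for t
  have J: "(J has_vector_derivative G t) (at t within {0..u})" if "t \<in> {0..u}" for t u
    unfolding J_def
    using that by (intro integral_has_vector_derivative continuous_on_subset[OF G]) auto
  have FJ: "F u = J u + F 0" if u: "0 \<le> u" for u
  proof -
    have "F u - J u = F 0 - J 0"
    proof (rule zero_right_derivative_constant[OF u])
      have "continuous_on {0..u} J"
        by (rule continuous_on_vector_derivative) (rule J)
      then show "continuous_on {0..u} (\<lambda>t. F t - J t)"
        by (intro continuous_on_diff continuous_on_subset[OF F]) auto
      fix t assume t: "0 \<le> t" "t < u"
      have "(J has_vector_derivative G t) (at t within {t..u})"
        by (rule has_vector_derivative_within_subset[OF J[of t u]]) (use t in auto)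
      then have "(J has_vector_derivative G t) (at_right t)"
        using at_within_Icc_at_right[OF t(2)] by simp
      from tendsto_diff[OF quot[OF t(1)] right_quotient_tendsto[OF this]]
      show "((\<lambda>h. (1 / h) *\<^sub>R (F (t + h) - J (t + h) - (F t - J t))) \<longlongrightarrow> 0) (at_right 0)"
        by (simp add: scaleR_diff_right algebra_simps)
    qed
    then show ?thesis
      by (simp add: J_def algebra_simps)
  qed
  have "((\<lambda>u. J u + F 0) has_vector_derivative G s + 0) (at s within {0..T})"
    by (intro has_vector_derivative_add J s has_vector_derivative_const)
  then have JF: "((\<lambda>u. J u + F 0) has_vector_derivative G s) (at s within {0..T})"
    by simp
  show ?thesis
  proof (rule has_vector_derivative_transform[OF s _ JF])
    fix u assume "u \<in> {0..T}"
    then show "F u = J u + F 0"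
      by (intro FJ) simp
  qed
qed

section \<open>Power series with quadratically growing coefficients\<close>

lemma summable_quadratic_geometric:
  fixes x :: "'b::{real_normed_field,banach}"
  assumes "norm x < 1"
  shows "summable (\<lambda>n. of_nat (Suc n) * of_nat (Suc (Suc n)) * x ^ n)"
proof -
  have "summable (\<lambda>n. diffs (\<lambda>n. 1) n * x ^ n)" if "norm x < 1" for x :: 'b
    using that by (intro termdiff_converges[of x 1]) (auto intro: summable_geometric)
  then have "summable (\<lambda>n. diffs (diffs (\<lambda>n. 1)) n * x ^ n)"
    using assms by (intro termdiff_converges[of x 1]) auto
  then show ?thesis
    by (simp add: diffs_def)
qed

text \<open>Dropping the zero term and shifting the index expresses each sum through itself and sums
  of lower degree, a linear equation with coefficient \<open>1 - z\<close>.\<close>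

lemma quadratic_geometric_suminf:
  fixes z :: complex
  assumes z: "norm z < 1"
  shows "summable (\<lambda>n. of_nat n * z ^ n)" and "summable (\<lambda>n. (of_nat n)\<^sup>2 * z ^ n)"
    and "(\<Sum>n. (of_nat n)\<^sup>2 * z ^ n) = z * (1 + z) / (1 - z) ^ 3"
proof -
  have M: "summable (\<lambda>n. of_nat (Suc n) * of_nat (Suc (Suc n)) * norm z ^ n)"
    using z by (intro summable_quadratic_geometric) simp
  show s1: "summable (\<lambda>n. of_nat n * z ^ n)"
    by (rule summable_comparison_test[OF _ M])
      (auto simp: norm_mult norm_power algebra_simps intro!: exI[of _ 0] mult_right_mono)
  show s2: "summable (\<lambda>n. (of_nat n)\<^sup>2 * z ^ n)"
    by (rule summable_comparison_test[OF _ M])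
      (auto simp: norm_mult norm_power algebra_simps power2_eq_square intro!: exI[of _ 0])
  have s0: "summable (\<lambda>n. z ^ n)"
    using z by (rule summable_geometric)
  let ?e = "\<Sum>n. of_nat n * z ^ n"
  let ?s = "\<Sum>n. (of_nat n)\<^sup>2 * z ^ n"
  have g: "(\<Sum>n. z ^ n) = 1 / (1 - z)"
    using z by (rule suminf_geometric)
  have z1: "1 - z \<noteq> 0"
    using z by auto
  have "?e = (\<Sum>n. of_nat (Suc n) * z ^ Suc n)"
    using suminf_split_head[OF s1] by simp
  also have "\<dots> = (\<Sum>n. z * (of_nat n * z ^ n + z ^ n))"
    by (simp add: algebra_simps)
  also have "\<dots> = z * (?e + (\<Sum>n. z ^ n))"
    using s0 s1 by (subst suminf_mult) (auto intro: summable_add simp: suminf_add)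
  finally have "?e * (1 - z) = z * (1 / (1 - z))"
    unfolding g by (simp add: algebra_simps)
  then have "?e = z * (1 / (1 - z)) / (1 - z)"
    by (simp only: nonzero_eq_divide_eq[OF z1])
  then have e: "?e = z / (1 - z)\<^sup>2"
    by (simp only: power2_eq_square times_divide_eq_right mult_1_right divide_divide_eq_left)
  have "?s = (\<Sum>n. (of_nat (Suc n))\<^sup>2 * z ^ Suc n)"
    using suminf_split_head[OF s2] by simp
  also have "\<dots> = (\<Sum>n. z * ((of_nat n)\<^sup>2 * z ^ n + (2 * (of_nat n * z ^ n) + z ^ n)))"
    by (simp add: algebra_simps power2_eq_square)
  also have "\<dots> = z * (?s + (2 * ?e + (\<Sum>n. z ^ n)))"
    by (intro sums_unique[symmetric] sums_mult sums_add summable_sums s0 s1 s2)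
  finally have "?s * (1 - z) = z * (2 * (z / (1 - z)\<^sup>2) + 1 / (1 - z))"
    unfolding e g by (simp add: algebra_simps)
  also have "\<dots> = z * (1 + z) / (1 - z)\<^sup>2"
    using z1 by (simp add: divide_simps power2_eq_square)
  finally have "?s = z * (1 + z) / (1 - z)\<^sup>2 / (1 - z)"
    by (simp only: nonzero_eq_divide_eq[OF z1])
  then show "?s = z * (1 + z) / (1 - z) ^ 3"
    by (simp add: power2_eq_square power3_eq_cube mult.assoc)
qed

text \<open>For the \<open>a\<close> and \<open>b\<close> of the theorem this is the mean of the
  squares of \<alpha> and \<beta> for even \<open>n\<close>, and their product for odd
  \<open>n\<close>.\<close>

definition signed_coeff :: "real \<Rightarrow> real \<Rightarrow> nat \<Rightarrow> complex" where
  "signed_coeff a b n = of_real (b\<^sup>2 + (-1) ^ n * a\<^sup>2)"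

lemma norm_signed_coeff: "norm (signed_coeff a b n) \<le> a\<^sup>2 + b\<^sup>2"
proof -
  have "norm (signed_coeff a b n) = \<bar>b\<^sup>2 + (-1) ^ n * a\<^sup>2\<bar>"
    unfolding signed_coeff_def by (rule norm_of_real)
  then show ?thesis
    by (cases "even n") (auto simp: abs_le_iff)
qed

lemma signed_suminf:
  fixes z :: complex
  assumes z: "norm z < 1"
  shows "(\<Sum>n. (of_nat n)\<^sup>2 * signed_coeff a b n * z ^ n)
    = of_real (b\<^sup>2) * (z * (1 + z) / (1 - z) ^ 3) - of_real (a\<^sup>2) * (z * (1 - z) / (1 + z) ^ 3)"
proof -
  have z': "norm (- z) < 1"
    using z by simp
  have "(\<Sum>n. (of_nat n)\<^sup>2 * signed_coeff a b n * z ^ n)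
      = (\<Sum>n. of_real (b\<^sup>2) * ((of_nat n)\<^sup>2 * z ^ n) + of_real (a\<^sup>2) * ((of_nat n)\<^sup>2 * (- z) ^ n))"
    by (simp add: signed_coeff_def power_minus[of z] algebra_simps)
  also have "\<dots> = of_real (b\<^sup>2) * (\<Sum>n. (of_nat n)\<^sup>2 * z ^ n) + of_real (a\<^sup>2) * (\<Sum>n. (of_nat n)\<^sup>2 * (- z) ^ n)"
    using quadratic_geometric_suminf(2)[OF z] quadratic_geometric_suminf(2)[OF z']
    by (simp add: suminf_add[symmetric] suminf_mult summable_mult del: of_real_power)
  finally show ?thesis
    unfolding quadratic_geometric_suminf(3)[OF z] quadratic_geometric_suminf(3)[OF z']
    by simp
qed

lemma has_vector_derivative_suminf:
  fixes u :: "nat \<Rightarrow> real \<Rightarrow> 'b::banach"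
  assumes S: "convex S" and x: "x \<in> S"
    and u: "\<And>n s. s \<in> S \<Longrightarrow> (u n has_vector_derivative u' n s) (at s within S)"
    and bound: "\<And>n s. s \<in> S \<Longrightarrow> norm (u' n s) \<le> M n" and M: "summable M"
    and sums: "\<And>s. s \<in> S \<Longrightarrow> summable (\<lambda>n. u n s)"
  shows "((\<lambda>s. \<Sum>n. u n s) has_vector_derivative (\<Sum>n. u' n x)) (at x within S)"
proof -
  have unif: "uniform_limit S (\<lambda>n s. \<Sum>i<n. u' i s) (\<lambda>s. \<Sum>i. u' i s) sequentially"
    by (rule Weierstrass_m_test[OF bound M])
  have "\<exists>g. \<forall>s\<in>S. (\<lambda>n. u n s) sums g s \<and> (g has_derivative (\<lambda>h. h *\<^sub>R (\<Sum>i. u' i s))) (at s within S)"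
  proof (rule has_derivative_series[where f = u and f' = "\<lambda>n s h. h *\<^sub>R u' n s" and x = x])
    show "convex S" "x \<in> S" "(\<lambda>n. u n x) sums (\<Sum>n. u n x)"
      by (fact S x summable_sums[OF sums[OF x]])+
    show "(u n has_derivative (\<lambda>h. h *\<^sub>R u' n s)) (at s within S)" if "s \<in> S" for n s
      using u[OF that] by (simp add: has_vector_derivative_def)
    fix e :: real assume "e > 0"
    then have "\<forall>\<^sub>F n in sequentially. \<forall>s\<in>S. dist (\<Sum>i<n. u' i s) (\<Sum>i. u' i s) < e"
      using unif by (simp add: uniform_limit_iff)
    then show "\<forall>\<^sub>F n in sequentially. \<forall>s\<in>S. \<forall>h.
        norm ((\<Sum>i<n. h *\<^sub>R u' i s) - h *\<^sub>R (\<Sum>i. u' i s)) \<le> e * norm h"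
    proof eventually_elim
      case (elim n)
      show ?case
      proof (intro ballI allI)
        fix s h assume "s \<in> S"
        then have "\<bar>h\<bar> * norm ((\<Sum>i<n. u' i s) - (\<Sum>i. u' i s)) \<le> \<bar>h\<bar> * e"
          using elim by (intro mult_left_mono) (auto simp: dist_norm less_imp_le)
        then show "norm ((\<Sum>i<n. h *\<^sub>R u' i s) - h *\<^sub>R (\<Sum>i. u' i s)) \<le> e * norm h"
          by (simp add: scaleR_sum_right[symmetric] scaleR_diff_right[symmetric] mult.commute)
      qed
    qed
  qed
  then obtain g where g: "\<And>s. s \<in> S \<Longrightarrow> (\<lambda>n. u n s) sums g s"
      "\<And>s. s \<in> S \<Longrightarrow> (g has_vector_derivative (\<Sum>i. u' i s)) (at s within S)"
    by (auto simp: has_vector_derivative_def)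
  show ?thesis
    by (rule has_vector_derivative_transform[OF x _ g(2)[OF x]]) (use g(1) in \<open>auto simp: sums_iff\<close>)
qed

text \<open>Writing \<open>F = (\<Sum>n. f n t * z ^ n)\<close>, the moment equations say
  \<open>\<partial>\<^sub>t F + z * (2 * F - 1) * \<partial>\<^sub>z F = (\<Sum>n. n\<^sup>2 * signed_coeff a b n * z ^ n)\<close>.\<close>

lemma generating_function_along_characteristic:
  fixes f :: "nat \<Rightarrow> real \<Rightarrow> complex" and y :: "real \<Rightarrow> complex"
  defines "F \<equiv> \<lambda>s. \<Sum>n. f n s * y s ^ n"
  assumes bound: "\<And>n s. s \<in> {0..T} \<Longrightarrow> norm (f n s) \<le> 1"
    and deriv: "\<And>n s. s \<in> {0..T} \<Longrightarrow> (f n has_vector_derivative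
        (of_nat n * (f n s - (\<Sum>k\<le>n. f k s * f (n - k) s)) + (of_nat n)\<^sup>2 * signed_coeff a b n))
        (at s within {0..T})"
    and y: "\<And>s. s \<in> {0..T} \<Longrightarrow> norm (y s) < 1"
    and y_deriv: "\<And>s. s \<in> {0..T} \<Longrightarrow>
        (y has_vector_derivative y s * (2 * F s - 1)) (at s within {0..T})"
    and t: "t \<in> {0..T}"
  shows "(F has_vector_derivative (\<Sum>n. (of_nat n)\<^sup>2 * signed_coeff a b n * y t ^ n)) (at t within {0..T})"
proof -
  let ?I = "{0..T}"
  let ?c = "signed_coeff a b"
  \<comment> \<open>On the compact time interval the trajectory stays in a disc of radius
    \<open>\<rho> < 1\<close>, which gives one summable majorant for all times.\<close>
  have "continuous_on ?I y"
    by (rule continuous_on_vector_derivative) (rule y_deriv)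
  then have "compact ((\<lambda>s. norm (y s)) ` ?I)"
    by (intro compact_continuous_image continuous_intros) auto
  then obtain s0 where s0: "s0 \<in> ?I" "\<And>s. s \<in> ?I \<Longrightarrow> norm (y s) \<le> norm (y s0)"
    using compact_attains_sup[of "(\<lambda>s. norm (y s)) ` ?I"] t by auto
  define \<rho> where "\<rho> = norm (y s0)"
  have \<rho>: "0 \<le> \<rho>" "\<rho> < 1" and y_le: "\<And>s. s \<in> ?I \<Longrightarrow> norm (y s) \<le> \<rho>"
    using s0 y by (auto simp: \<rho>_def)
  have geo: "summable (\<lambda>n. \<rho> ^ n)"
    using \<rho> by (intro summable_geometric) simp
  have power_le: "norm (y s ^ n) \<le> \<rho> ^ n" if "s \<in> ?I" for s n
    unfolding norm_power using y_le[OF that] by (intro power_mono) auto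
  have term_le: "norm (f n s * y s ^ n) \<le> \<rho> ^ n" if "s \<in> ?I" for n s
    using mult_mono[OF bound[OF that, of n] power_le[OF that, of n]] by (simp add: norm_mult)
  have abs_sum: "summable (\<lambda>n. norm (f n s * y s ^ n))" if "s \<in> ?I" for s
    using term_le[OF that] by (intro summable_comparison_test[OF _ geo]) auto
  have F_le: "norm (F s) \<le> 1 / (1 - \<rho>)" if "s \<in> ?I" for s
  proof -
    have "norm (F s) \<le> (\<Sum>n. norm (f n s * y s ^ n))"
      unfolding F_def by (rule summable_norm[OF abs_sum[OF that]])
    also have "\<dots> \<le> (\<Sum>n. \<rho> ^ n)"
      by (intro suminf_le term_le abs_sum that geo)
    finally show ?thesis
      using \<rho> by (simp add: suminf_geometric)
  qed
  define K where "K = 2 / (1 - \<rho>) + 1"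
  have H_le: "norm (2 * F s - 1) \<le> K" if "s \<in> ?I" for s
    using F_le[OF that] norm_triangle_ineq4[of "2 * F s" 1] by (simp add: K_def norm_mult)
  have K: "0 \<le> K"
    using \<rho> by (simp add: K_def)
  let ?conv = "\<lambda>n s. \<Sum>k\<le>n. f k s * f (n - k) s"
  let ?g = "\<lambda>n s. of_nat n * (f n s - ?conv n s) + (of_nat n)\<^sup>2 * ?c n"
  let ?u' = "\<lambda>n s. ?g n s * y s ^ n + of_nat n * f n s * y s ^ n * (2 * F s - 1)"
  let ?q = "\<lambda>n. real (Suc n) * real (Suc (Suc n))"
  have u: "((\<lambda>s. f n s * y s ^ n) has_vector_derivative ?u' n s) (at s within ?I)" if "s \<in> ?I" for n s
  proof -
    have "(((\<lambda>z. z ^ n) \<circ> y) has_vector_derivative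
        y s * (2 * F s - 1) * (of_nat n * y s ^ (n - 1))) (at s within ?I)"
      by (rule field_vector_diff_chain_within[OF y_deriv[OF that]]) (auto intro!: derivative_eq_intros)
    then have "((\<lambda>s. y s ^ n) has_vector_derivative
        y s * (2 * F s - 1) * (of_nat n * y s ^ (n - 1))) (at s within ?I)"
      by (simp add: o_def)
    also have "y s * (2 * F s - 1) * (of_nat n * y s ^ (n - 1)) = of_nat n * y s ^ n * (2 * F s - 1)"
      by (cases n) (auto simp: mult_ac)
    finally show ?thesis
      using has_vector_derivative_mult[OF deriv[OF that, of n]] by (fastforce simp: algebra_simps)
  qed
  have u_le: "norm (?u' n s) \<le> (1 + (a\<^sup>2 + b\<^sup>2) + K) * (?q n * \<rho> ^ n)" if s: "s \<in> ?I" for n s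
  proof -
    have "norm (?conv n s) \<le> (\<Sum>k\<le>n. 1)"
    proof (intro order_trans[OF norm_sum] sum_mono)
      fix k
      show "norm (f k s * f (n - k) s) \<le> 1"
        using mult_mono[OF bound[OF s, of k] bound[OF s, of "n - k"]] by (simp add: norm_mult)
    qed
    then have "norm (f n s - ?conv n s) \<le> real n + 2"
      using norm_triangle_ineq4[of "f n s" "?conv n s"] bound[OF s, of n] by simp
    then have 1: "norm (of_nat n * (f n s - ?conv n s)) \<le> real n * (real n + 2)"
      unfolding norm_mult by (simp add: mult_left_mono)
    have 2: "norm ((of_nat n)\<^sup>2 * ?c n) \<le> (real n)\<^sup>2 * (a\<^sup>2 + b\<^sup>2)"
      unfolding norm_mult by (simp add: norm_power mult_left_mono norm_signed_coeff)
    have "norm (of_nat n * f n s * (2 * F s - 1)) \<le> real n * 1 * K"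
      unfolding norm_mult using bound[OF s, of n] H_le[OF s] by (intro mult_mono) auto
    then have 3: "norm (of_nat n * f n s * (2 * F s - 1)) \<le> real n * K"
      by simp
    have "?u' n s = (of_nat n * (f n s - ?conv n s) + (of_nat n)\<^sup>2 * ?c n + of_nat n * f n s * (2 * F s - 1)) * y s ^ n"
      by (simp add: algebra_simps)
    then have "norm (?u' n s) = norm (of_nat n * (f n s - ?conv n s) + (of_nat n)\<^sup>2 * ?c n
        + of_nat n * f n s * (2 * F s - 1)) * norm (y s ^ n)"
      by (simp only: norm_mult)
    also have "\<dots> \<le> (real n * (real n + 2) + (real n)\<^sup>2 * (a\<^sup>2 + b\<^sup>2) + real n * K) * \<rho> ^ n"
      using 1 2 3 power_le[OF s, of n] \<rho> K
      by (intro mult_mono order_trans[OF norm_triangle_ineq] add_mono) (auto intro!: add_nonneg_nonneg)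
    also have "\<dots> \<le> (?q n * 1 + ?q n * (a\<^sup>2 + b\<^sup>2) + ?q n * K) * \<rho> ^ n"
    proof (intro mult_right_mono add_mono)
      show "real n * (real n + 2) \<le> ?q n * 1" "(real n)\<^sup>2 \<le> ?q n" "real n \<le> ?q n"
        by (simp_all add: algebra_simps power2_eq_square)
    qed (use \<rho> K in auto)
    finally show ?thesis
      by (simp add: algebra_simps)
  qed
  have M: "summable (\<lambda>n. (1 + (a\<^sup>2 + b\<^sup>2) + K) * (?q n * \<rho> ^ n))"
    using \<rho> by (intro summable_mult summable_quadratic_geometric) simp
  have F_deriv: "(F has_vector_derivative (\<Sum>n. ?u' n t)) (at t within ?I)"
    unfolding F_def[abs_def]
    by (rule has_vector_derivative_suminf[OF _ t _ _ M])
      (use u u_le abs_sum in \<open>auto intro: summable_norm_cancel simp: F_def\<close>)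
  define p where "p n = f n t * y t ^ n" for n
  \<comment> \<open>The terms of the series of \<open>z * F'(z)\<close>, with the derivative in
    space, at \<open>z = y t\<close>.\<close>
  define e where "e n = of_nat n * p n" for n
  have p_abs: "summable (\<lambda>n. norm (p n))"
    unfolding p_def by (rule abs_sum[OF t])
  have e_abs: "summable (\<lambda>n. norm (e n))"
  proof (rule summable_comparison_test[OF _ summable_quadratic_geometric])
    show "\<exists>N. \<forall>n\<ge>N. norm (norm (e n)) \<le> of_nat (Suc n) * of_nat (Suc (Suc n)) * \<rho> ^ n"
    proof (intro exI allI impI)
      fix n
      have "norm (e n) \<le> real n * \<rho> ^ n"
        unfolding e_def p_def norm_mult[of "of_nat n"] using term_le[OF t, of n] by (simp add: mult_left_mono)
      also have "\<dots> \<le> ?q n * \<rho> ^ n"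
        using \<rho> by (intro mult_right_mono) (auto simp: algebra_simps)
      finally show "norm (norm (e n)) \<le> of_nat (Suc n) * of_nat (Suc (Suc n)) * \<rho> ^ n"
        by simp
    qed
  qed (use \<rho> in simp)
  have e_sum: "summable e"
    by (rule summable_norm_cancel[OF e_abs])
  have cauchy: "(\<lambda>n. \<Sum>k\<le>n. p k * e (n - k)) sums ((\<Sum>n. p n) * (\<Sum>n. e n))"
    "(\<lambda>n. \<Sum>k\<le>n. e k * p (n - k)) sums ((\<Sum>n. e n) * (\<Sum>n. p n))"
    by (rule Cauchy_product_sums[OF p_abs e_abs] Cauchy_product_sums[OF e_abs p_abs])+
  \<comment> \<open>The Leibniz rule for \<open>F\<^sup>2\<close> on the level of coefficients: the
    two exponents add up to \<open>n\<close>.\<close>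
  have conv: "(\<Sum>k\<le>n. p k * e (n - k)) + (\<Sum>k\<le>n. e k * p (n - k)) = of_nat n * ?conv n t * y t ^ n" for n
  proof -
    have "(\<Sum>k\<le>n. p k * e (n - k)) + (\<Sum>k\<le>n. e k * p (n - k))
        = (\<Sum>k\<le>n. of_nat n * (f k t * f (n - k) t) * y t ^ n)"
      unfolding sum.distrib[symmetric]
    proof (rule sum.cong)
      fix k assume "k \<in> {..n}"
      then have "n = k + (n - k)"
        by simp
      then have "y t ^ n = y t ^ k * y t ^ (n - k)" "(of_nat n :: complex) = of_nat k + of_nat (n - k)"
        by (metis power_add, metis of_nat_add)
      then show "p k * e (n - k) + e k * p (n - k) = of_nat n * (f k t * f (n - k) t) * y t ^ n"
        by (simp only: p_def e_def) (simp add: algebra_simps)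
    qed simp
    then show ?thesis
      by (simp add: sum_distrib_left sum_distrib_right)
  qed
  have F_t: "F t = (\<Sum>n. p n)"
    by (simp add: F_def p_def)
  have "(\<lambda>n. of_nat n * ?conv n t * y t ^ n) sums (2 * F t * (\<Sum>n. e n))"
  proof -
    have "(\<Sum>n. p n) * (\<Sum>n. e n) + (\<Sum>n. e n) * (\<Sum>n. p n) = 2 * F t * (\<Sum>n. e n)"
      by (simp add: F_t)
    with sums_add[OF cauchy] show ?thesis
      unfolding conv by (simp only:)
  qed
  moreover have "(\<lambda>n. e n * (2 * F t)) sums ((\<Sum>n. e n) * (2 * F t))"
    by (intro sums_mult2 summable_sums e_sum)
  \<comment> \<open>Transport cancels here: motion of \<open>y\<close> contributes
    \<open>(2 * F t - 1)\<close> times the sum of \<open>e\<close>, the quadratic moment term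
    \<open>- 2 * F t\<close> times it, and the linear one the sum itself.\<close>
  ultimately have zero: "(\<lambda>n. e n * (2 * F t) - of_nat n * ?conv n t * y t ^ n) sums 0"
    using sums_diff by (fastforce simp: mult.commute)
  have "summable (\<lambda>n. (of_nat n)\<^sup>2 * ?c n * y t ^ n)"
  proof (rule summable_comparison_test)
    show "summable (\<lambda>n. (a\<^sup>2 + b\<^sup>2) * (?q n * \<rho> ^ n))"
      using \<rho> by (intro summable_mult summable_quadratic_geometric) simp
    show "\<exists>N. \<forall>n\<ge>N. norm ((of_nat n)\<^sup>2 * ?c n * y t ^ n) \<le> (a\<^sup>2 + b\<^sup>2) * (?q n * \<rho> ^ n)"
    proof (intro exI allI impI)
      fix n
      have "norm ((of_nat n)\<^sup>2 * ?c n * y t ^ n) \<le> (real n)\<^sup>2 * (a\<^sup>2 + b\<^sup>2) * \<rho> ^ n"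
        unfolding norm_mult using power_le[OF t, of n]
        by (intro mult_mono) (auto simp: norm_power norm_signed_coeff)
      also have "\<dots> \<le> ?q n * (a\<^sup>2 + b\<^sup>2) * \<rho> ^ n"
        using \<rho> by (intro mult_right_mono) (auto simp: algebra_simps power2_eq_square)
      finally show "norm ((of_nat n)\<^sup>2 * ?c n * y t ^ n) \<le> (a\<^sup>2 + b\<^sup>2) * (?q n * \<rho> ^ n)"
        by (simp only: mult_ac)
    qed
  qed
  then have "(\<lambda>n. (of_nat n)\<^sup>2 * ?c n * y t ^ n + (e n * (2 * F t) - of_nat n * ?conv n t * y t ^ n))
      sums ((\<Sum>n. (of_nat n)\<^sup>2 * ?c n * y t ^ n) + 0)"
    by (intro sums_add zero summable_sums)
  moreover have "(of_nat n)\<^sup>2 * ?c n * y t ^ n + (e n * (2 * F t) - of_nat n * ?conv n t * y t ^ n) = ?u' n t" for n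
    by (simp add: e_def p_def algebra_simps)
  ultimately have "(\<Sum>n. ?u' n t) = (\<Sum>n. (of_nat n)\<^sup>2 * ?c n * y t ^ n)"
    by (simp add: sums_iff)
  with F_deriv show ?thesis
    by simp
qed

section \<open>The differential equations of the moments\<close>

context liberation
begin

text \<open>The full convolution has two further terms, at its ends; both equal \<open>f n t\<close>
  because the zeroth moment is 1.\<close>

lemma f_convolution:
  "n > 0 \<Longrightarrow> (\<Sum>k<n - 1. f (Suc k) t * f (Suc (n - 2 - k)) t) = (\<Sum>k\<le>n. f k t * f (n - k) t) - 2 * f n t"
proof -
  assume "n > 0"
  then obtain m where m: "n = Suc m"
    by (cases n) auto
  show ?thesis
  proof (cases m)
    case (Suc l)
    have "(\<Sum>k\<le>n. f k t * f (n - k) t) = f n t + (\<Sum>k\<le>m. f (Suc k) t * f (m - k) t)"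
      unfolding m by (subst sum.atMost_Suc_shift) (simp add: f_0)
    also have "(\<Sum>k\<le>m. f (Suc k) t * f (m - k) t) = (\<Sum>k\<le>l. f (Suc k) t * f (m - k) t) + f n t"
      by (simp add: m Suc f_0)
    also have "(\<Sum>k\<le>l. f (Suc k) t * f (m - k) t) = (\<Sum>k<n - 1. f (Suc k) t * f (Suc (n - 2 - k)) t)"
      by (intro sum.cong) (auto simp: m Suc Suc_diff_le)
    finally show ?thesis
      by simp
  qed (simp add: m f_0)
qed

text \<open>For odd \<open>n\<close> each of the \<open>n - 1\<close> products, like the separate
  term, equals the product of \<alpha> and \<beta>. For even \<open>n\<close> the products are
  squares, with one more of \<alpha> than of \<beta>, and the separate term restores the
  balance.\<close>

lemma r_convolution:
  assumes a: "a = \<bar>\<alpha> - \<beta>\<bar> / 2" and b: "b = \<bar>\<alpha> + \<beta>\<bar> / 2"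
  shows "of_nat n * (r (n - 1) * of_real \<beta>) + of_nat n * (\<Sum>k<n - 1. r k * r (n - 2 - k))
    = (of_nat n)\<^sup>2 * signed_coeff a b n"
proof -
  have a2: "a\<^sup>2 = (\<alpha> - \<beta>)\<^sup>2 / 4" and b2: "b\<^sup>2 = (\<alpha> + \<beta>)\<^sup>2 / 4"
    by (simp_all add: a b power_divide)
  show ?thesis
  proof (cases "even n")
    case True
    have even_coeff: "signed_coeff a b n = of_real ((\<alpha>\<^sup>2 + \<beta>\<^sup>2) / 2)"
      using True unfolding signed_coeff_def a2 b2
      by (intro arg_cong[where f = of_real]) (simp add: power2_eq_square field_simps)
    show ?thesis
    proof (cases "n = 0")
      case False
      with True obtain m where m: "n = 2 * Suc m"
        by (metis dvdE mult_zero_right not0_implies_Suc)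
      have "(\<Sum>k<n - 1. r k * r (n - 2 - k)) = (\<Sum>k<n - 1. r k * r k)"
      proof (rule sum.cong)
        fix k assume "k \<in> {..<n - 1}"
        then have "even (n - 2 - k) \<longleftrightarrow> even k"
          using True by (auto simp: m)
        then show "r k * r (n - 2 - k) = r k * r k"
          by (simp add: r_def)
      qed simp
      also have "\<dots> = (\<Sum>k<Suc (2 * m). r k * r k)"
        by (simp add: m)
      also have "\<dots> = of_nat (Suc m) * (of_real \<alpha>)\<^sup>2 + of_nat m * (of_real \<beta>)\<^sup>2"
        by (induction m) (auto simp: r_def power2_eq_square algebra_simps)
      finally have sum: "(\<Sum>k<n - 1. r k * r (n - 2 - k))
          = of_nat (Suc m) * (of_real \<alpha>)\<^sup>2 + of_nat m * (of_real \<beta>)\<^sup>2" .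
      show ?thesis
        unfolding even_coeff sum by (simp add: m r_def power2_eq_square field_simps)
    qed simp
  next
    case False
    have odd_coeff: "signed_coeff a b n = of_real (\<alpha> * \<beta>)"
      using False unfolding signed_coeff_def a2 b2
      by (intro arg_cong[where f = of_real]) (simp add: power2_eq_square field_simps)
    obtain m where m: "n = 2 * m + 1"
      using False by (rule oddE)
    have sum: "(\<Sum>k<n - 1. r k * r (n - 2 - k)) = (\<Sum>k<2 * m. of_real (\<alpha> * \<beta>))"
    proof (rule sum.cong)
      fix k assume "k \<in> {..<2 * m}"
      then have "2 * m = (n - 2 - k) + Suc k"
        by (simp add: m)
      then have "even ((n - 2 - k) + Suc k)"
        by (metis dvd_triv_left)
      then have "even (n - 2 - k) \<longleftrightarrow> odd k"
        unfolding even_add by simp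
      then show "r k * r (n - 2 - k) = of_real (\<alpha> * \<beta>)"
        by (auto simp: r_def)
    qed (simp add: m)
    show ?thesis
      unfolding odd_coeff sum by (simp add: m r_def power2_eq_square algebra_simps)
  qed
qed

text \<open>Passing to the full convolution adds \<open>2 * f n t\<close>, which turns the damping
  term \<open>- n * f n t\<close> into \<open>+ n * f n t\<close>.\<close>

lemma moment_equation:
  assumes a: "a = \<bar>\<alpha> - \<beta>\<bar> / 2" and b: "b = \<bar>\<alpha> + \<beta>\<bar> / 2" and t: "t \<in> {0..T}"
  shows "(f n has_vector_derivative
      (of_nat n * (f n t - (\<Sum>k\<le>n. f k t * f (n - k) t)) + (of_nat n)\<^sup>2 * signed_coeff a b n))
    (at t within {0..T})"
proof (rule continuous_right_derivative[where
      G = "\<lambda>t. of_nat n * (f n t - (\<Sum>k\<le>n. f k t * f (n - k) t)) + (of_nat n)\<^sup>2 * signed_coeff a b n"])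
  show "continuous_on {0..} (f n)"
    by (rule f_continuous)
  show "continuous_on {0..} (\<lambda>t. of_nat n * (f n t - (\<Sum>k\<le>n. f k t * f (n - k) t))
      + (of_nat n)\<^sup>2 * signed_coeff a b n)"
    by (intro continuous_intros f_continuous)
  fix t :: real assume "0 \<le> t"
  note f_right_derivative[OF this, of n]
  also have "of_nat n * (r (n - 1) * of_real \<beta> - f n t)
      + of_nat n * (\<Sum>k<n - 1. r k * r (n - 2 - k) - f (Suc k) t * f (Suc (n - 2 - k)) t)
      = (of_nat n * (r (n - 1) * of_real \<beta>) + of_nat n * (\<Sum>k<n - 1. r k * r (n - 2 - k)))
        - of_nat n * f n t - of_nat n * (\<Sum>k<n - 1. f (Suc k) t * f (Suc (n - 2 - k)) t)"
    by (simp add: sum_subtractf right_diff_distrib)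
  also have "\<dots> = of_nat n * (f n t - (\<Sum>k\<le>n. f k t * f (n - k) t)) + (of_nat n)\<^sup>2 * signed_coeff a b n"
    unfolding r_convolution[OF a b]
  proof (cases "n = 0")
    case False
    then show "(of_nat n)\<^sup>2 * signed_coeff a b n - of_nat n * f n t
        - of_nat n * (\<Sum>k<n - 1. f (Suc k) t * f (Suc (n - 2 - k)) t)
        = of_nat n * (f n t - (\<Sum>k\<le>n. f k t * f (n - k) t)) + (of_nat n)\<^sup>2 * signed_coeff a b n"
      by (subst f_convolution) (simp_all add: algebra_simps)
  qed simp
  finally show "((\<lambda>h. (1 / h) *\<^sub>R (f n (t + h) - f n t)) \<longlongrightarrow>
      of_nat n * (f n t - (\<Sum>k\<le>n. f k t * f (n - k) t)) + (of_nat n)\<^sup>2 * signed_coeff a b n) (at_right 0)"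
    by (simp add: scaleR_conv_of_real divide_inverse mult.commute)
qed (rule t)

end

text \<open>On the circle the kernel is \<open>2 / (1 - cnj \<zeta> * z) - 1\<close>, whose
  geometric series is dominated by the powers of \<open>norm z\<close> and may be integrated
  termwise.\<close>

lemma herglotz_power_series:
  assumes prob: "prob_space \<nu>" and sets: "sets \<nu> = sets borel"
    and circle: "AE \<zeta> in \<nu>. \<zeta> \<in> sphere 0 1" and z: "norm z < 1"
  shows "herglotz \<nu> z = 2 * (\<Sum>n. cnj (\<integral>\<zeta>. \<zeta> ^ n \<partial>\<nu>) * z ^ n) - 1"
proof -
  interpret prob_space \<nu>
    by (rule prob)
  let ?u = "\<lambda>n \<zeta>. cnj (\<zeta> ^ n) * z ^ n"
  have meas: "?u n \<in> borel_measurable \<nu>" for n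
    unfolding measurable_cong_sets[OF sets refl]
    by (intro borel_measurable_continuous_onI continuous_intros)
  have bound: "AE \<zeta> in \<nu>. norm (?u n \<zeta>) \<le> norm z ^ n" for n
    using circle by eventually_elim (simp add: norm_mult norm_power)
  have int: "integrable \<nu> (?u n)" for n
    using bound[of n] meas[of n] by (rule integrable_const_bound)
  have geo: "summable (\<lambda>n. norm z ^ n)"
    using z by (intro summable_geometric) simp
  have AE_sum: "AE \<zeta> in \<nu>. summable (\<lambda>n. norm (?u n \<zeta>))"
    using circle by eventually_elim (simp add: norm_mult norm_power z)
  have norm_sum: "summable (\<lambda>n. \<integral>\<zeta>. norm (?u n \<zeta>) \<partial>\<nu>)"
  proof (rule summable_comparison_test[OF _ geo], intro exI allI impI)
    fix n
    have "(\<integral>\<zeta>. norm (?u n \<zeta>) \<partial>\<nu>) \<le> (\<integral>\<zeta>. norm z ^ n \<partial>\<nu>)"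
      using bound[of n] int[of n] by (intro integral_mono_AE) auto
    also have "\<dots> = norm z ^ n"
      by (simp add: prob_space)
    finally show "norm (\<integral>\<zeta>. norm (?u n \<zeta>) \<partial>\<nu>) \<le> norm z ^ n"
      by (simp add: integral_nonneg_AE)
  qed
  have "herglotz \<nu> z = (\<integral>\<zeta>. 2 * (\<Sum>n. ?u n \<zeta>) - 1 \<partial>\<nu>)"
    unfolding herglotz_def
  proof (rule integral_cong_AE)
    show "(\<lambda>\<zeta>. (\<zeta> + z) / (\<zeta> - z)) \<in> borel_measurable \<nu>"
      unfolding measurable_cong_sets[OF sets refl] by simp
    show "(\<lambda>\<zeta>. 2 * (\<Sum>n. ?u n \<zeta>) - 1) \<in> borel_measurable \<nu>"
      by (intro borel_measurable_diff borel_measurable_times borel_measurable_suminf meas) auto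
    show "AE \<zeta> in \<nu>. (\<zeta> + z) / (\<zeta> - z) = 2 * (\<Sum>n. ?u n \<zeta>) - 1"
      using circle
    proof eventually_elim
      case (elim \<zeta>)
      then have \<zeta>: "cnj \<zeta> * \<zeta> = 1" "norm \<zeta> = 1"
        using complex_norm_square[of \<zeta>] by (simp_all add: mult.commute)
      then have ne: "\<zeta> - z \<noteq> 0" "\<zeta> \<noteq> 0"
        using z by auto
      have small: "norm (cnj \<zeta> * z) < 1"
        using \<zeta> z by (simp add: norm_mult)
      have "(\<Sum>n. ?u n \<zeta>) = (\<Sum>n. (cnj \<zeta> * z) ^ n)"
        by (simp add: power_mult_distrib)
      also have "\<dots> = 1 / (1 - cnj \<zeta> * z)"
        by (rule suminf_geometric[OF small])
      also have "1 - cnj \<zeta> * z = cnj \<zeta> * (\<zeta> - z)"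
        using \<zeta> by (simp add: right_diff_distrib)
      also have "1 / (cnj \<zeta> * (\<zeta> - z)) = \<zeta> / (\<zeta> - z)"
        using \<zeta> ne by (simp add: divide_simps mult.commute)
      finally have sum: "(\<Sum>n. ?u n \<zeta>) = \<zeta> / (\<zeta> - z)" .
      show ?case
        unfolding sum using ne by (simp add: divide_simps)
    qed
  qed
  also have "\<dots> = 2 * (\<integral>\<zeta>. (\<Sum>n. ?u n \<zeta>) \<partial>\<nu>) - 1"
    using integrable_suminf[OF int AE_sum norm_sum]
    by (subst Bochner_Integration.integral_diff) (auto simp: prob_space)
  also have "(\<integral>\<zeta>. (\<Sum>n. ?u n \<zeta>) \<partial>\<nu>) = (\<Sum>n. \<integral>\<zeta>. ?u n \<zeta> \<partial>\<nu>)"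
    by (rule integral_suminf[OF int AE_sum norm_sum])
  also have "\<dots> = (\<Sum>n. cnj (\<integral>\<zeta>. \<zeta> ^ n \<partial>\<nu>) * z ^ n)"
    by (simp flip: complex_cnj_power)
  finally show ?thesis .
qed

definition radial_potential :: "real \<Rightarrow> real \<Rightarrow> complex \<Rightarrow> complex" where
  "radial_potential a b z = of_real a * ((1 - z) / (1 + z)) + of_real b * ((1 + z) / (1 - z))"

lemma radial_potential_square_derivative:
  assumes z: "norm z < 1"
  obtains d where "((\<lambda>w. (radial_potential a b w)\<^sup>2) has_field_derivative d) (at z within X)"
    and "z * d = 4 * (\<Sum>n. (of_nat n)\<^sup>2 * signed_coeff a b n * z ^ n)"
proof
  have ne: "1 + z \<noteq> 0" "1 - z \<noteq> 0"
    using z by (auto simp: add_eq_0_iff)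
  let ?d = "2 * radial_potential a b z * (of_real b * (2 / (1 - z)\<^sup>2) - of_real a * (2 / (1 + z)\<^sup>2))"
  have l: "((\<lambda>w. (1 - w) / (1 + w)) has_field_derivative - (2 / (1 + z)\<^sup>2)) (at z within X)"
    using ne by (auto intro!: derivative_eq_intros simp: power2_eq_square divide_simps)
  have k: "((\<lambda>w. (1 + w) / (1 - w)) has_field_derivative 2 / (1 - z)\<^sup>2) (at z within X)"
    using ne by (auto intro!: derivative_eq_intros simp: power2_eq_square divide_simps)
  have "(radial_potential a b has_field_derivative
      of_real b * (2 / (1 - z)\<^sup>2) - of_real a * (2 / (1 + z)\<^sup>2)) (at z within X)"
    unfolding radial_potential_def[abs_def]
    using DERIV_add[OF DERIV_cmult[OF l, of "of_real a"] DERIV_cmult[OF k, of "of_real b"]] by simp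
  from DERIV_power[OF this, of 2]
  show "((\<lambda>w. (radial_potential a b w)\<^sup>2) has_field_derivative ?d) (at z within X)"
    by (simp add: mult_ac)
  define p q where "p = 1 + z" and "q = 1 - z"
  have pq: "p \<noteq> 0" "q \<noteq> 0"
    using ne by (auto simp: p_def q_def)
  \<comment> \<open>The mixed terms in \<open>a * b\<close> cancel: each is
    \<open>2 * a * b / (p * q)\<close>, with opposite signs.\<close>
  have "radial_potential a b z * (of_real b * (2 / q\<^sup>2) - of_real a * (2 / p\<^sup>2))
      = 2 * ((of_real b)\<^sup>2 * (p / q ^ 3) - (of_real a)\<^sup>2 * (q / p ^ 3))"
    unfolding radial_potential_def p_def[symmetric] q_def[symmetric]
    using pq by (simp add: field_simps power2_eq_square power3_eq_cube)
  then have "z * ?d = 4 * (z * ((of_real b)\<^sup>2 * (p / q ^ 3) - (of_real a)\<^sup>2 * (q / p ^ 3)))"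
    unfolding p_def q_def by (simp add: mult_ac)
  then show "z * ?d = 4 * (\<Sum>n. (of_nat n)\<^sup>2 * signed_coeff a b n * z ^ n)"
    unfolding signed_suminf[OF z] p_def q_def by (simp add: right_diff_distrib mult_ac)
qed

section \<open>Conservation along the Loewner flow\<close>

theorem proposition3p4:
  fixes P :: "('a::cstar_algebra \<Rightarrow>\<^sub>L complex) set"
    and \<tau> :: "'a \<Rightarrow>\<^sub>L complex"
    and R S :: 'a
    and U :: "real \<Rightarrow> 'a"
    and \<alpha> \<beta> a b :: real
    and \<nu> :: "real \<Rightarrow> complex measure"
    and H \<phi> \<eta> :: "real \<Rightarrow> complex \<Rightarrow> complex"
  assumes "wstar_probability_space P \<tau>"
    and "symmetry R" and "symmetry S"
    and "\<tau> R = of_real \<alpha>" and "\<tau> S = of_real \<beta>"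
    and "free_unitary_brownian_motion P \<tau> U"
    and "free_sets \<tau> (U ` {0..}) {R, S}"
    and "\<And>t. t \<ge> 0 \<Longrightarrow> spectral_distribution \<tau> (R * U t * S * star (U t)) (\<nu> t)"
    and "\<And>t z. t \<ge> 0 \<Longrightarrow> z \<in> ball 0 1 \<Longrightarrow> H t z = herglotz (\<nu> t) z"
    and "a = \<bar>\<alpha> - \<beta>\<bar> / 2" and "b = \<bar>\<alpha> + \<beta>\<bar> / 2"
    and "radial_loewner_flow H \<phi>"
    and "\<And>t. t \<ge> 0 \<Longrightarrow> conformal_onto (\<phi> t) (loewner_domain H t) (ball 0 1)"
    and "\<And>t z. t \<ge> 0 \<Longrightarrow> z \<in> ball 0 1 \<Longrightarrow> \<eta> t z = inv_into (loewner_domain H t) (\<phi> t) z"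
  shows "\<forall>t\<ge>0. \<forall>z\<in>ball 0 1. K_transform a b H t z = K_transform a b H 0 (\<eta> t z)"
proof (intro allI impI ballI)
  fix t :: real and z :: complex
  assume t: "0 \<le> t" and z: "z \<in> ball 0 1"
  obtain \<A> B where "filtration P \<A>" "free_brownian_motion \<tau> \<A> B" "U 0 = 1" "continuous_on {0..} U"
      "\<forall>t\<ge>0. unitary (U t) \<and> U t \<in> \<A> t"
      "\<forall>t\<ge>0. \<exists>Y. has_free_ito_integral \<tau> U B t Y \<and>
        U t = U 0 + \<i> *\<^sub>C Y - (1/2) *\<^sub>R integral {0..t} U"
    using assms(6) unfolding free_unitary_brownian_motion_def by blast
  then interpret liberation P \<tau> \<A> B U R S \<alpha> \<beta>
    using assms(1-5,7)
    by (intro liberation.intro free_unitary_bm.intro free_unitary_bm_axioms.intro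
        liberation_axioms.intro) auto
  have H_series: "H s w = 2 * (\<Sum>n. f n s * w ^ n) - 1" if "0 \<le> s" "norm w < 1" for s w
  proof -
    have sd: "spectral_distribution \<tau> (A s) (\<nu> s)"
      using assms(8)[OF that(1)] by (simp add: A_def)
    then have "(\<integral>\<zeta>. \<zeta> ^ n \<partial>\<nu> s) = f n s" for n
      by (simp add: spectral_distribution_def f_def)
    then show ?thesis
      using sd herglotz_power_series[of "\<nu> s" w] assms(9)[OF that(1), of w] that f_real[OF that(1)]
      by (simp add: spectral_distribution_def)
  qed
  define x where "x = \<eta> t z"
  have bij: "bij_betw (\<phi> t) (loewner_domain H t) (ball 0 1)"
    using assms(13)[OF t] by (simp add: conformal_onto_def)
  then have x: "x \<in> loewner_domain H t" "\<phi> t x = z"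
    using assms(14)[OF t z] z inv_into_into[of z "\<phi> t" "loewner_domain H t"]
      f_inv_into_f[of z "\<phi> t" "loewner_domain H t"]
    by (simp_all add: x_def bij_betw_imp_surj_on)
  have x_ball: "x \<in> ball 0 1"
    using x(1) by (simp add: loewner_domain_def)
  \<comment> \<open>A lifetime exceeding \<open>t\<close> exceeds all earlier times, so the flow
    equation holds along the whole trajectory of \<open>x\<close>.\<close>
  have domain: "x \<in> loewner_domain H s" if "s \<in> {0..t}" for s
    using x(1) that by (auto simp: loewner_domain_def intro: le_less_trans[of "ereal s" "ereal t"])
  define y where "y s = \<phi> s x" for s
  have flow: "y s \<in> ball 0 1 \<and> (y has_vector_derivative y s * H s (y s)) (at s within {0..})"
    if "s \<in> {0..t}" for s
    using assms(12) domain[OF that] that unfolding radial_loewner_flow_def y_def[abs_def] by auto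
  have y_ball: "norm (y s) < 1" if "s \<in> {0..t}" for s
    using flow[OF that] by simp
  let ?F = "\<lambda>s. \<Sum>n. f n s * y s ^ n"
  have y_deriv: "(y has_vector_derivative y s * (2 * ?F s - 1)) (at s within {0..t})"
    if "s \<in> {0..t}" for s
  proof -
    have "(y has_vector_derivative y s * H s (y s)) (at s within {0..t})"
      by (rule has_vector_derivative_within_subset[of _ _ _ "{0..}"]) (use flow[OF that] in auto)
    then show ?thesis
      using H_series[of s "y s"] y_ball[OF that] that by simp
  qed
  define W where "W s = (2 * ?F s - 1)\<^sup>2 - (radial_potential a b (y s))\<^sup>2" for s
  have W_deriv: "(W has_vector_derivative 0) (at s within {0..t})" if s: "s \<in> {0..t}" for s
  proof -
    let ?c = "\<Sum>n. (of_nat n)\<^sup>2 * signed_coeff a b n * y s ^ n"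
    have F: "(?F has_vector_derivative ?c) (at s within {0..t})"
      by (rule generating_function_along_characteristic[OF _ moment_equation[OF assms(10,11)]
            y_ball y_deriv s]) (auto intro: f_bound)
    have "((\<lambda>w. (2 * w - 1)\<^sup>2) has_field_derivative 4 * (2 * ?F s - 1)) (at (?F s) within ?F ` {0..t})"
      by (auto intro!: derivative_eq_intros)
    from field_vector_diff_chain_within[OF F this]
    have 1: "((\<lambda>s. (2 * ?F s - 1)\<^sup>2) has_vector_derivative ?c * (4 * (2 * ?F s - 1))) (at s within {0..t})"
      by (simp add: o_def)
    obtain d where d: "((\<lambda>w. (radial_potential a b w)\<^sup>2) has_field_derivative d) (at (y s) within y ` {0..t})"
      "y s * d = 4 * ?c"
      using radial_potential_square_derivative[OF y_ball[OF s]] by blast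
    from field_vector_diff_chain_within[OF y_deriv[OF s] d(1)]
    have 2: "((\<lambda>s. (radial_potential a b (y s))\<^sup>2) has_vector_derivative
        y s * (2 * ?F s - 1) * d) (at s within {0..t})"
      by (simp add: o_def)
    \<comment> \<open>Both squares grow at the rate \<open>4 * ?c * (2 * ?F s - 1)\<close>: the
      first through the source term, the second because the velocity of \<open>y\<close> carries the
      same factor and \<open>y s * d\<close> is \<open>4 * ?c\<close>.\<close>
    have "p * (4 * q) - y s * q * d = (4 * p - y s * d) * q" for p q
      by (simp add: algebra_simps)
    then have "?c * (4 * (2 * ?F s - 1)) - y s * (2 * ?F s - 1) * d = 0"
      by (simp only: d(2) diff_self mult_zero_left)
    then show ?thesis
      using has_vector_derivative_diff[OF 1 2] unfolding W_def by (simp only:)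
  qed
  obtain c where "\<And>s. s \<in> {0..t} \<Longrightarrow> W s = c"
    using has_vector_derivative_zero_constant[of "{0..t}" W] W_deriv by auto
  then have W: "W t = W 0"
    using t by simp
  have W_eq: "W s = (H s (y s))\<^sup>2 - (radial_potential a b (y s))\<^sup>2" if "s \<in> {0..t}" for s
    using H_series[of s "y s"] y_ball[OF that] that by (simp add: W_def)
  have "y 0 = x"
    using assms(12) x_ball by (simp add: radial_loewner_flow_def y_def)
  then have "(H t z)\<^sup>2 - (radial_potential a b z)\<^sup>2 = (H 0 x)\<^sup>2 - (radial_potential a b x)\<^sup>2"
    using W W_eq[of t] W_eq[of 0] t x(2) by (simp add: y_def)
  then show "K_transform a b H t z = K_transform a b H 0 (\<eta> t z)"
    by (simp add: K_transform_def radial_potential_def x_def)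
qed

end
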